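(* Let $a,b,c$ be complex numbers with $\operatorname{Re}a\le\operatorname{Re}b$ and $c\notin\{0,-1,-2,\dots\}$. The shifted hypergeometric function $f(z)=z\,{}_2F_1(a,b;c;z)$ is universally starlike if and only if either $a,b,c$ are positive real numbers with $0<a\le 1$ and $0<b<c$, or $f(z)=z(1-z)^{-k}$ for some $k\in[0,1]$.
   Context: Let $\Lambda=\mathbb C\setminus[1,+\infty)=\{z\neq1:|\arg(1-z)|<\pi\}$. An analytic function $f$ on $\Lambda$ with $f(0)=0$, $f'(0)=1$ is called universally starlike if it maps every disk or half-plane $\Omega\subset\Lambda$ with $0\in\Omega$ univalently onto a domain starlike with respect to the origin. For complex parameters $a,b,c$ with $c\notin\{0,-1,-2,\dots\}$, ${}_2F_1(a,b;c;z)=\sum_{n=0}^\infty\frac{(a)_n(b)_n}{(c)_n\,n!}z^n$ for $|z|<1$, where $(a)_0=1$ and $(a)_n=a(a+1)\cdots(a+n-1)$ for $n\ge1$; on $\Lambda$ it denotes the (single-valued) analytic continuation of this series. Powers of $1-z$ on $\Lambda$ are principal branches. *)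

theory Defs
  imports "HOL-Complex_Analysis.Complex_Analysis"
begin

definition slit_plane :: "complex set" where
  "slit_plane = UNIV - complex_of_real ` {1..}"

definition open_disk :: "complex set \<Rightarrow> bool" where
  "open_disk D \<longleftrightarrow> (\<exists>w r. r > 0 \<and> D = ball w r)"

definition open_half_plane :: "complex set \<Rightarrow> bool" where
  "open_half_plane H \<longleftrightarrow> (\<exists>w t. w \<noteq> 0 \<and> H = {z. w \<bullet> z < t})"

text \<open>The library predicate \<open>starlike\<close> leaves the centre existentially quantified;
  here it has to be the origin.\<close>

definition starlike_domain_wrt_0 :: "complex set \<Rightarrow> bool" where
  "starlike_domain_wrt_0 D \<longleftrightarrow>
     open D \<and> connected D \<and> 0 \<in> D \<and> (\<forall>w\<in>D. closed_segment 0 w \<subseteq> D)"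

definition universally_starlike :: "(complex \<Rightarrow> complex) \<Rightarrow> bool" where
  "universally_starlike f \<longleftrightarrow>
     f holomorphic_on slit_plane \<and> f 0 = 0 \<and> deriv f 0 = 1 \<and>
     (\<forall>\<Omega>. (open_disk \<Omega> \<or> open_half_plane \<Omega>) \<and> \<Omega> \<subseteq> slit_plane \<and> 0 \<in> \<Omega> \<longrightarrow>
        inj_on f \<Omega> \<and> starlike_domain_wrt_0 (f ` \<Omega>))"

definition hyp2F1_series :: "complex \<Rightarrow> complex \<Rightarrow> complex \<Rightarrow> complex \<Rightarrow> complex" where
  "hyp2F1_series a b c z =
     (\<Sum>n. pochhammer a n * pochhammer b n / (pochhammer c n * fact n) * z ^ n)"

text \<open>The analytic continuation of the series to the slit plane.  For \<open>c\<close> not a nonpositive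
  integer such a function exists classically, and by the identity theorem its values on
  the slit plane are unique; the values on the cut \<open>[1, \<infinity>)\<close> are irrelevant.\<close>

definition hyp2F1 :: "complex \<Rightarrow> complex \<Rightarrow> complex \<Rightarrow> complex \<Rightarrow> complex" where
  "hyp2F1 a b c =
     (SOME F. F holomorphic_on slit_plane \<and> (\<forall>z\<in>ball 0 1. F z = hyp2F1_series a b c z))"

end

theory Submission
  imports Defs
begin

text \<open>
  Write \<open>f z = z F z\<close> and \<open>p z = z f'(z) / f z = 1 + z E z\<close> with \<open>E = F' / F\<close>.  Every disk or half-plane
  \<open>\<Omega>\<close> containing \<open>0\<close> is a Moebius image of the unit disk under some \<open>\<phi>\<close> with \<open>\<phi> 0 = 0\<close> and
  \<open>w \<phi>'(w) / \<phi> w = 1 + \<mu> \<phi> w\<close>, so starlikeness on \<open>\<Omega>\<close> amounts to \<open>Re (p z (1 + \<mu> z)) \<ge> 0\<close> on \<open>\<Omega>\<close>.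

  Sufficiency: \<open>p = (1 - a) + a g\<close> where \<open>g = F(a+1,b;c) / F(a,b;c)\<close>.  The convergents of Gauss's continued
  fraction for \<open>1 / g\<close> take values in the cone spanned by \<open>1\<close> and \<open>1 - z\<close>, and both \<open>1 + \<mu> z\<close> and
  \<open>(1 + \<mu> z) cnj (1 - z)\<close> have positive real part on \<open>\<Omega>\<close>; Montel's theorem passes to the limit.

  Necessity: suitable choices of \<open>\<mu>\<close> show that \<open>p\<close>, \<open>z p\<close> and \<open>- (1 - z) p / z\<close> map the upper half-plane
  into its closure.  The boundary Schwarz-Pick (Julia) inequality at \<open>0\<close> and at \<open>- \<infinity>\<close> turns this into
  \<open>E' 0 \<le> E 0\<close> and \<open>(E 0)\<^sup>2 \<le> l E' 0\<close>, where \<open>- l\<close> is the limit of \<open>x E x\<close> at \<open>- \<infinity>\<close>.  The Riccati equation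
  for \<open>E\<close> gives \<open>l = a\<close> or \<open>l = b\<close> and expresses \<open>E 0\<close> and \<open>E' 0\<close> through \<open>a, b, c\<close>; the inequalities then say
  exactly that the parameters are in the asserted range.  Its imaginary part on the real axis forces
  \<open>E = k / (1 - z)\<close> when the parameters are not real.
\<close>

section \<open>Analytic continuation of the hypergeometric series\<close>

text \<open>The two inequalities for \<open>E\<close> have a moment meaning. Classically
  \<open>E z\<close> is the integral of \<open>t / (1 - t z)\<close> against a positive measure on
  [0,1]; then \<open>E 0\<close> and \<open>E' 0\<close> are its first and second moments and
  \<open>l\<close> is its mass on (0,1]. So \<open>E' 0 \<le> E 0\<close> is
  \<open>t^2 \<le> t\<close> under the integral, and \<open>(E 0)^2 \<le> l E' 0\<close> is the
  Cauchy-Schwarz inequality. The Julia inequality gives both without a representing measure: at the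
  pole of \<open>- (1 - z) p / z\<close> it removes the part \<open>- 1 / z\<close>, and at minus
  infinity it removes the linear part \<open>(1 - l) z\<close> of \<open>z p\<close>. A point mass
  at 1 gives equality in both and makes \<open>F\<close> a power of \<open>1 - z\<close>. This is
  why \<open>a b = 0\<close>, \<open>c = a\<close> and \<open>c = b\<close> are split off before the
  inequalities are evaluated. That \<open>l\<close> is \<open>a\<close> or \<open>b\<close> comes
  from monotonicity: \<open>x E x\<close> is monotone and bounded on the negative axis, and at minus
  infinity the Riccati equation degenerates to a quadratic with roots \<open>a\<close> and
  \<open>b\<close>. The continuation itself is constructed from Euler's integral for large
  parameters, followed by first-order lowering operators.\<close>

lemma slit_plane_iff: "z \<in> slit_plane \<longleftrightarrow> Im z \<noteq> 0 \<or> Re z < 1"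
proof -
  have "z \<in> complex_of_real ` {1..} \<longleftrightarrow> Im z = 0 \<and> Re z \<ge> 1"
    by (auto simp: image_iff complex_eq_iff intro!: bexI[of _ "Re z"])
  then show ?thesis by (auto simp: slit_plane_def)
qed

lemma scaleR_slit_plane:
  assumes "z \<in> slit_plane" "0 \<le> t" "t \<le> 1"
  shows "t *\<^sub>R z \<in> slit_plane"
proof (cases "Im z = 0 \<or> t = 0")
  case True
  have "t * Re z < 1" if "Re z < 1"
    using assms that mult_left_mono[of "Re z" 1 t] by (cases "t = 1") auto
  with True assms show ?thesis by (auto simp: slit_plane_iff)
qed (use assms in \<open>auto simp: slit_plane_iff\<close>)

lemma one_minus_mult_neq_0:
  assumes "z \<in> slit_plane" "0 \<le> t" "t \<le> 1"
  shows "1 - of_real t * z \<noteq> 0"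
proof
  assume "1 - of_real t * z = 0"
  then have "t *\<^sub>R z = 1" by (simp add: scaleR_conv_of_real)
  with scaleR_slit_plane[OF assms] show False by (simp add: slit_plane_iff)
qed

lemma open_slit_plane: "open slit_plane"
proof -
  have "closed (complex_of_real ` {1..})"
    by (intro closed_injective_linear_image linear_of_real) (auto simp: inj_def)
  then show ?thesis by (auto simp: slit_plane_def open_Diff)
qed

lemma starlike_slit_plane: "z \<in> slit_plane \<Longrightarrow> closed_segment 0 z \<subseteq> slit_plane"
  using scaleR_slit_plane by (auto simp: in_segment)

lemma zero_in_slit_plane [simp]: "0 \<in> slit_plane"
  by (simp add: slit_plane_iff)

lemma connected_slit_plane: "connected slit_plane"
  using starlike_slit_plane by (intro starlike_imp_connected) (auto simp: starlike_def intro!: bexI[of _ 0])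

lemma ball_subset_slit_plane: "ball 0 1 \<subseteq> slit_plane"
proof
  fix z :: complex assume "z \<in> ball 0 1"
  then have "Re z < 1" using complex_Re_le_cmod[of z] by simp
  then show "z \<in> slit_plane" by (simp add: slit_plane_iff)
qed

lemma one_minus_slit_plane: "z \<in> slit_plane \<Longrightarrow> 1 - z \<notin> \<real>\<^sub>\<le>\<^sub>0"
  by (auto simp: slit_plane_iff complex_nonpos_Reals_iff)

text \<open>Identity theorem at 0: identities between functions on the slit plane become identities
  of formal power series, to be checked coefficientwise.\<close>

lemma slit_plane_eqI:
  assumes "f holomorphic_on slit_plane" "g holomorphic_on slit_plane"
    "f has_fps_expansion S" "g has_fps_expansion S" "z \<in> slit_plane"
  shows "f z = g z"
proof -
  have "(\<lambda>z. f z - g z) has_fps_expansion (S - S)"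
    using assms by (intro fps_expansion_intros)
  then have "f z - g z = 0"
    by (intro has_fps_expansion_0_analytic_continuation[of "\<lambda>z. f z - g z" slit_plane]
        holomorphic_intros assms open_slit_plane connected_slit_plane) auto
  then show ?thesis by simp
qed

section \<open>Contiguous relations as identities of formal power series\<close>

definition hyp_fps :: "complex \<Rightarrow> complex \<Rightarrow> complex \<Rightarrow> complex fps" where
  "hyp_fps a b c = Abs_fps (\<lambda>n. pochhammer a n * pochhammer b n / (pochhammer c n * fact n))"

lemma hyp_fps_nth:
  "fps_nth (hyp_fps a b c) n = pochhammer a n * pochhammer b n / (pochhammer c n * fact n)"
  by (simp add: hyp_fps_def)

lemma pochhammer_neq_0: "(c :: complex) \<notin> \<int>\<^sub>\<le>\<^sub>0 \<Longrightarrow> pochhammer c n \<noteq> 0"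
  using pochhammer_eq_0_iff[of c n] by auto

lemma not_nonpos_Int_plus_nat: "(c :: complex) \<notin> \<int>\<^sub>\<le>\<^sub>0 \<Longrightarrow> c + of_nat n \<notin> \<int>\<^sub>\<le>\<^sub>0"
proof
  assume "c + of_nat n \<in> \<int>\<^sub>\<le>\<^sub>0"
  then have "c + of_nat n - of_nat n \<in> \<int>\<^sub>\<le>\<^sub>0" by (rule nonpos_Ints_diff_Nats) auto
  moreover assume "c \<notin> \<int>\<^sub>\<le>\<^sub>0"
  ultimately show False by simp
qed

lemma hyp_fps_commute: "hyp_fps a b c = hyp_fps b a c"
  by (simp add: hyp_fps_def mult_ac)

lemma hyp_fps_Suc:
  assumes "c \<notin> \<int>\<^sub>\<le>\<^sub>0"
  shows "fps_nth (hyp_fps a b c) (Suc n) * ((c + of_nat n) * of_nat (Suc n)) =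
         (a + of_nat n) * (b + of_nat n) * fps_nth (hyp_fps a b c) n"
proof -
  have nz: "c + of_nat n \<noteq> 0" "of_nat (Suc n) \<noteq> (0::complex)" "pochhammer c n \<noteq> 0"
    using not_nonpos_Int_plus_nat[OF assms, of n] pochhammer_neq_0[OF assms] by (auto simp del: of_nat_Suc)
  show ?thesis
    unfolding hyp_fps_nth pochhammer_Suc fact_Suc using nz by (simp add: divide_simps del: of_nat_Suc)
qed

lemma pochhammer_plus1: "(a::complex) * pochhammer (a + 1) n = (a + of_nat n) * pochhammer a n"
  by (metis pochhammer_Suc pochhammer_rec mult.commute)

lemma fps_X_mult_deriv_nth: "fps_nth (fps_X * fps_deriv (S :: complex fps)) n = of_nat n * fps_nth S n"
  by (cases n) auto

lemma fps_X_mult_Suc_nth: "fps_nth (fps_X * (S :: complex fps)) (Suc n) = fps_nth S n"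
  by simp

text \<open>On coefficients \<open>X d/dX\<close> is multiplication by \<open>n\<close>, and
  \<open>c (c+1)_n = (c + n) (c)_n\<close>. The right side is a first-order operator applied to the
  series for \<open>c + 1\<close>, so a continuation for \<open>c + 1\<close> yields one for
  \<open>c\<close>.\<close>

lemma hyp_fps_lower_c:
  assumes "c \<notin> \<int>\<^sub>\<le>\<^sub>0"
  shows "fps_const c * hyp_fps a b c = fps_const c * hyp_fps a b (c + 1) + fps_X * fps_deriv (hyp_fps a b (c + 1))"
proof (rule fps_ext)
  fix n
  have nz: "c \<noteq> 0" "pochhammer c n \<noteq> 0" "c + of_nat n \<noteq> 0"
    using assms pochhammer_neq_0[OF assms, of n] not_nonpos_Int_plus_nat[OF assms, of n] by auto
  have 1: "pochhammer (c+1) n = (c + of_nat n) * pochhammer c n / c"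
    using pochhammer_plus1[of c n] nz by (simp add: field_simps)
  have "c * fps_nth (hyp_fps a b c) n = (c + of_nat n) * fps_nth (hyp_fps a b (c + 1)) n"
    unfolding hyp_fps_nth 1 using nz by simp
  then show "fps_nth (fps_const c * hyp_fps a b c) n =
    fps_nth (fps_const c * hyp_fps a b (c + 1) + fps_X * fps_deriv (hyp_fps a b (c + 1))) n"
    by (simp add: fps_X_mult_deriv_nth distrib_right del: fps_X_mult_nth)
qed

text \<open>The same mechanism in an upper parameter: \<open>a (a+1)_n = (a + n) (a)_n\<close>. This
  is the source of \<open>z F' = a (g - 1) F\<close>, hence of
  \<open>p = (1 - a) + a g\<close>.\<close>

lemma hyp_fps_shift_a:
  "fps_const a * hyp_fps (a + 1) b c = fps_const a * hyp_fps a b c + fps_X * fps_deriv (hyp_fps a b c)"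
proof (rule fps_ext)
  fix n
  have "a * fps_nth (hyp_fps (a + 1) b c) n = (a * pochhammer (a + 1) n) * (pochhammer b n / (pochhammer c n * fact n))"
    by (simp add: hyp_fps_nth)
  also have "\<dots> = (a + of_nat n) * fps_nth (hyp_fps a b c) n"
    by (simp add: hyp_fps_nth pochhammer_plus1)
  finally show "fps_nth (fps_const a * hyp_fps (a + 1) b c) n =
    fps_nth (fps_const a * hyp_fps a b c + fps_X * fps_deriv (hyp_fps a b c)) n"
    by (simp add: fps_X_mult_deriv_nth distrib_right del: fps_X_mult_nth)
qed

lemma hyp_fps_ode:
  fixes a b c :: complex
  assumes "c \<notin> \<int>\<^sub>\<le>\<^sub>0"
  defines "S \<equiv> hyp_fps a b c"
  shows "fps_X * (1 - fps_X) * fps_deriv (fps_deriv S) + (fps_const c - fps_const (a + b + 1) * fps_X) * fps_deriv S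
     = fps_const (a * b) * S" (is "?L = ?R")
proof (rule fps_ext)
  fix n
  define N s0 s1 where "N = (of_nat n :: complex)" "s0 = fps_nth S n" "s1 = fps_nth S (Suc n)"
  note N_def = this(1) and s0_def = this(2) and s1_def = this(3)
  \<comment> \<open>Rewritten through \<open>X d/dX\<close>, whose action on coefficients is known;
    the claim is then the two-term recursion \<open>hyp_fps_Suc\<close>.\<close>
  have L: "?L = fps_X * fps_deriv (fps_deriv S) - fps_X * (fps_deriv (fps_X * fps_deriv S) - fps_deriv S)
     + fps_const c * fps_deriv S - fps_const (a + b + 1) * (fps_X * fps_deriv S)"
    by (simp add: algebra_simps)
  have "fps_nth ?L n = N * ((N + 1) * s1) - (N * (N * s0) - N * s0) + c * ((N + 1) * s1) - (a + b + 1) * (N * s0)"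
  proof -
    have "fps_nth (fps_X * (fps_deriv (fps_X * fps_deriv S) - fps_deriv S)) n = N * (N * s0) - N * s0"
      by (simp only: right_diff_distrib fps_sub_nth fps_X_mult_deriv_nth N_def s0_def)
    then show ?thesis
      unfolding L fps_sub_nth[of _ "fps_const _ * _"] fps_sub_nth[of "fps_X * fps_deriv (fps_deriv S)"]
        fps_add_nth fps_X_mult_deriv_nth fps_mult_left_const_nth N_def s0_def s1_def
      by (simp add: fps_deriv_nth add.commute)
  qed
  also have "\<dots> = s1 * ((c + N) * (N + 1)) - (a + N) * (b + N) * s0 + a * b * s0"
    by (simp add: algebra_simps)
  also have "\<dots> = a * b * s0"
    using hyp_fps_Suc[OF assms(1), of a b n] unfolding S_def[symmetric] s0_def[symmetric] s1_def[symmetric]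
    by (simp add: N_def add.commute)
  finally show "fps_nth ?L n = fps_nth ?R n" by (simp add: s0_def)
qed

text \<open>Lowering operator in \<open>b\<close>. The factor \<open>c - b - 1\<close> can be
  divided out only where it is nonzero, which dictates the order of descent in
  \<open>hyp_continuable\<close>.\<close>

lemma hyp_fps_lower_b:
  fixes a b c :: complex
  assumes "c \<notin> \<int>\<^sub>\<le>\<^sub>0"
  defines "S \<equiv> hyp_fps a (b + 1) c"
  shows "fps_const (c - b - 1) * hyp_fps a b c =
     fps_X * (1 - fps_X) * fps_deriv S + (fps_const (c - b - 1) - fps_const a * fps_X) * S" (is "?L = ?R")
proof (rule fps_ext)
  fix n
  have *: "?R = fps_X * fps_deriv S - fps_X * (fps_X * fps_deriv S) + fps_const (c - b - 1) * S - fps_const a * (fps_X * S)"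
    by (simp add: algebra_simps)
  show "fps_nth ?L n = fps_nth ?R n"
  proof (cases n)
    case 0 then show ?thesis unfolding * by (simp add: S_def hyp_fps_nth)
  next
    case (Suc m)
    define N :: complex where "N = of_nat m"
    have sN: "of_nat (Suc m) = N + 1" by (simp add: N_def)
    have 1: "fps_nth ?R n = (N + c - b) * fps_nth S (Suc m) - (a + N) * fps_nth S m"
      unfolding * Suc fps_sub_nth fps_add_nth fps_mult_left_const_nth
      by (simp add: fps_X_mult_Suc_nth fps_X_mult_deriv_nth N_def del: of_nat_Suc fps_deriv_nth fps_X_mult_nth)
         (simp add: algebra_simps)
    have nz: "pochhammer c n \<noteq> 0" "pochhammer c m \<noteq> 0" "c + N \<noteq> 0" "N + 1 \<noteq> 0"
      using assms pochhammer_neq_0[OF assms(1)] not_nonpos_Int_plus_nat[OF assms(1), of m] sN[symmetric]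
      by (auto simp: N_def simp del: of_nat_Suc)
    have 2: "pochhammer b (Suc m) = b * pochhammer (b + 1) m" by (simp add: pochhammer_rec)
    have 3: "fps_nth S (Suc m) = (a + N) * (b + 1 + N) / ((c + N) * (N + 1)) * fps_nth S m"
      using hyp_fps_Suc[OF assms(1), of a "b + 1" m] nz unfolding S_def sN N_def[symmetric]
      by (simp add: eq_divide_eq)
    have 4: "fps_nth (hyp_fps a b c) (Suc m) = (a + N) * b / ((c + N) * (N + 1)) * fps_nth S m"
      using nz by (simp add: S_def hyp_fps_nth 2 pochhammer_Suc[of a] pochhammer_Suc[of c] sN N_def[symmetric] del: of_nat_Suc)
         (simp add: divide_simps)
    have "(c - b - 1) * ((a + N) * b / ((c + N) * (N + 1))) =
       (N + c - b) * ((a + N) * (b + 1 + N) / ((c + N) * (N + 1))) - (a + N)"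
      using nz by (simp add: divide_simps) (simp add: algebra_simps)
    then have "(c - b - 1) * ((a + N) * b / ((c + N) * (N + 1))) * fps_nth S m =
       ((N + c - b) * ((a + N) * (b + 1 + N) / ((c + N) * (N + 1))) - (a + N)) * fps_nth S m" by simp
    then show ?thesis unfolding 1 3 unfolding Suc fps_mult_left_const_nth 4
      by (simp only: mult.assoc left_diff_distrib)
  qed
qed

text \<open>With \<open>A + 1\<close> in place of \<open>A\<close>, this relation and the next one
  express the series for \<open>(A + 1, B, C)\<close> and for \<open>(A, B, C)\<close> through the
  same two series; their quotient is one step of Gauss's continued fraction.\<close>

lemma hyp_fps_contiguous1:
  assumes "C \<notin> \<int>\<^sub>\<le>\<^sub>0"
  shows "fps_const B * hyp_fps A (B + 1) (C + 1) + fps_const (C - B) * hyp_fps A B (C + 1) = fps_const C * hyp_fps A B C"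
proof (rule fps_ext)
  fix n
  have nz: "C \<noteq> 0" "pochhammer C n \<noteq> 0" "C + of_nat n \<noteq> 0"
    using assms pochhammer_neq_0[OF assms, of n] not_nonpos_Int_plus_nat[OF assms, of n] by auto
  define K where "K = pochhammer A n * pochhammer B n / (pochhammer (C+1) n * fact n)"
  have 1: "pochhammer (C+1) n = (C + of_nat n) * pochhammer C n / C"
    using pochhammer_plus1[of C n] nz by (simp add: field_simps)
  have "B * (pochhammer A n * pochhammer (B + 1) n / (pochhammer (C+1) n * fact n)) =
     pochhammer A n * (B * pochhammer (B + 1) n) / (pochhammer (C+1) n * fact n)" by simp
  also have "\<dots> = (B + of_nat n) * K" unfolding pochhammer_plus1 K_def by simp
  finally have "B * (pochhammer A n * pochhammer (B + 1) n / (pochhammer (C+1) n * fact n)) + (C - B) * K = (C + of_nat n) * K"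
    by (simp add: algebra_simps)
  also have "\<dots> = C * (pochhammer A n * pochhammer B n / (pochhammer C n * fact n))"
    unfolding K_def 1 using nz by simp
  finally show "fps_nth (fps_const B * hyp_fps A (B + 1) (C + 1) + fps_const (C - B) * hyp_fps A B (C + 1)) n =
      fps_nth (fps_const C * hyp_fps A B C) n"
    by (simp add: hyp_fps_nth K_def)
qed

lemma hyp_fps_contiguous2:
  assumes "C \<notin> \<int>\<^sub>\<le>\<^sub>0"
  shows "fps_const B * (1 - fps_X) * hyp_fps (A + 1) (B + 1) (C + 1) + fps_const (C - B) * hyp_fps (A + 1) B (C + 1)
    = fps_const C * hyp_fps A B C" (is "?L = ?R")
proof (rule fps_ext)
  fix n
  have *: "?L = fps_const C * hyp_fps (A+1) B C - fps_const B * (fps_X * hyp_fps (A + 1) (B + 1) (C + 1))"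
    unfolding hyp_fps_contiguous1[OF assms, symmetric] by (simp add: algebra_simps)
  have C1: "C + 1 \<notin> \<int>\<^sub>\<le>\<^sub>0" using not_nonpos_Int_plus_nat[OF assms, of 1] by simp
  show "fps_nth ?L n = fps_nth ?R n"
  proof (cases n)
    case 0 then show ?thesis unfolding * by (simp add: hyp_fps_nth)
  next
    case (Suc m)
    define N :: complex where "N = of_nat m"
    have sN: "of_nat (Suc m) = N + 1" by (simp add: N_def)
    define P where "P = pochhammer (A + 1) m * pochhammer (B + 1) m / (pochhammer (C + 1) m * fact m)"
    have nz: "C \<noteq> 0" "N + 1 \<noteq> 0" "pochhammer (C + 1) m \<noteq> 0"
      using assms pochhammer_neq_0[OF C1] sN[symmetric] by (auto simp del: of_nat_Suc)
    have 1: "pochhammer C (Suc m) = C * pochhammer (C + 1) m"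
       "pochhammer B (Suc m) = B * pochhammer (B + 1) m"
       "pochhammer A (Suc m) = A * pochhammer (A + 1) m"
       "pochhammer (A+1) (Suc m) = (A + 1 + N) * pochhammer (A + 1) m"
      unfolding N_def by (rule pochhammer_rec, rule pochhammer_rec, rule pochhammer_rec, rule pochhammer_rec')
    have 2: "C * fps_nth (hyp_fps (A + 1) B C) (Suc m) = (A + 1 + N) * B / (N + 1) * P"
      unfolding hyp_fps_nth 1 fact_Suc sN P_def using nz by (simp add: mult_ac)
    have 3: "C * fps_nth (hyp_fps A B C) (Suc m) = A * B / (N + 1) * P"
      unfolding hyp_fps_nth 1 fact_Suc sN P_def using nz by (simp add: mult_ac)
    have "(A + 1 + N) * B / (N + 1) - B = A * B / (N + 1)"
      using nz by (simp add: divide_simps) (simp add: algebra_simps)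
    then have "(A + 1 + N) * B / (N + 1) * P - B * P = A * B / (N + 1) * P"
      by (metis left_diff_distrib)
    then show ?thesis unfolding * Suc fps_sub_nth fps_mult_left_const_nth 2 3
      by (simp add: hyp_fps_nth P_def)
  qed
qed

section \<open>Euler's integral: holomorphy, power series and moments\<close>

lemma pochhammer_binomial_sums:
  assumes "norm (z :: complex) < 1"
  shows "(\<lambda>n. pochhammer a n / fact n * z ^ n) sums (1 - z) powr (-a)"
proof -
  have "(\<lambda>n. ((-a) gchoose n) * (- z) ^ n) sums (1 + (-z)) powr (-a)"
    by (rule gen_binomial_complex) (use assms in simp)
  also have "(\<lambda>n. ((-a) gchoose n) * (- z) ^ n) = (\<lambda>n. pochhammer a n / fact n * z ^ n)"
    by (simp add: gbinomial_pochhammer fun_eq_iff power_minus[of z])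
  finally show ?thesis by simp
qed

lemma continuous_on_powr_const:
  fixes a :: complex
  assumes "continuous_on S f" "\<And>x. x \<in> S \<Longrightarrow> f x \<notin> \<real>\<^sub>\<le>\<^sub>0"
  shows "continuous_on S (\<lambda>x. f x powr a)"
proof (rule continuous_on_powr_complex)
  show "S \<subseteq> {x. 0 \<le> Re (f x) \<or> Im (f x) \<noteq> 0}"
  proof
    fix x assume "x \<in> S"
    from assms(2)[OF this] show "x \<in> {x. 0 \<le> Re (f x) \<or> Im (f x) \<noteq> 0}"
      unfolding complex_nonpos_Reals_iff mem_Collect_eq by linarith
  qed
  show "Re a > 0" if "x \<in> S" "f x = 0" for x using assms(2)[OF that(1)] that(2) by simp
qed (use assms in \<open>auto intro: continuous_on_const\<close>)

text \<open>Differentiation under the integral sign; the segment from 0 to \<open>z\<close> stays in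
  the slit plane, so the branch cut of the power is never met.\<close>

lemma euler_transform_holomorphic:
  fixes a :: complex
  assumes "continuous_on {0..1} \<phi>"
  shows "(\<lambda>z. integral {0..1} (\<lambda>t. \<phi> t * (1 - of_real t * z) powr (-a))) holomorphic_on slit_plane"
proof (rule analytic_imp_holomorphic, unfold analytic_on_def, intro ballI)
  fix z0 assume "z0 \<in> slit_plane"
  then obtain e where e: "e > 0" "ball z0 e \<subseteq> slit_plane"
    using open_slit_plane openE by blast
  have nz: "1 - of_real t * z \<notin> \<real>\<^sub>\<le>\<^sub>0" if "z \<in> ball z0 e" "t \<in> {0..1}" for z t
    using scaleR_slit_plane[of z t] one_minus_slit_plane[of "t *\<^sub>R z"] that e
    by (auto simp: scaleR_conv_of_real)
  have "(\<lambda>z. integral (cbox 0 1) (\<lambda>t. \<phi> t * (1 - of_real t * z) powr (-a))) holomorphic_on ball z0 e"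
  proof (rule leibniz_rule_holomorphic)
    fix z t assume zt: "z \<in> ball z0 e" "t \<in> cbox (0::real) 1"
    show "((\<lambda>z. \<phi> t * (1 - of_real t * z) powr (-a)) has_field_derivative
       (\<phi> t * (-a * (1 - of_real t * z) powr (-a - 1) * (- of_real t)))) (at z within ball z0 e)"
      using nz[of z t] zt
      by (auto intro!: derivative_eq_intros)
  next
    fix z assume "z \<in> ball z0 e"
    then have "continuous_on {0..1} (\<lambda>t. \<phi> t * (1 - of_real t * z) powr (-a))"
      by (intro continuous_on_mult assms continuous_on_powr_const nz) (auto intro!: continuous_intros)
    then show "(\<lambda>t. \<phi> t * (1 - of_real t * z) powr (-a)) integrable_on cbox 0 1"
      by (simp add: integrable_continuous_real)
  next
    have c: "continuous_on (ball z0 e \<times> cbox 0 1) (\<lambda>x. \<phi> (snd x))"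
      by (rule continuous_on_compose2[OF assms]) (auto intro: continuous_intros)
    have "continuous_on (ball z0 e \<times> cbox 0 1)
      (\<lambda>x. \<phi> (snd x) * (-a * (1 - of_real (snd x) * fst x) powr (-a - 1) * (- of_real (snd x))))"
      by (intro continuous_on_mult c continuous_on_powr_const nz continuous_on_const) (auto intro!: continuous_intros)
    then show "continuous_on (ball z0 e \<times> cbox 0 1)
      (\<lambda>(z, t). \<phi> t * (-a * (1 - of_real t * z) powr (-a - 1) * (- of_real t)))"
      by (simp add: case_prod_unfold)
  qed auto
  then show "\<exists>e>0. (\<lambda>z. integral {0..1} (\<lambda>t. \<phi> t * (1 - of_real t * z) powr (-a))) holomorphic_on ball z0 e"
    using e by auto
qed

text \<open>The binomial series is integrated termwise; a bound for the continuous kernel provides a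
  majorant independent of \<open>t\<close>.\<close>

lemma euler_transform_sums:
  fixes z a :: complex
  assumes "continuous_on {0..1} \<phi>" "norm z < 1"
  shows "(\<lambda>n. pochhammer a n / fact n * integral {0..1} (\<lambda>t. \<phi> t * of_real t ^ n) * z ^ n) sums
    integral {0..1} (\<lambda>t. \<phi> t * (1 - of_real t * z) powr (-a))"
proof -
  have "compact (\<phi> ` {0..1})" by (intro compact_continuous_image assms) auto
  then obtain K where K: "\<And>t. t \<in> {0..1} \<Longrightarrow> norm (\<phi> t) \<le> K"
    by (metis bounded_iff compact_imp_bounded imageI)
  define T where "T n t = \<phi> t * (pochhammer a n / fact n * (of_real t * z) ^ n)" for n t
  have nt: "norm (of_real t * z) < 1" if "t \<in> {0..1}" for t :: real
    using that le_less_trans[OF mult_left_le_one_le[of "norm z" t] assms(2)] by (simp add: norm_mult)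
  have Tsum: "(\<lambda>n. T n t) sums (\<phi> t * (1 - of_real t * z) powr (-a))" if "t \<in> {0..1}" for t
    unfolding T_def by (intro sums_mult pochhammer_binomial_sums nt that)
  have "uniform_limit {0..1} (\<lambda>N t. \<Sum>n<N. T n t) (\<lambda>t. suminf (\<lambda>n. T n t)) sequentially"
  proof (rule Weierstrass_m_test)
    fix n t assume t: "t \<in> {0..1::real}"
    have "t ^ n * norm z ^ n \<le> 1 * norm z ^ n"
      using t by (intro mult_right_mono power_le_one) auto
    then have "norm (pochhammer a n / fact n) * (t ^ n * norm z ^ n) \<le> norm (pochhammer a n / fact n) * norm z ^ n"
      by (intro mult_left_mono) auto
    then have "norm (\<phi> t) * (norm (pochhammer a n / fact n) * (t ^ n * norm z ^ n)) \<le>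
        K * (norm (pochhammer a n / fact n) * norm z ^ n)"
      using K[OF t] t by (intro mult_mono[OF K[OF t]] order.trans[OF norm_ge_zero K[OF t]] mult_nonneg_nonneg) auto
    then show "norm (T n t) \<le> K * norm (pochhammer a n / fact n * z ^ n)"
      using t by (simp add: T_def norm_mult norm_power power_mult_distrib norm_divide)
  next
    \<comment> \<open>An intermediate radius turns convergence at \<open>r\<close> into absolute
      convergence at \<open>z\<close>.\<close>
    obtain r where r: "norm z < r" "r < 1" using assms(2) dense by blast
    have "summable (\<lambda>n. pochhammer a n / fact n * (of_real r :: complex) ^ n)"
      using pochhammer_binomial_sums[of "of_real r" a] r norm_ge_zero[of z] by (auto simp: sums_iff)
    then have "summable (\<lambda>n. norm (pochhammer a n / fact n * z ^ n))"
      by (rule powser_insidea) (use r in auto)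
    then show "summable (\<lambda>n. K * norm (pochhammer a n / fact n * z ^ n))" by (rule summable_mult)
  qed
  then have u: "uniform_limit {0..1} (\<lambda>N t. \<Sum>n<N. T n t) (\<lambda>t. \<phi> t * (1 - of_real t * z) powr (-a)) sequentially"
    by (rule uniform_limit_cong'[THEN iffD1, rotated -1]) (use Tsum in \<open>auto simp: sums_iff\<close>)
  have cT: "continuous_on {0..1} (T n)" for n
    unfolding T_def by (intro continuous_intros assms)
  obtain I J where IJ: "\<And>N. ((\<lambda>t. \<Sum>n<N. T n t) has_integral I N) {0..1}"
     "((\<lambda>t. \<phi> t * (1 - of_real t * z) powr (-a)) has_integral J) {0..1}" "I \<longlonglongrightarrow> J"
    by (rule uniform_limit_integral[OF u]) (auto intro!: continuous_on_sum cT)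
  have iT: "integral {0..1} (T n) = pochhammer a n / fact n * integral {0..1} (\<lambda>t. \<phi> t * of_real t ^ n) * z ^ n" for n
  proof -
    have "T n = (\<lambda>t. (pochhammer a n / fact n * z ^ n) * (\<phi> t * of_real t ^ n))"
      by (simp add: T_def fun_eq_iff power_mult_distrib)
    then have "integral {0..1} (T n) = (pochhammer a n / fact n * z ^ n) * integral {0..1} (\<lambda>t. \<phi> t * of_real t ^ n)"
      by (simp only: integral_mult_right)
    then show ?thesis by (simp only: mult_ac)
  qed
  have I: "I N = (\<Sum>n<N. integral {0..1} (T n))" for N
  proof -
    have "((\<lambda>t. \<Sum>n<N. T n t) has_integral (\<Sum>n<N. integral {0..1} (T n))) {0..1}"
      by (intro has_integral_sum integrable_integral integrable_continuous_real cT) auto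
    then show ?thesis using IJ(1) has_integral_unique by blast
  qed
  show ?thesis using IJ(3) unfolding sums_def iT[symmetric] I[symmetric] integral_unique[OF IJ(2)] .
qed

text \<open>Vanishing moments annihilate polynomials, hence by Weierstrass all continuous test
  functions; testing with the real and imaginary parts of \<open>\<phi>\<close> leaves vanishing
  integrals of squares.\<close>

lemma all_moments_zero_imp_zero:
  fixes \<phi> :: "real \<Rightarrow> complex"
  assumes "continuous_on {0..1} \<phi>" "\<And>n. integral {0..1} (\<lambda>t. \<phi> t * of_real t ^ n) = 0" "t \<in> {0..1}"
  shows "\<phi> t = 0"
proof -
  have *: "integral {0..1} (\<lambda>t. \<phi> t * of_real (p t)) = 0" if p: "real_polynomial_function p" for p
  proof -
    obtain a n where "p = (\<lambda>x. \<Sum>i\<le>n. a i * x ^ i)" using p unfolding real_polynomial_function_iff_sum by blast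
    then have "(\<lambda>t. \<phi> t * of_real (p t)) = (\<lambda>t. \<Sum>i\<le>n. of_real (a i) * (\<phi> t * of_real t ^ i))"
      by (simp add: sum_distrib_left mult_ac)
    moreover have "(\<lambda>t. of_real (a i) * (\<phi> t * of_real t ^ i)) integrable_on {0..1}" for i
      by (intro integrable_continuous_real continuous_intros assms)
    ultimately show ?thesis using assms(2) by (simp add: integral_sum)
  qed
  have z: "integral {0..1} (\<lambda>t. \<phi> t * of_real (g t)) = 0" if g: "continuous_on {0..1} g" for g :: "real \<Rightarrow> real"
  proof -
    have "compact (\<phi> ` {0..1})" by (intro compact_continuous_image assms) auto
    then obtain K where K: "\<And>t. t \<in> {0..1} \<Longrightarrow> norm (\<phi> t) \<le> K"
      by (metis bounded_iff compact_imp_bounded imageI)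
    have K0: "K \<ge> 0" using order.trans[OF norm_ge_zero K[of 0]] by simp
    have bnd: "norm (integral {0..1} (\<lambda>t. \<phi> t * of_real (g t))) \<le> (K + 1) * e" if e: "e > 0" for e
    proof -
      obtain p where p: "real_polynomial_function p" "\<And>x. x \<in> {0..1} \<Longrightarrow> \<bar>g x - p x\<bar> < e"
        using Stone_Weierstrass_real_polynomial_function[OF _ g e] by auto
      have cp: "continuous_on {0..1} p"
        using p(1) by (simp add: continuous_on_polymonial_function real_polynomial_function_eq)
      have "integral {0..1} (\<lambda>t. \<phi> t * of_real (g t)) =
         integral {0..1} (\<lambda>t. \<phi> t * of_real (g t)) - integral {0..1} (\<lambda>t. \<phi> t * of_real (p t))"
        by (simp add: *[OF p(1)])
      also have "\<dots> = integral {0..1} (\<lambda>t. \<phi> t * of_real (g t) - \<phi> t * of_real (p t))"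
        by (intro integral_diff[symmetric] integrable_continuous_real continuous_intros assms g cp)
      finally have eq: "integral {0..1} (\<lambda>t. \<phi> t * of_real (g t)) = integral {0..1} (\<lambda>t. \<phi> t * of_real (g t) - \<phi> t * of_real (p t))" .
      have "norm (integral {0..1} (\<lambda>t. \<phi> t * of_real (g t) - \<phi> t * of_real (p t))) \<le> ((K + 1) * e) * (1 - 0)"
      proof (rule integral_bound)
        show "continuous_on {0..1} (\<lambda>t. \<phi> t * of_real (g t) - \<phi> t * of_real (p t))"
          by (intro continuous_intros assms g cp)
        fix x :: real assume x: "x \<in> {0..1}"
        have "norm (\<phi> x * of_real (g x) - \<phi> x * of_real (p x)) = norm (\<phi> x) * \<bar>g x - p x\<bar>"
          by (metis norm_mult norm_of_real of_real_diff right_diff_distrib)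
        also have "\<dots> \<le> (K + 1) * e"
          using K[OF x] p(2)[OF x] K0 by (intro mult_mono) auto
        finally show "norm (\<phi> x * of_real (g x) - \<phi> x * of_real (p x)) \<le> (K + 1) * e" .
      qed auto
      then show ?thesis using eq by simp
    qed
    define x where "x = norm (integral {0..1} (\<lambda>t. \<phi> t * of_real (g t)))"
    \<comment> \<open>This choice of \<open>e\<close> in the bound would give
      \<open>x \<le> x / 2\<close>.\<close>
    have "x \<le> (K + 1) * (x / (2 * (K + 1)))" if "x > 0"
    proof -
      have "0 < x / (2 * (K + 1))" using that K0 by simp
      from bnd[OF this] show ?thesis unfolding x_def .
    qed
    moreover have "(K + 1) * (x / (2 * (K + 1))) = x / 2" using K0 by (simp add: add_nonneg_eq_0_iff field_simps)
    moreover have "x \<ge> 0" by (simp add: x_def)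
    ultimately have "x = 0" by linarith
    then show ?thesis by (simp add: x_def)
  qed
  have c: "continuous_on {0..1} (\<lambda>t. Re (\<phi> t))" "continuous_on {0..1} (\<lambda>t. Im (\<phi> t))"
    by (intro continuous_intros assms)+
  have i: "(\<lambda>t. \<phi> t * of_real (Re (\<phi> t))) integrable_on {0..1}" "(\<lambda>t. \<phi> t * of_real (Im (\<phi> t))) integrable_on {0..1}"
    by (intro integrable_continuous_real continuous_intros assms c)+
  have "integral {0..1} (\<lambda>t. (Re (\<phi> t))\<^sup>2) = 0"
    using z[OF c(1)] integral_linear[OF i(1) bounded_linear_Re] by (simp add: o_def power2_eq_square)
  moreover have "integral {0..1} (\<lambda>t. (Im (\<phi> t))\<^sup>2) = 0"
    using z[OF c(2)] integral_linear[OF i(2) bounded_linear_Im] by (simp add: o_def power2_eq_square)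
  ultimately have "(Re (\<phi> t))\<^sup>2 = 0" "(Im (\<phi> t))\<^sup>2 = 0"
    using integral_eq_0_iff[OF continuous_on_power[OF c(1)], of 2] integral_eq_0_iff[OF continuous_on_power[OF c(2)], of 2]
      assms(3) by auto
  then show ?thesis by (simp add: complex_eq_iff)
qed


definition hyp_continuable :: "complex \<Rightarrow> complex \<Rightarrow> complex \<Rightarrow> bool" where
  "hyp_continuable a b c \<longleftrightarrow> (\<exists>F. F holomorphic_on slit_plane \<and> F has_fps_expansion hyp_fps a b c)"

text \<open>Euler's integral; its normalising Beta integral does not vanish, since otherwise all moments of the
  kernel would vanish.\<close>

lemma hyp_continuable_euler:
  assumes "Re b > 1" "Re (c - b) > 1"
  shows "hyp_continuable a b c"
proof -
  \<comment> \<open>Both exponents have positive real part by hypothesis, so the kernel is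
    continuous up to the endpoints.\<close>
  define \<phi> where "\<phi> t = complex_of_real t powr (b - 1) * (1 - complex_of_real t) powr (c - b - 1)" for t
  define I where "I n = integral {0..1} (\<lambda>t. \<phi> t * of_real t ^ n)" for n
  have cont: "continuous_on {0..1} \<phi>"
    unfolding \<phi>_def by (intro continuous_intros) (use assms in auto)
  have deriv: "(\<phi> has_vector_derivative \<phi> t * ((b - 1) / of_real t - (c - b - 1) / (1 - of_real t))) (at t)"
    if "t \<in> {0<..<1}" for t
  proof -
    have t: "complex_of_real t \<notin> \<real>\<^sub>\<le>\<^sub>0" "1 - complex_of_real t \<notin> \<real>\<^sub>\<le>\<^sub>0" "complex_of_real t \<noteq> 0" "1 - complex_of_real t \<noteq> 0"
      using that by (auto simp: complex_nonpos_Reals_iff)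
    define \<beta> \<gamma> W where "\<beta> = b - 1" "\<gamma> = c - b - 1" "W = complex_of_real t"
    note defs = this
    have W: "W \<notin> \<real>\<^sub>\<le>\<^sub>0" "1 - W \<notin> \<real>\<^sub>\<le>\<^sub>0" "W \<noteq> 0" "1 - W \<noteq> 0" using t unfolding defs by auto
    have "((\<lambda>w. w powr \<beta> * (1 - w) powr \<gamma>) has_field_derivative
       (\<beta> * W powr (\<beta> - 1) * (1 - W) powr \<gamma> + \<gamma> * (1 - W) powr (\<gamma> - 1) * (- 1) * W powr \<beta>)) (at W)"
      using W by (intro DERIV_mult has_field_derivative_powr DERIV_chain2[where g = "\<lambda>w. 1 - w"])
        (auto intro!: derivative_eq_intros)
    moreover have "W powr (\<beta> - 1) = W powr \<beta> / W" "(1 - W) powr (\<gamma> - 1) = (1 - W) powr \<gamma> / (1 - W)"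
      using W by (auto simp: powr_diff)
    ultimately have "((\<lambda>w. w powr \<beta> * (1 - w) powr \<gamma>) has_field_derivative
       (W powr \<beta> * (1 - W) powr \<gamma> * (\<beta> / W - \<gamma> / (1 - W)))) (at W)"
      by (simp add: algebra_simps)
    then have "((\<lambda>w. w powr (b - 1) * (1 - w) powr (c - b - 1)) has_field_derivative
       \<phi> t * ((b - 1) / of_real t - (c - b - 1) / (1 - of_real t))) (at (of_real t))"
      unfolding defs \<phi>_def .
    from has_vector_derivative_real_field[OF this]
    show ?thesis by (simp add: \<phi>_def[abs_def])
  qed
  have rec: "(c + of_nat n) * I (Suc n) = (b + of_nat n) * I n" for n
  proof -
    \<comment> \<open>A primitive with zero boundary values: its derivative combines two consecutive
      moments, which gives the Beta recursion without the Gamma function.\<close>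
    define \<psi> where "\<psi> t = \<phi> t * (of_real t ^ Suc n * (1 - of_real t))" for t
    have "((\<lambda>t. (b + of_nat n) * (\<phi> t * of_real t ^ n) - (c + of_nat n) * (\<phi> t * of_real t ^ Suc n)) has_integral
       (\<psi> 1 - \<psi> 0)) {0..1}"
    proof (rule fundamental_theorem_of_calculus_interior)
      show "continuous_on {0..1} \<psi>" unfolding \<psi>_def by (intro continuous_intros cont)
      fix t :: real assume t: "t \<in> {0<..<1}"
      then have nz: "complex_of_real t \<noteq> 0" "1 - complex_of_real t \<noteq> 0"
        by (auto simp: complex_eq_iff)
      define T where "T = complex_of_real t"
      have p: "((\<lambda>t. complex_of_real t ^ Suc n * (1 - of_real t)) has_vector_derivative
         (of_nat (Suc n) * of_real t ^ n * (1 - of_real t) - of_real t ^ Suc n)) (at t)"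
      proof (rule has_vector_derivative_real_field[where f = "\<lambda>w. w ^ Suc n * (1 - w)"])
        have "((\<lambda>w. 1 - w) has_field_derivative - 1) (at (complex_of_real t))"
          by (auto intro!: derivative_eq_intros)
        from DERIV_mult[OF DERIV_power[OF DERIV_ident, of "Suc n" "complex_of_real t" UNIV] this]
        show "((\<lambda>w. w ^ Suc n * (1 - w)) has_field_derivative
           of_nat (Suc n) * of_real t ^ n * (1 - of_real t) - of_real t ^ Suc n) (at (complex_of_real t))"
          by simp
      qed
      have "(\<psi> has_vector_derivative (\<phi> t * (of_nat (Suc n) * of_real t ^ n * (1 - of_real t) - of_real t ^ Suc n) +
         \<phi> t * ((b - 1) / of_real t - (c - b - 1) / (1 - of_real t)) * (of_real t ^ Suc n * (1 - of_real t)))) (at t)"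
        unfolding \<psi>_def by (rule has_vector_derivative_mult[OF deriv[OF t] p])
      moreover have "(\<phi> t * (of_nat (Suc n) * T ^ n * (1 - T) - T ^ Suc n) +
         \<phi> t * ((b - 1) / T - (c - b - 1) / (1 - T)) * (T ^ Suc n * (1 - T))) =
         (b + of_nat n) * (\<phi> t * T ^ n) - (c + of_nat n) * (\<phi> t * T ^ Suc n)"
        using nz unfolding T_def[symmetric] by (simp add: divide_simps) (simp add: algebra_simps)
      ultimately show "(\<psi> has_vector_derivative (b + of_nat n) * (\<phi> t * of_real t ^ n) - (c + of_nat n) * (\<phi> t * of_real t ^ Suc n)) (at t)"
        unfolding T_def by simp
    qed simp
    moreover have "((\<lambda>t. (b + of_nat n) * (\<phi> t * of_real t ^ n) - (c + of_nat n) * (\<phi> t * of_real t ^ Suc n)) has_integral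
       ((b + of_nat n) * I n - (c + of_nat n) * I (Suc n))) {0..1}"
      unfolding I_def
      by (intro has_integral_diff has_integral_mult_right integrable_integral integrable_continuous_real continuous_intros cont)
    ultimately have "(b + of_nat n) * I n - (c + of_nat n) * I (Suc n) = \<psi> 1 - \<psi> 0"
      using has_integral_unique by blast
    then show ?thesis by (simp add: \<psi>_def)
  qed
  have nzc: "c + of_nat n \<noteq> 0" for n
  proof
    assume "c + of_nat n = 0"
    then have "Re (c + of_nat n) = 0" by simp
    with assms show False by simp
  qed
  then have "c \<notin> \<int>\<^sub>\<le>\<^sub>0" by (metis nonpos_Ints_cases' add.left_inverse)
  note pc = pochhammer_neq_0[OF this]
  have In: "I n = pochhammer b n / pochhammer c n * I 0" for n
  proof (induction n)
    case (Suc n)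
    have "I (Suc n) = (b + of_nat n) / (c + of_nat n) * I n"
      using rec[of n] nzc[of n] by (simp add: field_simps)
    also have "\<dots> = pochhammer b (Suc n) / pochhammer c (Suc n) * I 0"
      unfolding Suc pochhammer_Suc by (simp add: mult_ac)
    finally show ?case .
  qed simp
  have I0: "I 0 \<noteq> 0"
  proof
    assume "I 0 = 0"
    then have "I n = 0" for n using In[of n] by simp
    then have "\<phi> (1/2) = 0" unfolding I_def by (intro all_moments_zero_imp_zero[OF cont]) auto
    then show False by (simp add: \<phi>_def)
  qed
  define F where "F z = integral {0..1} (\<lambda>t. \<phi> t * (1 - of_real t * z) powr (-a)) / I 0" for z
  have "F holomorphic_on slit_plane"
    unfolding F_def by (intro holomorphic_intros euler_transform_holomorphic cont I0)
  moreover have "F has_fps_expansion hyp_fps a b c"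
  proof (rule has_fps_expansionI)
    have "(\<lambda>n. fps_nth (hyp_fps a b c) n * z ^ n) sums F z" if "z \<in> ball 0 1" for z
    proof -
      have "(\<lambda>n. pochhammer a n / fact n * I n * z ^ n / I 0) sums F z"
        unfolding F_def I_def by (rule sums_divide[OF euler_transform_sums[OF cont]]) (use that in simp)
      also have "(\<lambda>n. pochhammer a n / fact n * I n * z ^ n / I 0) = (\<lambda>n. fps_nth (hyp_fps a b c) n * z ^ n)"
      proof
        fix n show "pochhammer a n / fact n * I n * z ^ n / I 0 = fps_nth (hyp_fps a b c) n * z ^ n"
          using I0 In[of n] by (simp add: hyp_fps_nth mult_ac)
      qed
      finally show ?thesis .
    qed
    then show "\<forall>\<^sub>F z in nhds 0. (\<lambda>n. fps_nth (hyp_fps a b c) n * z ^ n) sums F z"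
      by (intro eventually_mono[OF eventually_nhds_in_open[of "ball 0 1"]]) auto
  qed
  ultimately show ?thesis unfolding hyp_continuable_def by blast
qed

section \<open>Descent from large parameters to arbitrary ones\<close>

lemma hyp_continuable_lower_b:
  assumes "hyp_continuable a (b + 1) c" "c \<notin> \<int>\<^sub>\<le>\<^sub>0" "c - b - 1 \<noteq> 0"
  shows "hyp_continuable a b c"
proof -
  obtain F where F: "F holomorphic_on slit_plane" "F has_fps_expansion hyp_fps a (b + 1) c"
    using assms(1) unfolding hyp_continuable_def by blast
  let ?S = "hyp_fps a (b + 1) c"
  let ?G = "\<lambda>z. 1 / (c - b - 1) * (z * (1 - z) * deriv F z + ((c - b - 1) - a * z) * F z)"
  have "?G holomorphic_on slit_plane" by (intro holomorphic_intros F open_slit_plane) (use assms in auto)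
  moreover have "?G has_fps_expansion
     fps_const (1 / (c - b - 1)) * (fps_X * (1 - fps_X) * fps_deriv ?S + (fps_const (c - b - 1) - fps_const a * fps_X) * ?S)"
    by (intro fps_expansion_intros F)
  moreover have "fps_const (1 / (c - b - 1)) * (fps_X * (1 - fps_X) * fps_deriv ?S + (fps_const (c - b - 1) - fps_const a * fps_X) * ?S)
     = hyp_fps a b c"
    unfolding hyp_fps_lower_b[OF assms(2), symmetric] mult.assoc[symmetric] fps_const_mult
    using assms(3) by simp
  ultimately show ?thesis unfolding hyp_continuable_def by metis
qed

lemma hyp_continuable_lower_c:
  assumes "hyp_continuable a b (c + 1)" "c \<notin> \<int>\<^sub>\<le>\<^sub>0"
  shows "hyp_continuable a b c"
proof -
  obtain F where F: "F holomorphic_on slit_plane" "F has_fps_expansion hyp_fps a b (c + 1)"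
    using assms(1) unfolding hyp_continuable_def by blast
  have nz: "c \<noteq> 0" using assms(2) by auto
  let ?S = "hyp_fps a b (c + 1)"
  let ?G = "\<lambda>z. 1 / c * (c * F z + z * deriv F z)"
  have "?G holomorphic_on slit_plane" by (intro holomorphic_intros F open_slit_plane) (use nz in auto)
  moreover have "?G has_fps_expansion fps_const (1 / c) * (fps_const c * ?S + fps_X * fps_deriv ?S)"
    by (intro fps_expansion_intros F)
  moreover have "fps_const (1 / c) * (fps_const c * ?S + fps_X * fps_deriv ?S) = hyp_fps a b c"
    unfolding hyp_fps_lower_c[OF assms(2), symmetric] mult.assoc[symmetric] fps_const_mult
    using nz by simp
  ultimately show ?thesis unfolding hyp_continuable_def by metis
qed

text \<open>The choices of \<open>n\<close> and then \<open>m\<close> make Euler's integral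
  available at \<open>b + n\<close>, \<open>c + m\<close>. Lowering \<open>b\<close> comes first,
  while the large lower parameter keeps the divisor in \<open>hyp_continuable_lower_b\<close>
  nonzero; \<open>c\<close> is lowered afterwards.\<close>

lemma hyp_continuable:
  assumes "c \<notin> \<int>\<^sub>\<le>\<^sub>0"
  shows "hyp_continuable a b c"
proof -
  obtain n where n: "1 - Re b < real n" using reals_Archimedean2 by blast
  obtain m where m: "1 + Re b + real n - Re c < real m" using reals_Archimedean2 by blast
  have lower_b: "hyp_continuable a (b + of_nat n - of_nat j) (c + of_nat m)" if "j \<le> n" for j
    using that
  proof (induction j)
    case 0
    show ?case by (rule hyp_continuable_euler) (use n m in auto)
  next
    case (Suc j)
    have "Re (c + of_nat m - (b + of_nat n - of_nat (Suc j)) - 1) > 0" using m by simp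
    then have nz: "c + of_nat m - (b + of_nat n - of_nat (Suc j)) - 1 \<noteq> 0" by (metis order_less_irrefl zero_complex.simps(1))
    have eq: "b + of_nat n - of_nat (Suc j) + 1 = b + of_nat n - of_nat j" by simp
    have hyp: "hyp_continuable a (b + of_nat n - of_nat (Suc j) + 1) (c + of_nat m)"
      unfolding eq by (rule Suc.IH) (use Suc.prems in simp)
    show ?case
      by (rule hyp_continuable_lower_b[OF hyp not_nonpos_Int_plus_nat[OF assms] nz])
  qed
  have "hyp_continuable a b (c + of_nat m - of_nat j)" if "j \<le> m" for j
    using that
  proof (induction j)
    case 0
    show ?case using lower_b[of n] by simp
  next
    case (Suc j)
    have "c + of_nat m - of_nat (Suc j) = c + of_nat (m - Suc j)" using Suc.prems by (simp add: of_nat_diff)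
    then have nonpos: "c + of_nat m - of_nat (Suc j) \<notin> \<int>\<^sub>\<le>\<^sub>0"
      using not_nonpos_Int_plus_nat[OF assms, of "m - Suc j"] by (simp only: not_False_eq_True)
    have eq: "c + of_nat m - of_nat (Suc j) + 1 = c + of_nat m - of_nat j" by simp
    have hyp: "hyp_continuable a b (c + of_nat m - of_nat (Suc j) + 1)"
      unfolding eq by (rule Suc.IH) (use Suc.prems in simp)
    show ?case by (rule hyp_continuable_lower_c[OF hyp nonpos])
  qed
  from this[of m] show ?thesis by simp
qed

lemma hyp2F1_props:
  assumes "c \<notin> \<int>\<^sub>\<le>\<^sub>0"
  shows hyp2F1_holomorphic: "hyp2F1 a b c holomorphic_on slit_plane"
    and hyp2F1_expansion: "hyp2F1 a b c has_fps_expansion hyp_fps a b c"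
proof -
  obtain F where F: "F holomorphic_on slit_plane" "F has_fps_expansion hyp_fps a b c"
    using hyp_continuable[OF assms] unfolding hyp_continuable_def by blast
  have eq: "F z = hyp2F1_series a b c z" if "z \<in> ball 0 1" for z
  proof -
    have "F holomorphic_on eball 0 1"
      using holomorphic_on_subset[OF F(1) ball_subset_slit_plane] by (simp add: one_ereal_def)
    from has_fps_expansion_imp_sums_complex[OF F(2) this, of z] that
    show ?thesis by (simp add: hyp2F1_series_def hyp_fps_nth sums_iff)
  qed
  have ex: "\<exists>F. F holomorphic_on slit_plane \<and> (\<forall>z\<in>ball 0 1. F z = hyp2F1_series a b c z)"
    using F(1) eq by blast
  have h: "hyp2F1 a b c holomorphic_on slit_plane" "\<And>z. z \<in> ball 0 1 \<Longrightarrow> hyp2F1 a b c z = hyp2F1_series a b c z"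
    using someI_ex[OF ex] unfolding hyp2F1_def by auto
  show "hyp2F1 a b c holomorphic_on slit_plane" by (rule h)
  have "\<forall>\<^sub>F z in nhds 0. F z = hyp2F1 a b c z"
    using h(2) eq by (intro eventually_mono[OF eventually_nhds_in_open[of "ball 0 1"]]) auto
  with F(2) show "hyp2F1 a b c has_fps_expansion hyp_fps a b c"
    using has_fps_expansion_cong by blast
qed

section \<open>Disks, half-planes and starlikeness\<close>

text \<open>With \<open>eps \<ge> 0\<close> these sets are exactly the disks (\<open>eps > 0\<close>) and half-planes (\<open>eps = 0\<close>) containing \<open>0\<close>,
  apart from the whole plane \<open>circ 0 0\<close>.\<close>

definition circ :: "real \<Rightarrow> complex \<Rightarrow> complex set" where
  "circ eps \<mu> = {z. eps * (norm z)\<^sup>2 - 2 * Re (\<mu> * z) < 1}"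

lemma sq_less_sq_iff: "0 \<le> x \<Longrightarrow> 0 \<le> y \<Longrightarrow> x\<^sup>2 < y\<^sup>2 \<longleftrightarrow> x < y" for x y :: real
  by (simp add: not_le[symmetric] power_mono_iff)

lemma norm_diff_sq: "(norm (z - w))\<^sup>2 = (norm z)\<^sup>2 - 2 * Re (cnj w * z) + (norm w)\<^sup>2" for z w :: complex
  unfolding cmod_power2 by (simp add: power2_eq_square algebra_simps)

lemma circ_disk:
  assumes "eps > 0"
  shows "open_disk (circ eps \<mu>)"
proof -
  \<comment> \<open>Centre and radius come from completing the square in the inequality that defines
    \<open>circ\<close>.\<close>
  define r where "r = sqrt (1 / eps + (norm \<mu> / eps)\<^sup>2)"
  define c where "c = cnj \<mu> / of_real eps"
  have r: "r > 0" "r\<^sup>2 = 1 / eps + (norm \<mu> / eps)\<^sup>2"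
    using assms by (auto simp: r_def intro!: add_pos_nonneg)
  have nc: "norm c = norm \<mu> / eps" using assms by (simp add: c_def norm_divide)
  have cc: "cnj c * z = \<mu> * z / of_real eps" for z by (simp add: c_def)
  have "z \<in> circ eps \<mu> \<longleftrightarrow> z \<in> ball c r" for z
  proof -
    have "z \<in> ball c r \<longleftrightarrow> (norm (z - c))\<^sup>2 < r\<^sup>2"
      using r(1) by (simp add: dist_norm norm_minus_commute sq_less_sq_iff)
    also have "\<dots> \<longleftrightarrow> (norm z)\<^sup>2 - 2 * (Re (\<mu> * z) / eps) < 1 / eps"
      unfolding norm_diff_sq r(2) nc cc by simp
    also have "\<dots> \<longleftrightarrow> z \<in> circ eps \<mu>"
    proof -
      have "n - 2 * (x / eps) < 1 / eps \<longleftrightarrow> eps * n - 2 * x < 1" for n x :: real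
        using assms by (simp add: pos_less_divide_eq left_diff_distrib right_diff_distrib mult.commute)
      then show ?thesis by (simp only: circ_def mem_Collect_eq)
    qed
    finally show ?thesis by simp
  qed
  then have "circ eps \<mu> = ball c r" by blast
  with r show ?thesis unfolding open_disk_def by blast
qed

lemma circ_half_plane:
  assumes "\<mu> \<noteq> 0"
  shows "open_half_plane (circ 0 \<mu>)"
  unfolding open_half_plane_def
proof (intro exI conjI)
  show "- 2 * cnj \<mu> \<noteq> 0" using assms by simp
  show "circ 0 \<mu> = {z. (- 2 * cnj \<mu>) \<bullet> z < 1}"
    by (auto simp: circ_def inner_complex_def)
qed

text \<open>Since 0 lies in the region, its inequality has a positive constant
  (\<open>\<Delta>\<close> or \<open>t\<close>) and can be divided by it; this normalises the
  right-hand side to 1.\<close>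

lemma region_circ:
  assumes "open_disk \<Omega> \<or> open_half_plane \<Omega>" "0 \<in> \<Omega>"
  obtains eps \<mu> where "eps \<ge> 0" "\<Omega> = circ eps \<mu>"
  using assms(1)
proof
  assume "open_disk \<Omega>"
  then obtain w r where r: "r > 0" "\<Omega> = ball w r" unfolding open_disk_def by blast
  define \<Delta> where "\<Delta> = r\<^sup>2 - (norm w)\<^sup>2"
  have "norm w < r" using assms(2) r by simp
  then have \<Delta>: "\<Delta> > 0" unfolding \<Delta>_def using power_strict_mono[of "norm w" r 2] by simp
  have "z \<in> ball w r \<longleftrightarrow> z \<in> circ (1 / \<Delta>) (cnj w / of_real \<Delta>)" for z
  proof -
    have "z \<in> ball w r \<longleftrightarrow> (norm (z - w))\<^sup>2 < r\<^sup>2"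
      using r(1) by (simp add: dist_norm norm_minus_commute sq_less_sq_iff)
    also have "\<dots> \<longleftrightarrow> (norm z)\<^sup>2 - 2 * Re (cnj w * z) < \<Delta>"
      unfolding norm_diff_sq \<Delta>_def by linarith
    also have "\<dots> \<longleftrightarrow> (norm z)\<^sup>2 / \<Delta> - 2 * (Re (cnj w * z) / \<Delta>) < 1"
      using \<Delta> by (simp add: field_simps)
    also have "\<dots> \<longleftrightarrow> z \<in> circ (1 / \<Delta>) (cnj w / of_real \<Delta>)"
      unfolding circ_def mem_Collect_eq times_divide_eq_left Re_divide_of_real by simp
    finally show ?thesis .
  qed
  then have "\<Omega> = circ (1 / \<Delta>) (cnj w / of_real \<Delta>)" using r(2) by blast
  then show ?thesis using that[of "1 / \<Delta>"] \<Delta> by auto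
next
  assume "open_half_plane \<Omega>"
  then obtain w t where w: "w \<noteq> 0" "\<Omega> = {z. w \<bullet> z < t}" unfolding open_half_plane_def by blast
  have t: "t > 0" using assms(2) w by simp
  have "w \<bullet> z < t \<longleftrightarrow> z \<in> circ 0 (- cnj w / of_real (2 * t))" for z
  proof -
    have "- cnj w / of_real (2 * t) * z = - (cnj w * z) / of_real (2 * t)" by simp
    then have "Re (- cnj w / of_real (2 * t) * z) = - (w \<bullet> z) / (2 * t)"
      by (simp only: Re_divide_of_real) (simp add: inner_complex_def)
    moreover have "x < t \<longleftrightarrow> 0 * n - 2 * (- x / (2 * t)) < 1" for n x :: real
      using t by (simp add: divide_less_eq)
    ultimately show ?thesis by (simp only: circ_def mem_Collect_eq)
  qed
  then have "\<Omega> = circ 0 (- cnj w / of_real (2 * t))" using w(2) by blast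
  then show ?thesis using that[of 0] by auto
qed

section \<open>Moebius parametrisation of the regions by the unit disk\<close>

definition circ_rad :: "real \<Rightarrow> complex \<Rightarrow> real" where
  "circ_rad eps \<mu> = sqrt (eps + (norm \<mu>)\<^sup>2)"

text \<open>The inverse of \<open>z \<mapsto> R z / (1 + \<mu> z)\<close> with
  \<open>R = circ_rad eps \<mu>\<close>; by \<open>circ_iff\<close> the points of
  \<open>circ eps \<mu>\<close> are exactly those which that map sends into the unit disk. Disks and
  half-planes are treated alike.\<close>

definition circ_map :: "real \<Rightarrow> complex \<Rightarrow> complex \<Rightarrow> complex" where
  "circ_map eps \<mu> w = w / (of_real (circ_rad eps \<mu>) - \<mu> * w)"

context
  fixes eps :: real and \<mu> :: complex
  assumes eps: "eps \<ge> 0" and circ_sub: "circ eps \<mu> \<subseteq> slit_plane"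
begin

text \<open>The point 1 is excluded from the region. This inequality is what makes
  \<open>circ_Re_cnj_pos\<close> work, and it also rules out a vanishing
  \<open>circ_rad\<close>.\<close>

lemma circ_coeff_ge: "eps - 2 * Re \<mu> \<ge> 1"
proof -
  have "(1::complex) \<notin> slit_plane" by (simp add: slit_plane_iff)
  then have "1 \<notin> circ eps \<mu>" using circ_sub by blast
  then show ?thesis by (simp add: circ_def)
qed

lemma circ_rad_pos: "circ_rad eps \<mu> > 0"
proof -
  have "eps + (norm \<mu>)\<^sup>2 > 0"
    using circ_coeff_ge eps by (cases "\<mu> = 0") (auto intro: add_nonneg_pos)
  then show ?thesis by (simp add: circ_rad_def)
qed

lemma circ_rad_sq: "(circ_rad eps \<mu>)\<^sup>2 = eps + (norm \<mu>)\<^sup>2"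
  using eps by (simp add: circ_rad_def)

lemma norm_le_circ_rad: "norm \<mu> \<le> circ_rad eps \<mu>"
  unfolding circ_rad_def by (rule real_le_rsqrt) (use eps in simp)

lemma circ_iff: "z \<in> circ eps \<mu> \<longleftrightarrow> circ_rad eps \<mu> * norm z < norm (1 + \<mu> * z)"
proof -
  have eq: "(norm (1 + \<mu> * z))\<^sup>2 = 1 + 2 * Re (\<mu> * z) + (norm \<mu>)\<^sup>2 * (norm z)\<^sup>2"
    unfolding cmod_power2 by (simp add: power2_eq_square algebra_simps)
  have "z \<in> circ eps \<mu> \<longleftrightarrow> (circ_rad eps \<mu> * norm z)\<^sup>2 < (norm (1 + \<mu> * z))\<^sup>2"
    unfolding eq power_mult_distrib circ_rad_sq circ_def mem_Collect_eq distrib_right by linarith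
  also have "\<dots> \<longleftrightarrow> circ_rad eps \<mu> * norm z < norm (1 + \<mu> * z)"
    using circ_rad_pos by (intro sq_less_sq_iff) auto
  finally show ?thesis .
qed

private abbreviation (input) R where "R \<equiv> complex_of_real (circ_rad eps \<mu>)"

lemma circ_map_denom: "w \<in> ball 0 1 \<Longrightarrow> R - \<mu> * w \<noteq> 0"
proof
  assume w: "w \<in> ball 0 1" and "R - \<mu> * w = 0"
  then have "\<mu> * w = R" by simp
  then have eq: "norm \<mu> * norm w = circ_rad eps \<mu>"
    using circ_rad_pos by (metis abs_of_pos norm_mult norm_of_real)
  have "norm \<mu> * norm w \<le> circ_rad eps \<mu> * norm w" using norm_le_circ_rad by (intro mult_right_mono) auto
  also have "\<dots> < circ_rad eps \<mu> * 1" using w circ_rad_pos by (intro mult_strict_left_mono) auto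
  finally show False using eq by simp
qed

lemma one_plus_circ_map:
  assumes "w \<in> ball 0 1"
  shows "1 + \<mu> * circ_map eps \<mu> w = R / (R - \<mu> * w)"
  using circ_map_denom[OF assms] by (simp add: circ_map_def field_simps)

lemma circ_map_in: 
  assumes "w \<in> ball 0 1"
  shows "circ_map eps \<mu> w \<in> circ eps \<mu>"
proof -
  let ?d = "norm (R - \<mu> * w)"
  have d: "?d > 0" using circ_map_denom[OF assms] by simp
  have "circ_rad eps \<mu> * norm w < circ_rad eps \<mu> * 1"
    using assms circ_rad_pos by (intro mult_strict_left_mono) auto
  then have "circ_rad eps \<mu> * (norm w / ?d) < circ_rad eps \<mu> / ?d"
    using d by (simp add: divide_strict_right_mono)
  then show ?thesis
    unfolding circ_iff one_plus_circ_map[OF assms] using circ_rad_pos by (simp add: circ_map_def norm_divide)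
qed

lemma circ_map_image: "circ_map eps \<mu> ` ball 0 1 = circ eps \<mu>"
proof (intro equalityI subsetI)
  fix z assume z: "z \<in> circ eps \<mu>"
  then have lt: "circ_rad eps \<mu> * norm z < norm (1 + \<mu> * z)" by (simp add: circ_iff)
  have "circ_rad eps \<mu> * norm z \<ge> 0" using circ_rad_pos by simp
  then have nz: "1 + \<mu> * z \<noteq> 0" using lt by auto
  have cr: "R \<noteq> 0" using circ_rad_pos by simp
  define w where "w = R * z / (1 + \<mu> * z)"
  have "norm w < 1" using lt nz circ_rad_pos by (simp add: w_def norm_divide norm_mult)
  moreover have "R - \<mu> * w = R / (1 + \<mu> * z)"
    using nz by (simp add: w_def field_simps)
  then have "circ_map eps \<mu> w = z" using nz cr by (simp add: circ_map_def w_def)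
  ultimately show "z \<in> circ_map eps \<mu> ` ball 0 1" by force
qed (use circ_map_in in auto)

lemma circ_map_holomorphic: "circ_map eps \<mu> holomorphic_on ball 0 1"
  unfolding circ_map_def[abs_def] using circ_map_denom by (intro holomorphic_intros) auto

lemma circ_map_inj: "inj_on (circ_map eps \<mu>) (ball 0 1)"
proof (rule inj_onI)
  fix v w assume vw: "v \<in> ball 0 1" "w \<in> ball 0 1" "circ_map eps \<mu> v = circ_map eps \<mu> w"
  have "R \<noteq> 0" using circ_rad_pos by simp
  with vw(3) circ_map_denom[OF vw(1)] circ_map_denom[OF vw(2)]
  show "v = w" unfolding circ_map_def by (simp add: field_simps)
qed

lemma circ_map_deriv:
  assumes "w \<in> ball 0 1"
  shows "(circ_map eps \<mu> has_field_derivative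
     R / (R - \<mu> * w)\<^sup>2) (at w)"
  unfolding circ_map_def[abs_def] using circ_map_denom[OF assms]
  by (auto intro!: derivative_eq_intros simp: field_simps power2_eq_square)

lemma circ_map_deriv_mult:
  assumes "w \<in> ball 0 1"
  shows "w * (R / (R - \<mu> * w)\<^sup>2) =
    circ_map eps \<mu> w * (1 + \<mu> * circ_map eps \<mu> w)"
  unfolding one_plus_circ_map[OF assms] by (simp add: circ_map_def power2_eq_square)

lemma circ_Re_pos: "z \<in> circ eps \<mu> \<Longrightarrow> Re (1 + \<mu> * z) > 0"
  using mult_nonneg_nonneg[OF eps zero_le_power2[of "norm z"]] unfolding circ_def mem_Collect_eq
  by (simp only: plus_complex.simps one_complex.simps)

text \<open>Twice the real part is the sum of \<open>1 - eps |z|^2 + 2 Re (\<mu> z)\<close>, of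
  \<open>|1 - z|^2\<close>, and of \<open>(eps - 2 Re \<mu> - 1) |z|^2\<close>. The first is
  positive in the region, the last nonnegative by \<open>circ_coeff_ge\<close>.\<close>

lemma circ_Re_cnj_pos:
  assumes "z \<in> circ eps \<mu>"
  shows "Re ((1 + \<mu> * z) * cnj (1 - z)) > 0"
proof -
  have "Re ((1 + \<mu> * z) * cnj (1 - z)) = 1 - Re z + Re (\<mu> * z) - Re \<mu> * (norm z)\<^sup>2"
    unfolding cmod_power2 by (simp add: power2_eq_square algebra_simps)
  moreover have "(eps - 2 * Re \<mu>) * (norm z)\<^sup>2 \<ge> 1 * (norm z)\<^sup>2"
    using circ_coeff_ge by (intro mult_right_mono) auto
  moreover have "1 - 2 * Re z + (norm z)\<^sup>2 = (norm (1 - z))\<^sup>2"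
    unfolding cmod_power2 by (simp add: power2_eq_square algebra_simps)
  moreover have "(norm (1 - z))\<^sup>2 \<ge> 0" by simp
  ultimately show ?thesis using assms unfolding circ_def mem_Collect_eq
    by (simp only: left_diff_distrib)
qed

end

text \<open>When \<open>c\<close> is a positive multiple of \<open>g w\<close>, the derivative has
  the sign of \<open>Re (w g' w / g w)\<close>. Both directions of the starlikeness criterion follow
  the modulus of the preimage along a ray.\<close>

lemma norm_inverse_along_ray:
  assumes g: "g holomorphic_on ball 0 1" "inj_on g (ball 0 1)"
    and K: "K holomorphic_on g ` ball 0 1" "\<And>z. z \<in> ball 0 1 \<Longrightarrow> deriv g z * deriv K (g z) = 1"
      "\<And>z. z \<in> ball 0 1 \<Longrightarrow> K (g z) = z"
    and w: "w \<in> ball 0 1" "of_real m * c = g w"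
  shows "((\<lambda>t. (norm (K (of_real t * c)))\<^sup>2) has_real_derivative 2 * Re (cnj w * (c / deriv g w))) (at m)"
proof -
  have op: "open (g ` ball 0 1)" by (rule open_mapping_thm3[OF g(1) _ g(2)]) simp
  have dg: "deriv K (g w) = 1 / deriv g w"
    using K(2)[OF w(1)] by (metis nonzero_eq_divide_eq mult.commute mult_zero_left zero_neq_one)
  have "(K has_field_derivative deriv K (g w)) (at (of_real m * c))"
    unfolding w(2) using holomorphic_derivI[OF K(1) op] w(1) by blast
  then have "((\<lambda>x. K (x * c)) has_field_derivative deriv K (g w) * c) (at (of_real m))"
    by (rule DERIV_chain2) (auto intro!: derivative_eq_intros)
  then have v: "((\<lambda>t. K (of_real t * c)) has_vector_derivative deriv K (g w) * c) (at m)"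
    by (rule has_vector_derivative_real_field)
  have D: "deriv K (g w) * c = c / deriv g w" unfolding dg by simp
  have Km: "K (of_real m * c) = w" using K(3)[OF w(1)] w(2) by simp
  have "((\<lambda>t. (Re (K (of_real t * c)))\<^sup>2 + (Im (K (of_real t * c)))\<^sup>2) has_real_derivative
     2 * Re w * Re (c / deriv g w) + 2 * Im w * Im (c / deriv g w)) (at m)"
    using DERIV_add[OF DERIV_power[OF has_field_derivative_Re[OF v], of 2] DERIV_power[OF has_field_derivative_Im[OF v], of 2]]
    unfolding D Km by (simp add: mult_ac)
  moreover have "2 * Re w * Re X + 2 * Im w * Im X = 2 * Re (cnj w * X)" for X by simp
  ultimately show ?thesis unfolding cmod_power2 by (simp only:)
qed

text \<open>The Schwarz lemma is applied to \<open>w \<mapsto> g\<^sup>-\<^sup>1 (t g w)\<close> and differentiated at \<open>t = 1\<close>.\<close>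

lemma starlike_imp_Re_nonneg:
  assumes g: "g holomorphic_on ball 0 1" "inj_on g (ball 0 1)" "g 0 = 0"
    and st: "starlike_domain_wrt_0 (g ` ball 0 1)"
    and w: "w \<in> ball 0 1" "w \<noteq> 0"
  shows "g w \<noteq> 0" "deriv g w \<noteq> 0" "Re (w * deriv g w / g w) \<ge> 0"
proof -
  obtain K where K: "K holomorphic_on g ` ball 0 1" "\<And>z. z \<in> ball 0 1 \<Longrightarrow> deriv g z * deriv K (g z) = 1"
      "\<And>z. z \<in> ball 0 1 \<Longrightarrow> K (g z) = z"
    using holomorphic_has_inverse[OF g(1) _ g(2)] by auto
  show gw: "g w \<noteq> 0" using g w by (metis centre_in_ball inj_onD zero_less_one)
  show dg: "deriv g w \<noteq> 0" using K(2)[OF w(1)] by auto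
  define P where "P = w * deriv g w / g w"
  have der: "((\<lambda>t. (norm (K (of_real t * g w)))\<^sup>2) has_real_derivative 2 * Re (cnj w * (g w / deriv g w))) (at 1)"
    by (rule norm_inverse_along_ray[OF g(1,2) K w(1)]) auto
  have "cnj w * (g w / deriv g w) = of_real ((norm w)\<^sup>2) * (1 / P)"
    using gw dg w unfolding P_def complex_norm_square by (simp add: field_simps)
  then have eq: "Re (cnj w * (g w / deriv g w)) = (norm w)\<^sup>2 * Re (1 / P)"
    by (simp only: times_complex.simps Re_complex_of_real Im_complex_of_real)
  \<comment> \<open>A negative derivative at 1 would make the preimage of \<open>t g w\<close>
    larger than \<open>w\<close> in modulus for some \<open>t < 1\<close>, against the Schwarz
    lemma.\<close>
  have "\<not> Re (cnj w * (g w / deriv g w)) < 0"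
  proof
    assume "Re (cnj w * (g w / deriv g w)) < 0"
    then obtain d where d: "d > 0" "\<And>h. 0 < h \<Longrightarrow> h < d \<Longrightarrow>
        (norm (K (of_real 1 * g w)))\<^sup>2 < (norm (K (of_real (1 - h) * g w)))\<^sup>2"
      using DERIV_neg_dec_left[OF der] by auto
    define t where "t = 1 - min (d / 2) (1 / 2)"
    have t: "0 \<le> t" "t \<le> 1" and lt: "(norm w)\<^sup>2 < (norm (K (of_real t * g w)))\<^sup>2"
      using d(1) d(2)[of "min (d/2) (1/2)"] K(3)[OF w(1)] by (auto simp: t_def min_def)
    have tin: "of_real t * g v \<in> g ` ball 0 1" if "v \<in> ball 0 1" for v
    proof -
      have "closed_segment 0 (g v) \<subseteq> g ` ball 0 1" using st that unfolding starlike_domain_wrt_0_def by blast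
      moreover have "of_real t * g v \<in> closed_segment 0 (g v)"
        using t by (auto simp: in_segment scaleR_conv_of_real)
      ultimately show ?thesis by blast
    qed
    have "norm (K (of_real t * g w)) \<le> norm w"
    proof (rule Schwarz_Lemma(1)[where f = "\<lambda>v. K (of_real t * g v)"])
      show "(\<lambda>v. K (of_real t * g v)) holomorphic_on ball 0 1"
        by (rule holomorphic_on_compose_gen[OF _ K(1), unfolded o_def])
           (use tin in \<open>auto intro!: holomorphic_intros g\<close>)
      show "K (of_real t * g 0) = 0" using K(3)[of 0] g(3) by simp
      show "norm (K (of_real t * g v)) < 1" if nv: "norm v < 1" for v
      proof -
        obtain u where "u \<in> ball 0 1" "of_real t * g v = g u" using tin[of v] nv by auto
        then show ?thesis using K(3)[of u] by simp
      qed
      show "norm w < 1" using w by simp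
    qed
    then have "(norm (K (of_real t * g w)))\<^sup>2 \<le> (norm w)\<^sup>2" by (intro power_mono) auto
    with lt show False by simp
  qed
  then have "Re (1 / P) \<ge> 0" unfolding eq using w by (simp add: zero_le_mult_iff not_less)
  moreover have "Re (1 / P) = Re P / (norm P)\<^sup>2" by (simp add: Re_divide cmod_power2)
  moreover have "norm P > 0" using gw dg w by (simp add: P_def)
  ultimately have "Re P \<ge> 0" by (simp add: zero_le_divide_iff)
  then show "Re (w * deriv g w / g w) \<ge> 0" by (simp add: P_def)
qed


lemma deriv_norm_inverse_pos:
  assumes "Re (w * g' / gw) > 0" "w \<noteq> 0" "m > 0" "of_real m * c = gw"
  shows "2 * Re (cnj w * (c / g')) > 0"
proof -
  define P where "P = w * g' / gw"
  have nz: "g' \<noteq> 0" "gw \<noteq> 0" using assms(1) by auto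
  have c: "c = gw / of_real m" using assms by (simp add: field_simps)
  have "cnj w * (c / g') = of_real ((norm w)\<^sup>2 / m) * (1 / P)"
    using nz assms unfolding P_def c of_real_divide complex_norm_square by (simp add: field_simps)
  then have "Re (cnj w * (c / g')) = ((norm w)\<^sup>2 / m) * Re (1 / P)"
    by (simp only: times_complex.simps Re_complex_of_real Im_complex_of_real)
  moreover have "Re (1 / P) = Re P / (norm P)\<^sup>2" by (simp add: Re_divide cmod_power2)
  moreover have "norm P > 0" using nz assms by (simp add: P_def)
  ultimately show ?thesis using assms unfolding P_def[symmetric] by simp
qed

text \<open>Noshiro-Warschawski: for \<open>u \<noteq> v\<close> the real part of
  \<open>L (u + s (v - u)) / (v - u)\<close> strictly increases in \<open>s\<close>, so the values
  at the two ends differ.\<close>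

lemma Re_deriv_pos_inj_on:
  assumes "convex S" and der: "\<And>z. z \<in> S \<Longrightarrow> (L has_field_derivative L' z) (at z)" and pos: "\<And>z. z \<in> S \<Longrightarrow> Re (L' z) > 0"
  shows "inj_on L S"
proof (rule inj_onI, rule ccontr)
  fix u v assume uv: "u \<in> S" "v \<in> S" "L u = L v" "u \<noteq> v"
  define k where "k s = Re (L (u + of_real s * (v - u)) / (v - u))" for s
  have "k 0 < k 1"
  proof (rule DERIV_pos_imp_increasing[where f = k and a = 0 and b = 1])
    fix s :: real assume s: "0 \<le> s" "s \<le> 1"
    define z where "z = u + of_real s * (v - u)"
    have "z = (1 - s) *\<^sub>R u + s *\<^sub>R v" by (simp add: z_def scaleR_conv_of_real algebra_simps)
    then have z: "z \<in> S" using assms(1) uv s by (simp add: convex_alt)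
    have 1: "(L has_field_derivative L' z) (at (u + of_real s * (v - u)))"
      using der[OF z] by (simp add: z_def)
    have 2: "((\<lambda>x. u + x * (v - u)) has_field_derivative (v - u)) (at (of_real s))"
      by (auto intro!: derivative_eq_intros)
    have "((\<lambda>x. L (u + x * (v - u))) has_field_derivative L' z * (v - u)) (at (of_real s))"
      by (rule DERIV_chain2[where f = L and g = "\<lambda>x. u + x * (v - u)", OF 1 2])
    then have "((\<lambda>x. L (u + x * (v - u)) / (v - u)) has_field_derivative L' z * (v - u) / (v - u)) (at (of_real s))"
      by (rule DERIV_cdivide)
    then have "((\<lambda>x. L (u + x * (v - u)) / (v - u)) has_field_derivative L' z) (at (of_real s))"
      using uv(4) by simp
    from has_field_derivative_Re[OF has_vector_derivative_real_field[OF this]]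
    show "\<exists>y. (k has_real_derivative y) (at s) \<and> 0 < y"
      using pos[OF z] unfolding k_def by blast
  qed simp
  then show False using uv by (simp add: k_def)
qed

text \<open>Injectivity is read off from \<open>L u = log (g (exp u))\<close>, whose derivative has positive real part on the left
  half-plane.  For starlikeness, the modulus of the preimage of \<open>t g w0\<close> decreases as \<open>t\<close> decreases.\<close>

lemma Re_pos_imp_starlike:
  assumes G: "G holomorphic_on ball 0 1" "\<And>w. w \<in> ball 0 1 \<Longrightarrow> G w \<noteq> 0"
    and pos: "\<And>w. w \<in> ball 0 1 \<Longrightarrow> Re (1 + w * deriv G w / G w) > 0"
  defines "g \<equiv> \<lambda>w. w * G w"
  shows "inj_on g (ball 0 1)" "starlike_domain_wrt_0 (g ` ball 0 1)"
proof -
  obtain h where h: "h holomorphic_on ball 0 1" "\<And>w. w \<in> ball 0 1 \<Longrightarrow> exp (h w) = G w"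
    using holomorphic_logarithm_exists[OF convex_ball open_ball G, of 0] by (metis centre_in_ball zero_less_one)
  have dG: "(G has_field_derivative deriv G w) (at w)" if "w \<in> ball 0 1" for w
    using holomorphic_derivI[OF G(1) _ that] by simp
  have dh: "deriv h w = deriv G w / G w" if w: "w \<in> ball 0 1" for w
  proof -
    have "((\<lambda>w. exp (h w)) has_field_derivative exp (h w) * deriv h w) (at w)"
      using holomorphic_derivI[OF h(1) _ w] by (auto intro!: derivative_eq_intros)
    then have "(G has_field_derivative exp (h w) * deriv h w) (at w)"
      by (rule has_field_derivative_transform_within_open[OF _ open_ball w]) (use h in auto)
    then have "exp (h w) * deriv h w = deriv G w" using dG[OF w] DERIV_unique by blast
    then show ?thesis using h(2)[OF w] G(2)[OF w] by (simp add: field_simps)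
  qed
  define L where "L u = u + h (exp u)" for u
  have eb: "exp u \<in> ball 0 1" if "Re u < 0" for u :: complex using that by simp
  have expL: "exp (L u) = g (exp u)" if "Re u < 0" for u
    using h(2)[OF eb[OF that]] by (simp add: L_def exp_add g_def)
  have injL: "inj_on L {u. Re u < 0}"
  proof (rule Re_deriv_pos_inj_on)
    show "convex {u. Re u < 0}" by (rule convex_halfspace_Re_lt)
    fix u assume "u \<in> {u. Re u < 0}"
    then have u: "exp u \<in> ball 0 1" by simp
    have "((\<lambda>u. h (exp u)) has_field_derivative deriv h (exp u) * exp u) (at u)"
      by (rule DERIV_chain2[where f = h and g = exp, OF holomorphic_derivI[OF h(1) open_ball u, of UNIV]])
         (auto intro!: derivative_eq_intros)
    then show "(L has_field_derivative 1 + deriv h (exp u) * exp u) (at u)"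
      unfolding L_def[abs_def] by (auto intro!: derivative_eq_intros)
    show "Re (1 + deriv h (exp u) * exp u) > 0"
      using pos[OF u] dh[OF u] by (simp add: mult_ac)
  qed
  have g0: "g w = 0 \<longleftrightarrow> w = 0" if "w \<in> ball 0 1" for w
    using G(2)[OF that] by (simp add: g_def)
  show inj: "inj_on g (ball 0 1)"
  proof (rule inj_onI)
    fix v w assume vw: "v \<in> ball 0 1" "w \<in> ball 0 1" "g v = g w"
    show "v = w"
    proof (cases "v = 0 \<or> w = 0")
      case True then show ?thesis using g0 vw by metis
    next
      case False
      then have nz: "v \<noteq> 0" "w \<noteq> 0" by auto
      have neg: "Re (Ln v) < 0" "Re (Ln w) < 0" using nz vw by auto
      have "exp (L (Ln v)) = exp (L (Ln w))" using expL neg vw nz by simp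
      \<comment> \<open>\<open>L\<close> commutes with translation by \<open>2 pi i\<close>, so the
        ambiguity of the logarithm is absorbed by shifting \<open>Ln w\<close>.\<close>
      then obtain n :: int where n: "L (Ln v) = L (Ln w) + of_int (2 * n) * of_real pi * \<i>"
        unfolding exp_eq by auto
      define u where "u = Ln w + of_int (2 * n) * of_real pi * \<i>"
      have eu: "exp u = w" using nz unfolding u_def exp_add
        by (simp add: exp_eq_1 mult_ac flip: of_int_mult)
      have "L u = L (Ln w) + of_int (2 * n) * of_real pi * \<i>" unfolding L_def eu using nz by (simp add: u_def)
      then have "L u = L (Ln v)" using n by simp
      moreover have "Re u < 0" using neg by (simp add: u_def)
      ultimately have "u = Ln v" using injL neg by (auto dest: inj_onD)
      then show ?thesis using eu nz by (metis exp_Ln)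
    qed
  qed
  have hol: "g holomorphic_on ball 0 1" unfolding g_def by (intro holomorphic_intros G)
  have op: "open (g ` ball 0 1)" by (rule open_mapping_thm3[OF hol _ inj]) simp
  obtain K where K: "K holomorphic_on g ` ball 0 1" "\<And>z. z \<in> ball 0 1 \<Longrightarrow> deriv g z * deriv K (g z) = 1"
      "\<And>z. z \<in> ball 0 1 \<Longrightarrow> K (g z) = z"
    using holomorphic_has_inverse[OF hol _ inj] by auto
  have ray: "of_real t0 * g w0 \<in> g ` ball 0 1" if w0: "w0 \<in> ball 0 1" and t0: "0 \<le> t0" "t0 \<le> 1" for w0 t0
  proof (cases "t0 = 0 \<or> w0 = 0")
    case True
    moreover have "g 0 = 0" using g0[of 0] by simp
    ultimately have "of_real t0 * g w0 = g 0" using g0[of 0] by auto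
    then show ?thesis by auto
  next
    case False
    then have gw0: "g w0 \<noteq> 0" and w0nz: "w0 \<noteq> 0" using g0 w0 by auto
    \<comment> \<open>Times at which the point of the ray has a preimage of modulus at most
      \<open>norm w0\<close>. The set is closed by compactness of the smaller disk; at an infimum
      above \<open>t0\<close> the positive derivative would permit a further step down.\<close>
    define S where "S = {t \<in> {t0..1}. of_real t * g w0 \<in> g ` cball 0 (norm w0)}"
    have cb: "cball 0 (norm w0) \<subseteq> ball 0 1" using w0 by auto
    have "compact (g ` cball 0 (norm w0))"
      by (intro compact_continuous_image compact_cball holomorphic_on_imp_continuous_on holomorphic_on_subset[OF hol cb])
    then have "closed ((\<lambda>t::real. of_real t * g w0) -` (g ` cball 0 (norm w0)))"
      by (intro closed_vimage compact_imp_closed continuous_intros)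
    moreover have "S = {t0..1} \<inter> ((\<lambda>t::real. of_real t * g w0) -` (g ` cball 0 (norm w0)))"
      by (auto simp: S_def)
    ultimately have clS: "closed S" by (simp only: closed_Int closed_real_atLeastAtMost)
    have S1: "1 \<in> S" using t0 by (auto simp: S_def)
    have bdd: "bdd_below S" by (rule bdd_belowI[of _ t0]) (simp add: S_def)
    define m where "m = Inf S"
    have m: "m \<in> S" unfolding m_def using closed_contains_Inf[OF _ bdd clS] S1 by auto
    have "m = t0"
    proof (rule ccontr)
      assume "m \<noteq> t0"
      then have mt: "m > t0" "m > 0" using m t0 by (auto simp: S_def)
      obtain w where w: "norm w \<le> norm w0" "of_real m * g w0 = g w" using m by (auto simp: S_def)
      have wb: "w \<in> ball 0 1" using w w0 by simp
      have wnz: "w \<noteq> 0" using w(2) g0[OF wb] gw0 mt by auto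
      have "deriv g w = G w + w * deriv G w"
        unfolding g_def by (rule DERIV_imp_deriv) (use dG[OF wb] in \<open>auto intro!: derivative_eq_intros\<close>)
      then have "w * deriv g w / g w = 1 + w * deriv G w / G w"
        using G(2)[OF wb] wnz by (simp add: g_def field_simps)
      then have "Re (w * deriv g w / g w) > 0" using pos[OF wb] by simp
      from DERIV_pos_inc_left[OF norm_inverse_along_ray[OF hol inj K wb w(2)] deriv_norm_inverse_pos[OF this wnz mt(2) w(2)]]
      obtain d where d: "d > 0" "\<And>h. 0 < h \<Longrightarrow> h < d \<Longrightarrow>
          (norm (K (of_real (m - h) * g w0)))\<^sup>2 < (norm (K (of_real m * g w0)))\<^sup>2" by auto
      have "open ((\<lambda>t::real. of_real t * g w0) -` (g ` ball 0 1))"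
        by (intro open_vimage op continuous_intros)
      moreover have "m \<in> (\<lambda>t::real. of_real t * g w0) -` (g ` ball 0 1)" using w(2) wb by auto
      ultimately obtain e where e: "e > 0" "ball m e \<subseteq> (\<lambda>t::real. of_real t * g w0) -` (g ` ball 0 1)"
        using openE by blast
      define h where "h = min (min (d / 2) (e / 2)) (m - t0)"
      have hh: "0 < h" "h < d" "h < e" "h \<le> m - t0" using d(1) e(1) mt by (auto simp: h_def)
      have "m - h \<in> ball m e" using hh by (simp add: dist_real_def)
      then have "of_real (m - h) * g w0 \<in> g ` ball 0 1" using e(2) by blast
      then obtain v where v: "v \<in> ball 0 1" "of_real (m - h) * g w0 = g v" by blast
      have "(norm v)\<^sup>2 < (norm w)\<^sup>2" using d(2)[OF hh(1,2)] unfolding v(2) w(2) K(3)[OF v(1)] K(3)[OF wb] .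
      then have "norm v \<le> norm w0" using w(1) by (simp add: sq_less_sq_iff)
      then have "m - h \<in> S" using v(2) hh m by (auto simp: S_def)
      then have "m \<le> m - h" unfolding m_def by (rule cInf_lower[OF _ bdd])
      with hh show False by simp
    qed
    with m show ?thesis using cb by (auto simp: S_def)
  qed
  show "starlike_domain_wrt_0 (g ` ball 0 1)"
    unfolding starlike_domain_wrt_0_def
  proof (intro conjI ballI subsetI)
    show "open (g ` ball 0 1)" by (rule op)
    show "connected (g ` ball 0 1)"
      by (intro connected_continuous_image holomorphic_on_imp_continuous_on hol) auto
    show "0 \<in> g ` ball 0 1" using g0 by force
    fix x y assume "x \<in> g ` ball 0 1" "y \<in> closed_segment 0 x"
    then show "y \<in> g ` ball 0 1" using ray by (auto simp: in_segment scaleR_conv_of_real)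
  qed
qed


section \<open>Transfer between the unit disk and the regions in the slit plane\<close>

lemma starlike_on_circ:
  assumes F: "F holomorphic_on slit_plane" "\<And>z. z \<in> slit_plane \<Longrightarrow> F z \<noteq> 0"
    and eps: "eps \<ge> 0" and sub: "circ eps \<mu> \<subseteq> slit_plane"
    and pos: "\<And>z. z \<in> circ eps \<mu> \<Longrightarrow> Re ((1 + z * deriv F z / F z) * (1 + \<mu> * z)) > 0"
  shows "inj_on (\<lambda>z. z * F z) (circ eps \<mu>)" "starlike_domain_wrt_0 ((\<lambda>z. z * F z) ` circ eps \<mu>)"
proof -
  define R where "R = complex_of_real (circ_rad eps \<mu>)"
  let ?\<phi> = "circ_map eps \<mu>"
  \<comment> \<open>The denominator of \<open>circ_map\<close> is absorbed into \<open>G\<close>: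
    then \<open>w G w\<close> is the pullback of \<open>z F z\<close>, and \<open>G\<close> has no
    zeros.\<close>
  define G where "G w = F (?\<phi> w) / (R - \<mu> * w)" for w
  have in_slit: "?\<phi> w \<in> slit_plane" if "w \<in> ball 0 1" for w
    using circ_map_in[OF eps sub that] sub by blast
  have den: "R - \<mu> * w \<noteq> 0" if "w \<in> ball 0 1" for w
    using circ_map_denom[OF eps sub that] by (simp add: R_def)
  have "(\<lambda>w. F (?\<phi> w)) holomorphic_on ball 0 1"
    by (rule holomorphic_on_compose_gen[OF circ_map_holomorphic[OF eps sub] F(1), unfolded o_def])
       (use in_slit in auto)
  then have hol: "G holomorphic_on ball 0 1"
    unfolding G_def by (intro holomorphic_intros) (use den in auto)
  have nz: "G w \<noteq> 0" if "w \<in> ball 0 1" for w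
    using F(2)[OF in_slit[OF that]] den[OF that] by (simp add: G_def)
  have eq: "w * G w = ?\<phi> w * F (?\<phi> w)" for w
    by (simp add: G_def R_def circ_map_def)
  have pos': "Re (1 + w * deriv G w / G w) > 0" if w: "w \<in> ball 0 1" for w
  proof -
    define z where "z = ?\<phi> w"
    define f d where "f = F z" and "d = deriv F z"
    define D where "D = R - \<mu> * w"
    have fD: "f \<noteq> 0" "D \<noteq> 0" using F(2)[OF in_slit[OF w]] den[OF w] by (auto simp: f_def z_def D_def)
    have "((\<lambda>w. F (?\<phi> w)) has_field_derivative d * (R / D\<^sup>2)) (at w)"
      unfolding d_def z_def R_def D_def
      by (rule DERIV_chain2[where f = F and g = ?\<phi>, OF holomorphic_derivI[OF F(1) open_slit_plane in_slit[OF w], of UNIV] circ_map_deriv[OF eps sub w]])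
    then have "(G has_field_derivative ((d * (R / D\<^sup>2)) * D - f * (- \<mu>)) / (D * D)) (at w)"
      unfolding G_def[abs_def] D_def f_def z_def
      by (rule DERIV_divide) (use den[OF w] in \<open>auto intro!: derivative_eq_intros\<close>)
    then have "deriv G w = ((d * (R / D\<^sup>2)) * D - f * (- \<mu>)) / (D * D)" by (rule DERIV_imp_deriv)
    moreover have "G w = f / D" by (simp add: G_def f_def z_def D_def)
    ultimately have "1 + w * deriv G w / G w = 1 + w * (((d * (R / D\<^sup>2)) * D - f * (- \<mu>)) / (D * D)) / (f / D)"
      by (simp only:)
    also have "\<dots> = 1 + (w * (R / D\<^sup>2)) * d / f + w * \<mu> / D"
      using fD by (simp add: field_simps power2_eq_square)
    also have "w * (R / D\<^sup>2) = z * (1 + \<mu> * z)"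
      using circ_map_deriv_mult[OF eps sub w] by (simp add: R_def D_def z_def)
    also have "1 + z * (1 + \<mu> * z) * d / f + w * \<mu> / D = z * (1 + \<mu> * z) * d / f + R / D"
      using fD by (simp add: D_def field_simps)
    also have "R / D = 1 + \<mu> * z" 
      using one_plus_circ_map[OF eps sub w] by (simp add: R_def D_def z_def)
    also have "z * (1 + \<mu> * z) * d / f + (1 + \<mu> * z) = (1 + z * d / f) * (1 + \<mu> * z)"
      by (simp add: algebra_simps)
    finally show ?thesis using pos[OF circ_map_in[OF eps sub w]] by (simp add: z_def f_def d_def)
  qed
  have im: "(\<lambda>z. z * F z) ` circ eps \<mu> = (\<lambda>w. w * G w) ` ball 0 1"
    unfolding circ_map_image[OF eps sub, symmetric] image_image eq ..
  show "starlike_domain_wrt_0 ((\<lambda>z. z * F z) ` circ eps \<mu>)"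
    unfolding im by (rule Re_pos_imp_starlike[OF hol nz pos'])
  have "inj_on (\<lambda>w. w * G w) (ball 0 1)" by (rule Re_pos_imp_starlike[OF hol nz pos'])
  then have "inj_on (\<lambda>w. ?\<phi> w * F (?\<phi> w)) (ball 0 1)" unfolding eq .
  then have "inj_on (\<lambda>z. z * F z) (?\<phi> ` ball 0 1)"
    by (auto simp: inj_on_def)
  then show "inj_on (\<lambda>z. z * F z) (circ eps \<mu>)"
    unfolding circ_map_image[OF eps sub] .
qed

text \<open>The regions enter only through two sign conditions on \<open>m = 1 + \<mu> z\<close>,
  which put \<open>m\<close> in the dual of the cone spanned by 1 and \<open>1 - z\<close>. What
  remains is a pointwise statement about \<open>p\<close>.\<close>

lemma universally_starlikeI:
  assumes F: "F holomorphic_on slit_plane" "\<And>z. z \<in> slit_plane \<Longrightarrow> F z \<noteq> 0" "F 0 = 1"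
    and pos: "\<And>z m. z \<in> slit_plane \<Longrightarrow> Re m > 0 \<Longrightarrow> Re (m * cnj (1 - z)) > 0 \<Longrightarrow>
       Re ((1 + z * deriv F z / F z) * m) > 0"
    and f: "\<And>z. z \<in> slit_plane \<Longrightarrow> f z = z * F z"
  shows "universally_starlike f"
  unfolding universally_starlike_def
proof (intro conjI allI impI)
  have "(\<lambda>z. z * F z) holomorphic_on slit_plane" by (intro holomorphic_intros F)
  then show "f holomorphic_on slit_plane"
    by (rule holomorphic_transform) (use f in auto)
  show "f 0 = 0" using f by simp
  have "((\<lambda>z. z * F z) has_field_derivative 1) (at 0)"
    using holomorphic_derivI[OF F(1) open_slit_plane zero_in_slit_plane] F(3)
    by (auto intro!: derivative_eq_intros)
  then have "(f has_field_derivative 1) (at 0)"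
    by (rule has_field_derivative_transform_within_open[OF _ open_slit_plane zero_in_slit_plane]) (use f in auto)
  then show "deriv f 0 = 1" by (rule DERIV_imp_deriv)
  fix \<Omega> assume \<Omega>: "(open_disk \<Omega> \<or> open_half_plane \<Omega>) \<and> \<Omega> \<subseteq> slit_plane \<and> 0 \<in> \<Omega>"
  then obtain eps \<mu> where c: "eps \<ge> 0" "\<Omega> = circ eps \<mu>" using region_circ by metis
  then have sub: "circ eps \<mu> \<subseteq> slit_plane" using \<Omega> by simp
  have "Re ((1 + z * deriv F z / F z) * (1 + \<mu> * z)) > 0" if "z \<in> circ eps \<mu>" for z
    using that sub circ_Re_pos[OF c(1) sub that] circ_Re_cnj_pos[OF c(1) sub that] by (intro pos) auto
  note st = starlike_on_circ[OF F(1,2) c(1) sub this]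
  have eq: "f z = z * F z" if "z \<in> \<Omega>" for z using that f \<Omega> by blast
  show "inj_on f \<Omega>" using st(1) unfolding c(2)[symmetric] by (simp add: inj_on_def eq)
  show "starlike_domain_wrt_0 (f ` \<Omega>)" using st(2) unfolding c(2)[symmetric] by (simp add: eq cong: image_cong_simp)
qed

lemma universally_starlike_Re_nonneg:
  assumes "universally_starlike f" "eps \<ge> 0" "eps > 0 \<or> \<mu> \<noteq> 0" and sub: "circ eps \<mu> \<subseteq> slit_plane"
    and z: "z \<in> circ eps \<mu>" "z \<noteq> 0"
  shows "f z \<noteq> 0" "Re (z * deriv f z / f z * (1 + \<mu> * z)) \<ge> 0"
proof -
  note eps = assms(2)
  define R where "R = complex_of_real (circ_rad eps \<mu>)"
  let ?\<phi> = "circ_map eps \<mu>"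
  define g where "g w = f (?\<phi> w)" for w
  have "open_disk (circ eps \<mu>) \<or> open_half_plane (circ eps \<mu>)"
    using assms(2,3) circ_disk[of eps \<mu>] circ_half_plane[of \<mu>] by (cases "eps = 0") auto
  moreover have "0 \<in> circ eps \<mu>" by (simp add: circ_def)
  ultimately have f: "f holomorphic_on slit_plane" "f 0 = 0" "inj_on f (circ eps \<mu>)" "starlike_domain_wrt_0 (f ` circ eps \<mu>)"
    using assms(1) sub unfolding universally_starlike_def by auto
  have in_slit: "?\<phi> w \<in> slit_plane" if "w \<in> ball 0 1" for w
    using circ_map_in[OF eps sub that] sub by blast
  have hol: "g holomorphic_on ball 0 1" unfolding g_def
    by (rule holomorphic_on_compose_gen[OF circ_map_holomorphic[OF eps sub] f(1), unfolded o_def])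
       (use in_slit in auto)
  have inj: "inj_on g (ball 0 1)"
    using comp_inj_on[OF circ_map_inj[OF eps sub]] f(3) unfolding circ_map_image[OF eps sub]
    by (simp add: o_def g_def[abs_def])
  have im: "g ` ball 0 1 = f ` circ eps \<mu>"
    unfolding circ_map_image[OF eps sub, symmetric] image_image g_def ..
  have g0: "g 0 = 0" using f(2) by (simp add: g_def circ_map_def)
  obtain w where w: "w \<in> ball 0 1" "z = ?\<phi> w" using z(1) unfolding circ_map_image[OF eps sub, symmetric] by blast
  have wnz: "w \<noteq> 0" using w z(2) by (auto simp: circ_map_def)
  note st = starlike_imp_Re_nonneg[OF hol inj g0 f(4)[folded im] w(1) wnz]
  have "(g has_field_derivative deriv f (?\<phi> w) * (R / (R - \<mu> * w)\<^sup>2)) (at w)"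
    unfolding g_def[abs_def] R_def
    by (rule DERIV_chain2[where f = f and g = ?\<phi>, OF holomorphic_derivI[OF f(1) open_slit_plane in_slit[OF w(1)], of UNIV] circ_map_deriv[OF eps sub w(1)]])
  then have "deriv g w = deriv f z * (R / (R - \<mu> * w)\<^sup>2)" unfolding w(2) by (rule DERIV_imp_deriv)
  then have "w * deriv g w / g w = deriv f z * (w * (R / (R - \<mu> * w)\<^sup>2)) / f z"
    by (simp add: g_def w(2))
  also have "w * (R / (R - \<mu> * w)\<^sup>2) = z * (1 + \<mu> * z)"
    using circ_map_deriv_mult[OF eps sub w(1)] by (simp add: R_def w(2))
  also have "deriv f z * (z * (1 + \<mu> * z)) / f z = z * deriv f z / f z * (1 + \<mu> * z)" by simp
  finally show "Re (z * deriv f z / f z * (1 + \<mu> * z)) \<ge> 0" using st(3) by simp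
  show "f z \<noteq> 0" using st(1) by (simp add: g_def w(2))
qed

section \<open>The Julia inequality in the half-plane\<close>

lemma cmod_diff_cnj_sq: "(norm (A - cnj B))\<^sup>2 = (norm (A - B))\<^sup>2 + 4 * Im A * Im B"
  unfolding cmod_power2 by (simp add: power2_eq_square algebra_simps)

text \<open>The Schwarz lemma between Cayley transforms, rewritten with
  \<open>cmod_diff_cnj_sq\<close>. The form without quotients survives the passage to boundary
  points.\<close>

lemma half_plane_schwarz_pick_strict:
  assumes hol: "N holomorphic_on {z. Im z > 0}" and pos: "\<And>z. Im z > 0 \<Longrightarrow> Im (N z) > 0"
    and z: "Im z > 0" and w: "Im w > 0"
  shows "Im z * Im w * (norm (N z - cnj (N w)))\<^sup>2 \<le> Im (N z) * Im (N w) * (norm (z - cnj w))\<^sup>2"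
proof -
  \<comment> \<open>\<open>T\<close> maps the unit disk into the upper half-plane with
    \<open>T 0 = w\<close>; \<open>G\<close> then sends \<open>N w\<close> back to 0.\<close>
  define T where "T u = (w - cnj w * u) / (1 - u)" for u
  define B where "B = N w"
  define G where "G u = (N (T u) - B) / (N (T u) - cnj B)" for u
  have T: "Im (T u) > 0" if u: "u \<in> ball 0 1" for u
  proof -
    have nz: "1 - u \<noteq> 0" using u by auto
    have "T u = (w - cnj w * u) * cnj (1 - u) / of_real ((norm (1 - u))\<^sup>2)"
      unfolding T_def complex_norm_square using nz by simp
    then have "Im (T u) = Im ((w - cnj w * u) * cnj (1 - u)) / (norm (1 - u))\<^sup>2"
      by (simp only: Im_divide_of_real)
    moreover have "Im ((w - cnj w * u) * cnj (1 - u)) = Im w * (1 - (norm u)\<^sup>2)"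
      unfolding cmod_power2 by (simp add: power2_eq_square algebra_simps)
    moreover have "(norm u)\<^sup>2 < 1" using u by (simp add: power_less_one_iff abs_square_less_1)
    ultimately show ?thesis using w nz by simp
  qed
  have B: "Im B > 0" using pos[OF w] by (simp add: B_def)
  have den: "A - cnj B \<noteq> 0" if "Im A > 0" for A using that B by (auto simp: complex_eq_iff)
  have less: "norm ((A - B) / (A - cnj B)) < 1" if A: "Im A > 0" for A
  proof -
    have "(norm (A - B))\<^sup>2 < (norm (A - cnj B))\<^sup>2" unfolding cmod_diff_cnj_sq using A B by simp
    then have "norm (A - B) < norm (A - cnj B)" by (simp add: sq_less_sq_iff)
    then show ?thesis using den[OF A] by (simp add: norm_divide)
  qed
  have zw: "z - cnj w \<noteq> 0" using z w by (auto simp: complex_eq_iff)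
  define u where "u = (z - w) / (z - cnj w)"
  have "(norm (z - w))\<^sup>2 < (norm (z - cnj w))\<^sup>2" unfolding cmod_diff_cnj_sq using z w by simp
  then have "norm (z - w) < norm (z - cnj w)" by (simp add: sq_less_sq_iff)
  then have u: "norm u < 1" using zw by (simp add: u_def norm_divide)
  have Tu: "T u = z"
  proof -
    have "1 - u = (w - cnj w) / (z - cnj w)" using zw by (simp add: u_def field_simps)
    moreover have "w - cnj w * u = z * (w - cnj w) / (z - cnj w)" using zw by (simp add: u_def field_simps)
    moreover have "w - cnj w \<noteq> 0" using w by (auto simp: complex_eq_iff)
    ultimately show ?thesis using zw by (simp add: T_def)
  qed
  have "norm (G u) \<le> norm u"
  proof (rule Schwarz_Lemma(1)[OF _ _ _ u])
    have "T holomorphic_on ball 0 1" unfolding T_def[abs_def] by (intro holomorphic_intros) auto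
    then have "(\<lambda>u. N (T u)) holomorphic_on ball 0 1"
      by (rule holomorphic_on_compose_gen[OF _ hol, unfolded o_def]) (use T in auto)
    then show "G holomorphic_on ball 0 1"
      unfolding G_def[abs_def] using den[OF pos[OF T]] by (intro holomorphic_intros) auto
    show "G 0 = 0" by (simp add: G_def T_def B_def)
    show "norm (G v) < 1" if "norm v < 1" for v
      unfolding G_def using less[OF pos[OF T]] that by simp
  qed
  then have "norm (N z - B) / norm (N z - cnj B) \<le> norm (z - w) / norm (z - cnj w)"
    unfolding G_def Tu by (simp add: u_def norm_divide)
  then have "norm (N z - B) * norm (z - cnj w) \<le> norm (z - w) * norm (N z - cnj B)"
    using zw den[OF pos[OF z]] by (simp add: field_simps)
  then have "(norm (N z - B) * norm (z - cnj w))\<^sup>2 \<le> (norm (z - w) * norm (N z - cnj B))\<^sup>2"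
    by (intro power_mono) auto
  moreover have "(norm (z - w))\<^sup>2 = (norm (z - cnj w))\<^sup>2 - 4 * Im z * Im w"
    "(norm (N z - B))\<^sup>2 = (norm (N z - cnj B))\<^sup>2 - 4 * Im (N z) * Im B"
    by (simp_all add: cmod_diff_cnj_sq)
  ultimately have "((norm (N z - cnj B))\<^sup>2 - 4 * Im (N z) * Im B) * (norm (z - cnj w))\<^sup>2 \<le>
     ((norm (z - cnj w))\<^sup>2 - 4 * Im z * Im w) * (norm (N z - cnj B))\<^sup>2"
    by (simp only: power_mult_distrib)
  then show ?thesis by (simp add: B_def algebra_simps)
qed

text \<open>Adding \<open>\<i> \<delta>\<close> to \<open>N\<close> makes its imaginary part
  strictly positive; then \<open>\<delta>\<close> tends to 0.\<close>

lemma half_plane_schwarz_pick: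
  assumes hol: "N holomorphic_on {z. Im z > 0}" and pos: "\<And>z. Im z > 0 \<Longrightarrow> Im (N z) \<ge> 0"
    and z: "Im z > 0" and w: "Im w > 0"
  shows "Im z * Im w * (norm (N z - cnj (N w)))\<^sup>2 \<le> Im (N z) * Im (N w) * (norm (z - cnj w))\<^sup>2"
proof (rule tendsto_le)
  let ?M = "\<lambda>\<delta> z. N z + \<i> * of_real \<delta>"
  show "((\<lambda>\<delta>. Im z * Im w * (norm (?M \<delta> z - cnj (?M \<delta> w)))\<^sup>2) \<longlongrightarrow> Im z * Im w * (norm (N z - cnj (N w)))\<^sup>2) (at_right (0::real))"
    by (auto intro!: tendsto_eq_intros)
  show "((\<lambda>\<delta>. Im (?M \<delta> z) * Im (?M \<delta> w) * (norm (z - cnj w))\<^sup>2) \<longlongrightarrow> Im (N z) * Im (N w) * (norm (z - cnj w))\<^sup>2) (at_right (0::real))"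
    by (auto intro!: tendsto_eq_intros)
  have "Im z * Im w * (norm (?M \<delta> z - cnj (?M \<delta> w)))\<^sup>2 \<le> Im (?M \<delta> z) * Im (?M \<delta> w) * (norm (z - cnj w))\<^sup>2" if "\<delta> > 0" for \<delta>
    using that by (intro half_plane_schwarz_pick_strict z w holomorphic_intros hol) (simp add: add_nonneg_pos pos)
  then show "\<forall>\<^sub>F \<delta> in at_right (0::real). Im z * Im w * (norm (?M \<delta> z - cnj (?M \<delta> w)))\<^sup>2 \<le>
       Im (?M \<delta> z) * Im (?M \<delta> w) * (norm (z - cnj w))\<^sup>2"
    by (rule eventually_at_right_less[THEN eventually_mono])
qed simp

lemma tendsto_vertical:
  assumes "isCont N (of_real x)"
  shows "((\<lambda>eps. N (of_real x + \<i> * of_real eps)) \<longlongrightarrow> N (of_real x)) (at_right 0)"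
  using assms by (rule isCont_tendsto_compose) (auto intro!: tendsto_eq_intros)

lemma tendsto_Im_vertical:
  assumes "(N has_field_derivative D) (at (of_real x))" "Im (N (of_real x)) = 0"
  shows "((\<lambda>eps. Im (N (of_real x + \<i> * of_real eps)) / eps) \<longlongrightarrow> Re D) (at_right 0)"
proof -
  have "((\<lambda>h. (N (of_real x + h) - N (of_real x)) / h) \<longlongrightarrow> D) (at 0)"
    using assms(1) by (simp add: DERIV_def)
  moreover have "filterlim (\<lambda>eps. \<i> * complex_of_real eps) (at 0) (at_right 0)"
    unfolding filterlim_at by (auto intro!: tendsto_eq_intros eventually_at_right_less[THEN eventually_mono])
  ultimately have "((\<lambda>eps. (N (of_real x + \<i> * of_real eps) - N (of_real x)) / (\<i> * of_real eps)) \<longlongrightarrow> D) (at_right 0)"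
    by (rule filterlim_compose)
  then have "((\<lambda>eps. Re ((N (of_real x + \<i> * of_real eps) - N (of_real x)) / (\<i> * of_real eps))) \<longlongrightarrow> Re D) (at_right 0)"
    by (rule tendsto_Re)
  moreover have "Re (Z / (\<i> * of_real eps)) = Im Z / eps" for Z eps
  proof -
    have "Z / (\<i> * of_real eps) = (- \<i> * Z) / of_real eps" by (simp add: divide_simps)
    then show ?thesis by (simp only: Re_divide_of_real) simp
  qed
  ultimately show ?thesis using assms(2) by simp
qed

lemma Im_nonneg_imp_deriv_nonneg:
  assumes "(N has_field_derivative D) (at (of_real x))" "Im (N (of_real x)) = 0"
    and "\<And>z. Im z > 0 \<Longrightarrow> Im (N z) \<ge> 0"
  shows "Re D \<ge> 0"
proof (rule tendsto_lowerbound[OF tendsto_Im_vertical[OF assms(1,2)]])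
  show "\<forall>\<^sub>F eps in at_right 0. 0 \<le> Im (N (of_real x + \<i> * of_real eps)) / eps"
    using assms(3) by (intro eventually_at_right_less[THEN eventually_mono]) (auto intro!: divide_nonneg_pos)
qed simp

text \<open>Schwarz-Pick with the second point approaching \<open>x\<close> vertically, divided by
  its height: since \<open>N\<close> is real at \<open>x\<close>, the quotient of
  \<open>Im N\<close> by the height tends to \<open>Re D\<close>.\<close>

lemma half_plane_julia:
  assumes hol: "N holomorphic_on {z. Im z > 0}" and pos: "\<And>z. Im z > 0 \<Longrightarrow> Im (N z) \<ge> 0"
    and D: "(N has_field_derivative D) (at (of_real x))" "Im (N (of_real x)) = 0"
    and z: "Im z > 0"
  shows "Im z * (norm (N z - N (of_real x)))\<^sup>2 \<le> Im (N z) * Re D * (norm (z - of_real x))\<^sup>2"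
proof (rule tendsto_le)
  let ?w = "\<lambda>eps. of_real x + \<i> * complex_of_real eps"
  have "isCont N (of_real x)" using D(1) by (rule DERIV_isCont)
  note N = tendsto_vertical[OF this]
  have cN: "cnj (N (of_real x)) = N (of_real x)" using D(2) by (simp add: complex_eq_iff)
  have "((\<lambda>eps. Im z * (norm (N z - cnj (N (?w eps))))\<^sup>2) \<longlongrightarrow> Im z * (norm (N z - cnj (N (of_real x))))\<^sup>2) (at_right 0)"
    by (intro tendsto_intros N)
  then show "((\<lambda>eps. Im z * (norm (N z - cnj (N (?w eps))))\<^sup>2) \<longlongrightarrow> Im z * (norm (N z - N (of_real x)))\<^sup>2) (at_right 0)"
    unfolding cN .
  have "((\<lambda>eps. Im (N z) * (Im (N (?w eps)) / eps) * (norm (z - cnj (?w eps)))\<^sup>2) \<longlongrightarrow>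
      Im (N z) * Re D * (norm (z - cnj (of_real x + \<i> * of_real 0)))\<^sup>2) (at_right 0)"
    by (intro tendsto_intros tendsto_Im_vertical D)
  then show "((\<lambda>eps. Im (N z) * (Im (N (?w eps)) / eps) * (norm (z - cnj (?w eps)))\<^sup>2) \<longlongrightarrow>
      Im (N z) * Re D * (norm (z - of_real x))\<^sup>2) (at_right 0)" by simp
  have "Im z * (norm (N z - cnj (N (?w eps))))\<^sup>2 \<le> Im (N z) * (Im (N (?w eps)) / eps) * (norm (z - cnj (?w eps)))\<^sup>2" if "eps > 0" for eps
  proof -
    have "Im z * Im (?w eps) * (norm (N z - cnj (N (?w eps))))\<^sup>2 \<le> Im (N z) * Im (N (?w eps)) * (norm (z - cnj (?w eps)))\<^sup>2"
      by (rule half_plane_schwarz_pick[OF hol pos z]) (use that in auto)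
    moreover have "Im (?w eps) = eps" by simp
    ultimately have "(Im z * (norm (N z - cnj (N (?w eps))))\<^sup>2) * eps \<le> Im (N z) * Im (N (?w eps)) * (norm (z - cnj (?w eps)))\<^sup>2"
      by (simp only: mult_ac)
    then have "Im z * (norm (N z - cnj (N (?w eps))))\<^sup>2 \<le> Im (N z) * Im (N (?w eps)) * (norm (z - cnj (?w eps)))\<^sup>2 / eps"
      using that by (simp only: pos_le_divide_eq)
    then show ?thesis by (simp only: times_divide_eq_left times_divide_eq_right)
  qed
  then show "\<forall>\<^sub>F eps in at_right 0. Im z * (norm (N z - cnj (N (?w eps))))\<^sup>2 \<le>
     Im (N z) * (Im (N (?w eps)) / eps) * (norm (z - cnj (?w eps)))\<^sup>2"
    by (rule eventually_at_right_less[THEN eventually_mono])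
qed simp

text \<open>Lets a free parameter of the region tend to infinity and keeps only the sign of its
  coefficient.\<close>

lemma nonneg_of_large_multiples:
  fixes x y :: real
  assumes "\<And>M. M \<ge> M0 \<Longrightarrow> x + M * y \<ge> 0"
  shows "y \<ge> 0"
proof (rule ccontr)
  assume "\<not> y \<ge> 0"
  define M where "M = max M0 ((x + 1) / (- y))"
  have "(x + 1) / (- y) * (- y) \<le> M * (- y)" using \<open>\<not> y \<ge> 0\<close> by (intro mult_right_mono) (auto simp: M_def)
  then have "x + 1 \<le> - (M * y)" using \<open>\<not> y \<ge> 0\<close> by simp
  moreover have "x + M * y \<ge> 0" by (rule assms) (simp add: M_def)
  ultimately show False by simp
qed

lemma circ_subset_slit_plane:
  assumes "\<And>x. x \<ge> 1 \<Longrightarrow> eps * x\<^sup>2 - 2 * Re \<mu> * x \<ge> 1"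
  shows "circ eps \<mu> \<subseteq> slit_plane"
proof
  fix z assume z: "z \<in> circ eps \<mu>"
  show "z \<in> slit_plane"
  proof (rule ccontr)
    assume "z \<notin> slit_plane"
    then have "Im z = 0" "Re z \<ge> 1" by (auto simp: slit_plane_iff)
    then have "norm z = Re z" by (simp add: cmod_def)
    with assms[OF \<open>Re z \<ge> 1\<close>] z \<open>Im z = 0\<close> show False by (simp add: circ_def)
  qed
qed

lemma vanishing_Im_deriv:
  assumes "E holomorphic_on slit_plane" "\<And>x. x < 1 \<Longrightarrow> Im (E (of_real x)) = 0" "x < 1"
  shows "Im (deriv E (of_real x)) = 0"
proof -
  have "(E has_field_derivative deriv E (of_real x)) (at (of_real x))"
    by (rule holomorphic_derivI[OF assms(1) open_slit_plane]) (use assms(3) in \<open>simp add: slit_plane_iff\<close>)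
  from has_field_derivative_Im[OF has_vector_derivative_real_field[OF this]]
  have "((\<lambda>x. Im (E (of_real x))) has_real_derivative Im (deriv E (of_real x))) (at x)" .
  moreover have "((\<lambda>x. 0) has_real_derivative Im (deriv E (of_real x))) (at x)"
    by (rule has_field_derivative_transform_within_open[OF calculation, of "{..<1}"]) (use assms in auto)
  ultimately show ?thesis using DERIV_unique DERIV_const by blast
qed

section \<open>Consequences of universal starlikeness\<close>

lemma eventually_at_right_0I: "(\<And>eps. eps > 0 \<Longrightarrow> P eps) \<Longrightarrow> \<forall>\<^sub>F eps in at_right (0::real). P eps"
  by (rule eventually_at_right_less[THEN eventually_mono])

definition log_deriv :: "(complex \<Rightarrow> complex) \<Rightarrow> complex \<Rightarrow> complex" where
  "log_deriv F z = deriv F z / F z"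

context
  fixes F :: "complex \<Rightarrow> complex"
  assumes hol: "F holomorphic_on slit_plane" and F0: "F 0 = 1"
    and us: "universally_starlike (\<lambda>z. z * F z)"
begin

private abbreviation (input) E where "E \<equiv> log_deriv F"

lemma circ_Re_nonneg:
  assumes "eps \<ge> 0" "eps > 0 \<or> \<mu> \<noteq> 0" "\<And>x. x \<ge> 1 \<Longrightarrow> eps * x\<^sup>2 - 2 * Re \<mu> * x \<ge> 1" "z \<in> circ eps \<mu>"
  shows "F z \<noteq> 0" "Re ((1 + z * E z) * (1 + \<mu> * z)) \<ge> 0"
proof -
  have sub: "circ eps \<mu> \<subseteq> slit_plane" using assms(3) by (rule circ_subset_slit_plane)
  have "F z \<noteq> 0 \<and> Re ((1 + z * E z) * (1 + \<mu> * z)) \<ge> 0"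
  proof (cases "z = 0")
    case True then show ?thesis using F0 by simp
  next
    case False
    note st = universally_starlike_Re_nonneg[OF us assms(1,2) sub assms(4) False]
    have nz: "F z \<noteq> 0" using st(1) by simp
    have "((\<lambda>z. z * F z) has_field_derivative F z + z * deriv F z) (at z)"
      using holomorphic_derivI[OF hol open_slit_plane, of z] sub assms(4) by (auto intro!: derivative_eq_intros)
    then have "deriv (\<lambda>z. z * F z) z = F z + z * deriv F z" by (rule DERIV_imp_deriv)
    then have "z * deriv (\<lambda>z. z * F z) z / (z * F z) = 1 + z * E z"
      using False nz by (simp add: log_deriv_def field_simps)
    with st(2) nz show ?thesis by simp
  qed
  then show "F z \<noteq> 0" "Re ((1 + z * E z) * (1 + \<mu> * z)) \<ge> 0" by auto
qed

lemma nonreal_nonzero_and_sign: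
  assumes "Im z \<noteq> 0"
  shows "F z \<noteq> 0" "Im z * Im (1 + z * E z) \<ge> 0"
proof -
  define P where "P = 1 + z * E z"
  have nz: "z \<noteq> 0" using assms by auto
  define s where "s = sgn (Im z)"
  have s: "s * Im z = \<bar>Im z\<bar>" by (simp add: s_def sgn_if)
  have *: "F z \<noteq> 0 \<and> Re P + M * (s * Im P) \<ge> 0" if M: "M \<ge> (norm z)\<^sup>2 / (2 * \<bar>Im z\<bar>)" for M
  proof -
    \<comment> \<open>Chosen so that \<open>\<mu> z\<close> is purely imaginary: the quantity tested
      becomes \<open>Re P + M s Im P\<close>. The half-plane omits the cut once
      \<open>- 2 Re \<mu> \<ge> 1\<close>, which is the lower bound imposed on
      \<open>M\<close>.\<close>
    define \<mu> where "\<mu> = - \<i> * of_real (M * s) / z"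
    have M0: "M > 0" using assms nz by (intro less_le_trans[OF _ M]) auto
    have \<mu>z: "\<mu> * z = - \<i> * of_real (M * s)" using nz by (simp add: \<mu>_def)
    have "\<mu> = of_real (M * s) * (- \<i> * cnj z) / of_real ((norm z)\<^sup>2)"
      unfolding complex_norm_square \<mu>_def using nz by simp
    then have "Re \<mu> = Re (of_real (M * s) * (- \<i> * cnj z)) / (norm z)\<^sup>2" by (simp only: Re_divide_of_real)
    then have Re\<mu>: "Re \<mu> = - (M * \<bar>Im z\<bar>) / (norm z)\<^sup>2" using s by (simp add: mult_ac)
    have "(norm z)\<^sup>2 \<le> 2 * M * \<bar>Im z\<bar>" using M assms by (simp add: field_simps)
    then have low: "- 2 * Re \<mu> \<ge> 1" using nz unfolding Re\<mu> by (simp add: field_simps)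
    have "- 2 * Re \<mu> * x \<ge> 1" if "x \<ge> 1" for x
    proof -
      have "1 * 1 \<le> (- 2 * Re \<mu>) * x" using low that by (intro mult_mono) auto
      then show ?thesis by simp
    qed
    moreover have "z \<in> circ 0 \<mu>" unfolding circ_def mem_Collect_eq \<mu>z by simp
    moreover have "\<mu> \<noteq> 0" using low by auto
    ultimately have "F z \<noteq> 0" "Re (P * (1 + \<mu> * z)) \<ge> 0"
      unfolding P_def using circ_Re_nonneg[of 0 \<mu> z] by auto
    then show ?thesis unfolding \<mu>z by (simp add: algebra_simps)
  qed
  show "F z \<noteq> 0" using * by blast
  have "s * Im P \<ge> 0" by (rule nonneg_of_large_multiples) (use * in blast)
  then show "Im z * Im (1 + z * E z) \<ge> 0"
    unfolding P_def[symmetric] by (auto simp: s_def sgn_if zero_le_mult_iff split: if_splits)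
qed

lemma Im_one_plus_nonneg: "Im z > 0 \<Longrightarrow> Im (1 + z * E z) \<ge> 0"
  using nonreal_nonzero_and_sign(2)[of z] by (simp only: zero_le_mult_iff) linarith

lemma Im_one_plus_nonpos: "Im z < 0 \<Longrightarrow> Im (1 + z * E z) \<le> 0"
  using nonreal_nonzero_and_sign(2)[of z] by (simp only: zero_le_mult_iff) linarith

lemma universally_starlike_factor_nonzero: "z \<in> slit_plane \<Longrightarrow> F z \<noteq> 0"
  and Re_nonneg_real: "x < 1 \<Longrightarrow> Re ((1 + of_real x * E (of_real x)) * (1 - of_real x / 2)) \<ge> 0"
proof -
  \<comment> \<open>\<open>\<mu> = - 1/2\<close> gives the half-plane \<open>Re z < 1\<close>, which
    contains the real points of the slit plane.\<close>
  have half: "F z \<noteq> 0" "Re ((1 + z * E z) * (1 - z / 2)) \<ge> 0" if "Re z < 1" for z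
    using circ_Re_nonneg[of 0 "-1/2" z] that by (auto simp: circ_def)
  show "F z \<noteq> 0" if "z \<in> slit_plane"
    using that half(1)[of z] nonreal_nonzero_and_sign(1)[of z] by (auto simp: slit_plane_iff)
  show "Re ((1 + of_real x * E (of_real x)) * (1 - of_real x / 2)) \<ge> 0" if "x < 1"
    using half(2)[of "of_real x"] that by simp
qed

lemma log_deriv_holomorphic: "E holomorphic_on slit_plane"
  unfolding log_deriv_def[abs_def] using universally_starlike_factor_nonzero by (intro holomorphic_intros hol open_slit_plane) auto

lemma log_deriv_has_derivative:
  "z \<in> slit_plane \<Longrightarrow> (E has_field_derivative deriv E z) (at z)"
  by (rule holomorphic_derivI[OF log_deriv_holomorphic open_slit_plane])

lemma isCont_log_deriv: "z \<in> slit_plane \<Longrightarrow> isCont E z"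
  using log_deriv_has_derivative DERIV_isCont by blast

lemma of_real_in_slit_plane: "x < 1 \<Longrightarrow> of_real x \<in> slit_plane"
  by (simp add: slit_plane_iff)

lemma upper_in_slit_plane: "Im z > 0 \<Longrightarrow> z \<in> slit_plane"
  by (simp add: slit_plane_iff)

text \<open>\<open>Im p\<close> is nonnegative above and nonpositive below the real axis, so by
  continuity \<open>p\<close> is real on it. Dividing by \<open>x\<close> gives the claim for
  \<open>E\<close> away from 0, and continuity gives it at 0.\<close>

lemma log_deriv_real:
  assumes "x < 1"
  shows "Im (E (of_real x)) = 0"
proof -
  define P where "P z = 1 + z * E z" for z
  have P: "Im (P (of_real x)) = 0" if "x < 1" for x
  proof -
    have c: "isCont P (of_real x)"
      unfolding P_def by (intro continuous_intros isCont_log_deriv of_real_in_slit_plane that)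
    have lim1: "((\<lambda>eps. Im (P (of_real x + \<i> * of_real eps))) \<longlongrightarrow> Im (P (of_real x))) (at_right 0)"
      by (intro tendsto_Im tendsto_vertical c)
    have ge: "0 \<le> Im (P (of_real x + \<i> * of_real eps))" if "eps > 0" for eps
      unfolding P_def by (rule Im_one_plus_nonneg) (use that in simp)
    have "((\<lambda>eps. P (of_real x - \<i> * of_real eps)) \<longlongrightarrow> P (of_real x)) (at_right 0)"
      using c by (rule isCont_tendsto_compose) (auto intro!: tendsto_eq_intros)
    then have lim2: "((\<lambda>eps. Im (P (of_real x - \<i> * of_real eps))) \<longlongrightarrow> Im (P (of_real x))) (at_right 0)"
      by (rule tendsto_Im)
    have le: "Im (P (of_real x - \<i> * of_real eps)) \<le> 0" if "eps > 0" for eps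
      unfolding P_def by (rule Im_one_plus_nonpos) (use that in simp)
    show ?thesis
      using tendsto_lowerbound[OF lim1 eventually_at_right_0I[OF ge]] tendsto_upperbound[OF lim2 eventually_at_right_0I[OF le]]
      by simp
  qed
  have nonzero: "Im (E (of_real x)) = 0" if "x < 1" "x \<noteq> 0" for x
    using P[OF that(1)] that(2) by (simp add: P_def)
  show ?thesis
  proof (cases "x = 0")
    case True
    have "((\<lambda>x. E (of_real x)) \<longlongrightarrow> E 0) (at (0::real))"
      by (rule isCont_tendsto_compose[OF isCont_log_deriv]) (auto intro!: tendsto_eq_intros)
    then have "((\<lambda>x. Im (E (of_real x))) \<longlongrightarrow> Im (E 0)) (at (0::real))" by (rule tendsto_Im)
    moreover have "\<forall>\<^sub>F x in at (0::real). Im (E (of_real x)) = 0"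
      using nonzero by (intro eventually_mono[OF eventually_at_in_open[of "{..<1}" 0]]) auto
    ultimately have "((\<lambda>x. 0) \<longlongrightarrow> Im (E 0)) (at (0::real))"
      by (rule Lim_transform_eventually)
    then show ?thesis using True tendsto_unique[OF _ _ tendsto_const] by force
  qed (use nonzero assms in auto)
qed

lemma deriv_log_deriv_real: "x < 1 \<Longrightarrow> Im (deriv E (of_real x)) = 0"
  by (rule vanishing_Im_deriv[OF log_deriv_holomorphic log_deriv_real])

lemma mult_log_deriv_has_derivative:
  "z \<in> slit_plane \<Longrightarrow> ((\<lambda>z. 1 + z * E z) has_field_derivative (E z + z * deriv E z)) (at z)"
  by (auto intro!: derivative_eq_intros log_deriv_has_derivative)

lemma deriv_mult_log_deriv_nonneg: "x < 1 \<Longrightarrow> Re (E (of_real x) + of_real x * deriv E (of_real x)) \<ge> 0"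
  by (rule Im_nonneg_imp_deriv_nonneg[OF mult_log_deriv_has_derivative[OF of_real_in_slit_plane] _ Im_one_plus_nonneg]) (simp_all add: log_deriv_real)

lemma mult_log_deriv_mono:
  assumes "x \<le> y" "y < 1"
  shows "x * Re (E (of_real x)) \<le> y * Re (E (of_real y))"
proof -
  define r where "r x = Re (1 + of_real x * E (of_real x))" for x
  have "r x \<le> r y"
  proof (rule DERIV_nonneg_imp_nondecreasing[where f = r, OF assms(1)])
    fix t assume "x \<le> t" "t \<le> y"
    then have t: "t < 1" using assms by simp
    from has_field_derivative_Re[OF has_vector_derivative_real_field[OF mult_log_deriv_has_derivative[OF of_real_in_slit_plane[OF t]]]]
    show "\<exists>d. (r has_real_derivative d) (at t) \<and> 0 \<le> d"
      using deriv_mult_log_deriv_nonneg[OF t] unfolding r_def[abs_def] by blast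
  qed
  then show ?thesis by (simp add: r_def)
qed

lemma mult_log_deriv_ge:
  assumes "x < 1"
  shows "1 + x * Re (E (of_real x)) \<ge> 0"
proof -
  have "(1 + x * Re (E (of_real x))) * (1 - x / 2) \<ge> 0"
    using Re_nonneg_real[OF assms] log_deriv_real[OF assms] by simp
  then show ?thesis using assms by (simp add: zero_le_mult_iff)
qed

lemma log_deriv_0_nonneg: "Re (E 0) \<ge> 0"
  using deriv_mult_log_deriv_nonneg[of 0] by simp

lemma Im_z_mult_nonneg:
  assumes "Im z > 0"
  shows "Im (z * (1 + z * E z)) \<ge> 0"
proof -
  define P where "P = 1 + z * E z"
  have "Im (z * P) \<ge> 0"
  proof (rule nonneg_of_large_multiples)
    fix M assume M: "M \<ge> max 0 ((norm z)\<^sup>2 / (2 * Im z))"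
    \<comment> \<open>\<open>circ 1 \<mu>\<close> is the disk centred at \<open>\<i> M\<close> whose
      boundary passes through 1 and -1; these disks exhaust the upper half-plane as \<open>M\<close>
      grows.\<close>
    define \<mu> where "\<mu> = - \<i> * of_real M"
    have "(norm z)\<^sup>2 \<le> 2 * M * Im z" using M assms by (simp add: field_simps)
    then have "z \<in> circ 1 \<mu>" by (simp add: circ_def \<mu>_def)
    moreover have "1 * x\<^sup>2 - 2 * Re \<mu> * x \<ge> 1" if "x \<ge> 1" for x :: real
      using that by (simp add: \<mu>_def)
    ultimately have "Re (P * (1 + \<mu> * z)) \<ge> 0"
      unfolding P_def by (intro circ_Re_nonneg) auto
    moreover have "P * (1 + \<mu> * z) = P - \<i> * of_real M * (z * P)" by (simp add: \<mu>_def algebra_simps)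
    ultimately show "Re P + M * Im (z * P) \<ge> 0" by simp
  qed
  then show ?thesis by (simp add: P_def)
qed

lemma Im_inverse_mult_nonpos:
  assumes z: "Im z > 0"
  shows "Im ((1 - z) / z * (1 + z * E z)) \<le> 0"
proof -
  define P where "P = 1 + z * E z"
  \<comment> \<open>The half-planes used here are \<open>Re z + 2 \<nu> Im z < 1\<close>, with 1 on
    their boundary; \<open>\<nu>0\<close> is the value at which the boundary also passes through
    \<open>z\<close>.\<close>
  define \<nu>0 where "\<nu>0 = (1 - Re z) / (2 * Im z)"
  have "Re (P * (1 + (- 1/2 + \<i> * of_real \<nu>) * z)) \<ge> 0" if \<nu>: "\<nu> < \<nu>0" for \<nu>
  proof -
    define \<mu> where "\<mu> = - 1/2 + \<i> * of_real \<nu>"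
    have "\<nu> * (2 * Im z) < 1 - Re z" using \<nu> z by (simp add: \<nu>0_def field_simps)
    then have "z \<in> circ 0 \<mu>" by (simp add: circ_def \<mu>_def algebra_simps)
    moreover have "\<mu> \<noteq> 0" by (simp add: \<mu>_def complex_eq_iff)
    moreover have "0 * x\<^sup>2 - 2 * Re \<mu> * x \<ge> 1" if "x \<ge> 1" for x :: real
      using that by (simp add: \<mu>_def)
    ultimately show ?thesis
      unfolding P_def \<mu>_def[symmetric] by (intro circ_Re_nonneg) auto
  qed
  moreover have "((\<lambda>\<nu>. Re (P * (1 + (- 1/2 + \<i> * of_real \<nu>) * z))) \<longlongrightarrow> Re (P * (1 + (- 1/2 + \<i> * of_real \<nu>0) * z))) (at_left \<nu>0)"
    by (intro tendsto_intros)
  ultimately have nn: "Re (P * (1 + (- 1/2 + \<i> * of_real \<nu>0) * z)) \<ge> 0"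
    by (intro tendsto_lowerbound[of _ _ "at_left \<nu>0"]) (auto simp: eventually_at_left_field intro!: exI[of _ "\<nu>0 - 1"])
  \<comment> \<open>In the limit position \<open>m\<close> is a positive multiple of
    \<open>\<i> (1 - z) / z\<close>; the computations below verify this through real and imaginary
    parts.\<close>
  define m where "m = 1 + (- 1/2 + \<i> * of_real \<nu>0) * z"
  have \<nu>y: "\<nu>0 * Im z = (1 - Re z) / 2" using z by (simp add: \<nu>0_def)
  have "Re m = 1 / 2"
  proof -
    have "Re m = 1 - Re z / 2 - \<nu>0 * Im z" by (simp add: m_def)
    then show ?thesis unfolding \<nu>y by (simp add: field_simps)
  qed
  moreover have "2 * Im z * Im m = Re z - (norm z)\<^sup>2"
  proof -
    have "2 * Im z * Im m = - (Im z)\<^sup>2 + 2 * (\<nu>0 * Im z) * Re z"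
      by (simp add: m_def power2_eq_square algebra_simps)
    then show ?thesis unfolding \<nu>y cmod_power2 by (simp add: power2_eq_square algebra_simps)
  qed
  moreover have "Re ((1 - z) * cnj z) = Re z - (norm z)\<^sup>2" "Im ((1 - z) * cnj z) = - Im z"
    unfolding cmod_power2 by (simp_all add: power2_eq_square algebra_simps)
  moreover have "Re (- \<i> * of_real (2 * Im z) * m) = 2 * Im z * Im m" "Im (- \<i> * of_real (2 * Im z) * m) = - (2 * Im z * Re m)"
    by simp_all
  ultimately have "(1 - z) * cnj z = - \<i> * of_real (2 * Im z) * m" by (intro complex_eqI) simp_all
  moreover have nz: "z \<noteq> 0" using z by auto
  then have "(1 - z) / z = (1 - z) * cnj z / of_real ((norm z)\<^sup>2)"
    unfolding complex_norm_square by simp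
  ultimately have "(1 - z) / z * P = (of_real (2 * Im z) * (- \<i> * (P * m))) / of_real ((norm z)\<^sup>2)" by simp
  then have "Im ((1 - z) / z * P) = Im (of_real (2 * Im z) * (- \<i> * (P * m))) / (norm z)\<^sup>2"
    by (simp only: Im_divide_of_real)
  also have "\<dots> = - (2 * Im z * Re (P * m)) / (norm z)\<^sup>2" by simp
  also have "\<dots> \<le> 0" using nn z unfolding m_def[symmetric] by (intro divide_nonpos_nonneg) auto
  finally show ?thesis by (simp add: P_def)
qed

text \<open>\<open>N = - (1 - z) p / z\<close> has nonnegative imaginary part and the polar part
  \<open>- 1 / z\<close> at 0. A boundary pole of this kind can be subtracted without losing the
  sign: Julia's inequality at the pole says \<open>Im (N z) \<ge> Im (- 1 / z)\<close>.\<close>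

lemma Im_one_minus_log_deriv:
  assumes z: "Im z > 0"
  shows "Im ((1 - z) * E z) \<le> 0"
proof -
  define Y where "Y z = (1 - z) * E z" for z
  define N where "N z = 1 - 1 / z - Y z" for z
  have YD: "(Y has_field_derivative (1 - z) * deriv E z - E z) (at z)" if "z \<in> slit_plane" for z
    unfolding Y_def[abs_def] using log_deriv_has_derivative[OF that] by (auto intro!: derivative_eq_intros)
  have Nhol: "N holomorphic_on {z. Im z > 0}"
    unfolding N_def[abs_def] Y_def
    by (intro holomorphic_intros holomorphic_on_subset[OF log_deriv_holomorphic]) (auto simp: upper_in_slit_plane)
  have Npos: "Im (N z) \<ge> 0" if "Im z > 0" for z
  proof -
    have "z \<noteq> 0" using that by auto
    then have "N z = - ((1 - z) / z * (1 + z * E z))" by (simp add: N_def Y_def field_simps)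
    then show ?thesis using Im_inverse_mult_nonpos[OF that] by simp
  qed
  have ND: "(N has_field_derivative 1 / z\<^sup>2 - ((1 - z) * deriv E z - E z)) (at z)"
    if "z \<in> slit_plane" "z \<noteq> 0" for z
    unfolding N_def[abs_def] using YD[OF that(1)] that(2)
    by (auto intro!: derivative_eq_intros simp: power2_eq_square)
  have dcont: "isCont (deriv E) 0"
    using holomorphic_deriv[OF log_deriv_holomorphic open_slit_plane] open_slit_plane zero_in_slit_plane
    by (meson continuous_on_eq_continuous_at holomorphic_on_imp_continuous_on)
  define D where "D x = 1 / (of_real x)\<^sup>2 - ((1 - of_real x) * deriv E (of_real x) - E (of_real x))" for x :: real
  \<comment> \<open>Julia's inequality at \<open>x < 0\<close> multiplied by \<open>x^2\<close>:
    both sides stay finite as \<open>x\<close> tends to the pole at 0.\<close>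
  let ?l = "\<lambda>x. Im z * (norm (of_real x * N z - (of_real x - 1 - of_real x * Y (of_real x))))\<^sup>2"
  let ?r = "\<lambda>x. Im (N z) * Re (1 - (of_real x)\<^sup>2 * ((1 - of_real x) * deriv E (of_real x) - E (of_real x))) * (norm (z - of_real x))\<^sup>2"
  have ine: "?l x \<le>
     ?r x"
    if x: "x < 0" for x :: real
  proof -
    have "Im (N (of_real x)) = 0" using log_deriv_real[of x] x by (simp add: N_def Y_def)
    then have "Im z * (norm (N z - N (of_real x)))\<^sup>2 \<le> Im (N z) * Re (D x) * (norm (z - of_real x))\<^sup>2"
      unfolding D_def using x of_real_in_slit_plane[of x] by (intro half_plane_julia[OF Nhol Npos ND _ z]) auto
    then have "x\<^sup>2 * (Im z * (norm (N z - N (of_real x)))\<^sup>2) \<le> x\<^sup>2 * (Im (N z) * Re (D x) * (norm (z - of_real x))\<^sup>2)"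
      by (rule mult_left_mono) simp
    then have "Im z * (\<bar>x\<bar> * norm (N z - N (of_real x)))\<^sup>2 \<le> Im (N z) * (x\<^sup>2 * Re (D x)) * (norm (z - of_real x))\<^sup>2"
      by (simp add: power_mult_distrib mult_ac)
    moreover have "\<bar>x\<bar> * norm (N z - N (of_real x)) = norm (of_real x * (N z - N (of_real x)))"
      by (simp add: norm_mult)
    moreover have "of_real x * (N z - N (of_real x)) = of_real x * N z - (of_real x - 1 - of_real x * Y (of_real x))"
      using x by (simp add: N_def algebra_simps)
    moreover have "(of_real x)\<^sup>2 * D x = 1 - (of_real x)\<^sup>2 * ((1 - of_real x) * deriv E (of_real x) - E (of_real x))"
      using x by (simp add: D_def right_diff_distrib)
    moreover have "x\<^sup>2 * Re (D x) = Re ((of_real x)\<^sup>2 * D x)" by (simp flip: of_real_power)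
    ultimately show ?thesis by (simp only:)
  qed
  have E: "((\<lambda>x. E (of_real x)) \<longlongrightarrow> E 0) (at_left (0::real))"
    "((\<lambda>x. deriv E (of_real x)) \<longlongrightarrow> deriv E 0) (at_left (0::real))"
    by (rule isCont_tendsto_compose[OF isCont_log_deriv] isCont_tendsto_compose[OF dcont]; auto intro!: tendsto_eq_intros)+
  have X: "((\<lambda>x. complex_of_real x) \<longlongrightarrow> of_real 0) (at_left (0::real))" by (intro tendsto_intros)
  let ?llim = "Im z * (norm (of_real 0 * N z - (of_real 0 - 1 - of_real 0 * ((1 - of_real 0) * E 0))))\<^sup>2"
  let ?rlim = "Im (N z) * Re (1 - (of_real 0)\<^sup>2 * ((1 - of_real 0) * deriv E 0 - E 0)) * (norm (z - of_real 0))\<^sup>2"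
  have "?llim \<le>
     ?rlim"
  proof (rule tendsto_le)
    show "(?l \<longlongrightarrow>
      ?llim) (at_left 0)"
      unfolding Y_def by (intro tendsto_intros X E)
    show "(?r \<longlongrightarrow>
      ?rlim) (at_left 0)"
      by (intro tendsto_intros X E)
    show "\<forall>\<^sub>F x in at_left (0::real). ?l x \<le>
     ?r x"
      unfolding eventually_at_left_field using ine by (intro exI[of _ "-1"]) auto
  qed simp
  then have "Im z \<le> Im (N z) * (norm z)\<^sup>2" by simp
  moreover have "Im (1 / z) = - Im z / (norm z)\<^sup>2" by (simp add: Im_divide cmod_power2)
  then have "Im (N z) * (norm z)\<^sup>2 = Im z - Im (Y z) * (norm z)\<^sup>2"
    using z by (auto simp: N_def left_diff_distrib)
  ultimately have "Im (Y z) * (norm z)\<^sup>2 \<le> 0" by simp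
  moreover have "(norm z)\<^sup>2 > 0" using z by auto
  ultimately have "Im (Y z) \<le> 0" by (simp add: mult_le_0_iff)
  then show ?thesis by (simp add: Y_def)
qed

lemma deriv_log_deriv_le: "Re (deriv E 0) \<le> Re (E 0)"
proof -
  have "((\<lambda>z. - ((1 - z) * E z)) has_field_derivative E 0 - deriv E 0) (at (of_real 0))"
    using log_deriv_has_derivative[OF zero_in_slit_plane] by (auto intro!: derivative_eq_intros)
  then have "Re (E 0 - deriv E 0) \<ge> 0"
    by (rule Im_nonneg_imp_deriv_nonneg) (use log_deriv_real[of 0] Im_one_minus_log_deriv in auto)
  then show ?thesis by simp
qed

lemma log_deriv_sq_le:
  assumes lim: "((\<lambda>x. x * Re (E (of_real x))) \<longlongrightarrow> - l) at_bot"
    and lim': "((\<lambda>x. x * (Re (E (of_real x)) + x * Re (deriv E (of_real x)))) \<longlongrightarrow> 0) at_bot"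
    and l: "l \<le> 1"
  shows "(Re (E 0))\<^sup>2 \<le> l * Re (deriv E 0)"
proof -
  define P where "P z = 1 + z * E z" for z
  \<comment> \<open>Julia's inequality for \<open>z p\<close> at \<open>x\<close>, divided by
    \<open>x^2\<close>, as \<open>x\<close> tends to minus infinity. Both \<open>p x\<close> and the
    derivative \<open>D x\<close> of \<open>z p\<close> tend to \<open>1 - l\<close>, which yields
    \<open>Im (z p) \<ge> (1 - l) Im z\<close>.\<close>
  have step1: "Im (z * (z * E z + of_real l)) \<ge> 0" if z: "Im z > 0" for z
  proof -
    define N where "N z = z * P z" for z
    have Nhol: "N holomorphic_on {z. Im z > 0}"
      unfolding N_def[abs_def] P_def
      by (intro holomorphic_intros holomorphic_on_subset[OF log_deriv_holomorphic]) (auto simp: upper_in_slit_plane)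
    have Npos: "Im (N z) \<ge> 0" if "Im z > 0" for z
      using Im_z_mult_nonneg[OF that] by (simp add: N_def P_def)
    have ND: "(N has_field_derivative P z + z * (E z + z * deriv E z)) (at z)" if "z \<in> slit_plane" for z
      unfolding N_def[abs_def] P_def using log_deriv_has_derivative[OF that] by (auto intro!: derivative_eq_intros simp: algebra_simps)
    define D where "D x = 1 + x * Re (E (of_real x)) + x * (Re (E (of_real x)) + x * Re (deriv E (of_real x)))" for x
    have P: "P (of_real x) = of_real (1 + x * Re (E (of_real x)))" if "x < 1" for x
      using log_deriv_real[OF that] by (simp add: P_def complex_eq_iff)
    have ine: "Im z * (norm (N z / of_real x - P (of_real x)))\<^sup>2 \<le> Im (N z) * D x * (norm (z / of_real x - 1))\<^sup>2"
      if x: "x < 0" for x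
    proof -
      have "Im (N (of_real x)) = 0" using log_deriv_real[of x] x by (simp add: N_def P_def)
      then have "Im z * (norm (N z - N (of_real x)))\<^sup>2 \<le> Im (N z) *
          Re (P (of_real x) + of_real x * (E (of_real x) + of_real x * deriv E (of_real x))) * (norm (z - of_real x))\<^sup>2"
        using x of_real_in_slit_plane[of x] by (intro half_plane_julia[OF Nhol Npos ND _ z]) auto
      also have "Re (P (of_real x) + of_real x * (E (of_real x) + of_real x * deriv E (of_real x))) = D x"
        using x P[of x] by (simp add: D_def)
      finally have "Im z * (norm (N z - N (of_real x)))\<^sup>2 / x\<^sup>2 \<le> Im (N z) * D x * (norm (z - of_real x))\<^sup>2 / x\<^sup>2"
        by (rule divide_right_mono) simp
      then have "Im z * (norm (N z - N (of_real x)) / \<bar>x\<bar>)\<^sup>2 \<le> Im (N z) * D x * (norm (z - of_real x) / \<bar>x\<bar>)\<^sup>2"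
        by (simp add: power_divide)
      moreover have "norm (N z - N (of_real x)) / \<bar>x\<bar> = norm ((N z - N (of_real x)) / of_real x)"
        "norm (z - of_real x) / \<bar>x\<bar> = norm ((z - of_real x) / of_real x)" by (simp_all add: norm_divide)
      moreover have "(N z - N (of_real x)) / of_real x = N z / of_real x - P (of_real x)"
        "(z - of_real x) / of_real x = z / of_real x - 1"
        using x by (simp_all add: N_def diff_divide_distrib)
      ultimately show ?thesis by (simp only:)
    qed
    have inf: "((\<lambda>x. w / complex_of_real x) \<longlongrightarrow> 0) at_bot" for w
    proof -
      have "((\<lambda>x. w * complex_of_real (inverse x)) \<longlongrightarrow> w * of_real 0) at_bot"
        by (intro tendsto_intros tendsto_mono[OF at_bot_le_at_infinity tendsto_inverse_0])
      then show ?thesis by (simp add: divide_inverse)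
    qed
    have limP: "((\<lambda>x. P (of_real x)) \<longlongrightarrow> of_real (1 + - l)) at_bot"
    proof (rule Lim_transform_eventually)
      show "((\<lambda>x. complex_of_real (1 + x * Re (E (of_real x)))) \<longlongrightarrow> of_real (1 + - l)) at_bot"
        by (intro tendsto_intros lim)
      show "\<forall>\<^sub>F x in at_bot. complex_of_real (1 + x * Re (E (of_real x))) = P (of_real x)"
        using P by (intro eventually_mono[OF eventually_le_at_bot[of "-1"]]) auto
    qed
    have limD: "(D \<longlongrightarrow> 1 + - l + 0) at_bot"
      unfolding D_def[abs_def] by (intro tendsto_intros lim lim')
    have "Im z * (norm (0 - complex_of_real (1 + - l)))\<^sup>2 \<le> Im (N z) * (1 + - l + 0) * (norm (0 - 1 :: complex))\<^sup>2"
    proof (rule tendsto_le)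
      show "((\<lambda>x. Im z * (norm (N z / of_real x - P (of_real x)))\<^sup>2) \<longlongrightarrow> Im z * (norm (0 - complex_of_real (1 + - l)))\<^sup>2) at_bot"
        by (intro tendsto_intros inf limP)
      show "((\<lambda>x. Im (N z) * D x * (norm (z / of_real x - 1))\<^sup>2) \<longlongrightarrow> Im (N z) * (1 + - l + 0) * (norm (0 - 1 :: complex))\<^sup>2) at_bot"
        by (intro tendsto_intros inf limD)
      show "\<forall>\<^sub>F x in at_bot. Im z * (norm (N z / of_real x - P (of_real x)))\<^sup>2 \<le> Im (N z) * D x * (norm (z / of_real x - 1))\<^sup>2"
        using ine by (intro eventually_mono[OF eventually_le_at_bot[of "-1"]]) auto
    qed simp
    moreover have "norm (0 - complex_of_real (1 + - l)) = 1 - l" using l by (simp del: of_real_diff of_real_add flip: of_real_minus)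
    ultimately have "(1 - l) * (Im z * (1 - l)) \<le> (1 - l) * Im (N z)" by (simp add: power2_eq_square mult_ac)
    \<comment> \<open>The factor \<open>1 - l\<close> can be cancelled only when positive; for
      \<open>l = 1\<close> the claim reduces to \<open>Npos\<close>.\<close>
    then have "Im z * (1 - l) \<le> Im (N z)" if "l \<noteq> 1" using l that by (simp add: mult_le_cancel_left)
    then have "Im z * (1 - l) \<le> Im (N z)" using Npos[OF z] by (cases "l = 1") auto
    moreover have "z * (z * E z + of_real l) = N z - of_real (1 - l) * z"
      by (simp add: N_def P_def algebra_simps)
    ultimately show ?thesis by (simp add: mult_ac)
  qed
  \<comment> \<open>Second use of Julia's inequality, now at 0, where this \<open>N\<close> vanishes
    with derivative \<open>l\<close>; at \<open>\<i> \<eta>\<close> it becomes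
    \<open>|E|^2 \<le> l Im E / \<eta>\<close>.\<close>
  define N where "N z = z * (z * E z + of_real l)" for z
  have Nhol: "N holomorphic_on {z. Im z > 0}"
    unfolding N_def[abs_def]
    by (intro holomorphic_intros holomorphic_on_subset[OF log_deriv_holomorphic]) (auto simp: upper_in_slit_plane)
  have Npos: "Im (N z) \<ge> 0" if "Im z > 0" for z using step1[OF that] by (simp add: N_def)
  have ND: "(N has_field_derivative of_real l) (at (of_real 0))"
    unfolding N_def[abs_def] using log_deriv_has_derivative[OF zero_in_slit_plane] by (auto intro!: derivative_eq_intros)
  have ine: "(norm (E (of_real 0 + \<i> * of_real \<eta>)))\<^sup>2 \<le> l * (Im (E (of_real 0 + \<i> * of_real \<eta>)) / \<eta>)" if \<eta>: "\<eta> > 0" for \<eta>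
  proof -
    define e where "e = E (\<i> * of_real \<eta>)"
    have "\<eta> * (norm (N (\<i> * of_real \<eta>)))\<^sup>2 \<le> Im (N (\<i> * of_real \<eta>)) * l * \<eta>\<^sup>2"
      using half_plane_julia[OF Nhol Npos ND, of "\<i> * of_real \<eta>"] \<eta> by (simp add: N_def norm_mult)
    moreover have "(norm (N (\<i> * of_real \<eta>)))\<^sup>2 = \<eta>\<^sup>2 * ((l - \<eta> * Im e)\<^sup>2 + (\<eta> * Re e)\<^sup>2)"
      unfolding cmod_power2 N_def e_def[symmetric] by (simp add: power2_eq_square algebra_simps)
    moreover have "Im (N (\<i> * of_real \<eta>)) = \<eta> * (l - \<eta> * Im e)"
      unfolding N_def e_def[symmetric] by (simp add: algebra_simps)
    ultimately have "\<eta> ^ 3 * ((l - \<eta> * Im e)\<^sup>2 + (\<eta> * Re e)\<^sup>2) \<le> \<eta> ^ 3 * ((l - \<eta> * Im e) * l)"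
      by (simp add: power2_eq_square power3_eq_cube mult_ac)
    then have "(l - \<eta> * Im e)\<^sup>2 + (\<eta> * Re e)\<^sup>2 \<le> (l - \<eta> * Im e) * l" using \<eta> by simp
    then have "\<eta> * (\<eta> * ((Re e)\<^sup>2 + (Im e)\<^sup>2)) \<le> \<eta> * (l * Im e)"
      by (simp add: power2_eq_square algebra_simps)
    then have "\<eta> * (norm e)\<^sup>2 \<le> l * Im e" using \<eta> unfolding cmod_power2 by simp
    then show ?thesis using \<eta> by (simp add: e_def field_simps)
  qed
  have c: "isCont E (of_real 0)" using isCont_log_deriv[OF zero_in_slit_plane] by simp
  have "(norm (E (of_real 0)))\<^sup>2 \<le> l * Re (deriv E 0)"
  proof (rule tendsto_le)
    show "((\<lambda>\<eta>. (norm (E (of_real 0 + \<i> * of_real \<eta>)))\<^sup>2) \<longlongrightarrow> (norm (E (of_real 0)))\<^sup>2) (at_right 0)"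
      by (intro tendsto_intros tendsto_vertical c)
    show "((\<lambda>\<eta>. l * (Im (E (of_real 0 + \<i> * of_real \<eta>)) / \<eta>)) \<longlongrightarrow> l * Re (deriv E 0)) (at_right 0)"
      using log_deriv_has_derivative[OF zero_in_slit_plane] log_deriv_real[of 0]
      by (intro tendsto_intros tendsto_Im_vertical) auto
    show "\<forall>\<^sub>F \<eta> in at_right 0. (norm (E (of_real 0 + \<i> * of_real \<eta>)))\<^sup>2 \<le> l * (Im (E (of_real 0 + \<i> * of_real \<eta>)) / \<eta>)"
      using ine by (rule eventually_at_right_less[THEN eventually_mono])
  qed simp
  moreover have "(norm (E (of_real 0)))\<^sup>2 = (Re (E 0))\<^sup>2"
    using log_deriv_real[of 0] by (simp add: cmod_power2)
  ultimately show ?thesis by simp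
qed

end

section \<open>The Gauss continued fraction\<close>

definition slit_cone :: "complex \<Rightarrow> complex set" where
  "slit_cone z = {of_real \<alpha> + of_real \<beta> * (1 - z) |\<alpha> \<beta>. \<alpha> \<ge> 0 \<and> \<beta> \<ge> 0}"

lemma slit_coneI: "\<alpha> \<ge> 0 \<Longrightarrow> \<beta> \<ge> 0 \<Longrightarrow> of_real \<alpha> + of_real \<beta> * (1 - z) \<in> slit_cone z"
  unfolding slit_cone_def by blast

text \<open>If the total weight is positive, the element equals
  \<open>(\<alpha> + \<beta>) (1 - t z)\<close> with
  \<open>t = \<beta> / (\<alpha> + \<beta>)\<close> in [0,1], so it is controlled by the distance of
  1 from the segment between 0 and \<open>z\<close>.\<close>

lemma slit_cone_lower_bound:
  fixes z :: complex
  assumes d: "\<And>t. t \<in> {0..1} \<Longrightarrow> d \<le> norm (1 - of_real t * z)"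
    and nonneg: "\<alpha> \<ge> 0" "\<beta> \<ge> 0"
  shows "(\<alpha> + \<beta>) * d \<le> norm (of_real \<alpha> + of_real \<beta> * (1 - z))"
proof (cases "\<alpha> + \<beta> = 0")
  case False
  then have s: "\<alpha> + \<beta> > 0" using nonneg by simp
  then have "(\<alpha> + \<beta>) * (\<beta> / (\<alpha> + \<beta>)) = \<beta>" by simp
  then have "of_real (\<alpha> + \<beta>) * of_real (\<beta> / (\<alpha> + \<beta>)) = complex_of_real \<beta>"
    by (simp only: of_real_mult[symmetric])
  then have "of_real (\<alpha> + \<beta>) * (1 - of_real (\<beta> / (\<alpha> + \<beta>)) * z) = of_real (\<alpha> + \<beta>) - of_real \<beta> * z"
    by (simp only: right_diff_distrib mult.assoc[symmetric] mult_1_right)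
  then have "of_real \<alpha> + of_real \<beta> * (1 - z) = of_real (\<alpha> + \<beta>) * (1 - of_real (\<beta> / (\<alpha> + \<beta>)) * z)"
    by (simp add: algebra_simps del: of_real_divide)
  then have "norm (of_real \<alpha> + of_real \<beta> * (1 - z)) = (\<alpha> + \<beta>) * norm (1 - of_real (\<beta> / (\<alpha> + \<beta>)) * z)"
    using s by (simp only: norm_mult norm_of_real abs_of_pos)
  moreover have "\<beta> / (\<alpha> + \<beta>) \<in> {0..1}" using nonneg s by simp
  ultimately show ?thesis using mult_left_mono[OF d less_imp_le[OF s]] by metis
qed (use nonneg in auto)

lemma slit_dist_pos:
  assumes "compact S" "S \<subseteq> slit_plane"
  obtains d where "d > 0" "\<And>t z. t \<in> {0..1} \<Longrightarrow> z \<in> S \<Longrightarrow> d \<le> norm (1 - of_real t * z)"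
proof (cases "S = {}")
  case True then show ?thesis using that[of 1] by auto
next
  case False
  define n where "n x = norm (1 - complex_of_real (fst x) * snd x)" for x
  have "compact ({0..1::real} \<times> S)" using assms by (intro compact_Times) auto
  moreover have "{0..1::real} \<times> S \<noteq> {}" using False by auto
  moreover have "continuous_on ({0..1::real} \<times> S) n"
    unfolding n_def by (intro continuous_intros)
  ultimately have "\<exists>x\<in>{0..1} \<times> S. \<forall>y\<in>{0..1} \<times> S. n x \<le> n y" by (rule continuous_attains_inf)
  then obtain x where x: "x \<in> {0..1} \<times> S" "\<And>y. y \<in> {0..1} \<times> S \<Longrightarrow> n x \<le> n y" by blast
  have "norm (1 - of_real (fst x) * snd x) > 0"
    using one_minus_mult_neq_0[of "snd x" "fst x"] x(1) assms(2) by auto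
  then show ?thesis
  proof (rule that)
    fix t :: real and z assume "t \<in> {0..1}" "z \<in> S"
    then show "norm (1 - of_real (fst x) * snd x) \<le> norm (1 - of_real t * z)" using x(2)[of "(t, z)"] by (simp add: n_def)
  qed
qed

lemma slit_cone_nz:
  assumes z: "z \<in> slit_plane" and "\<alpha> \<ge> 0" "\<beta> \<ge> 0" "\<alpha> + \<beta> > 0"
  shows "of_real \<alpha> + of_real \<beta> * (1 - z) \<noteq> 0"
proof -
  obtain d where d: "d > 0" "\<And>t. t \<in> {0..1} \<Longrightarrow> d \<le> norm (1 - of_real t * z)"
    by (rule slit_dist_pos[of "{z}"]) (use z in auto)
  show ?thesis
  proof
    assume "of_real \<alpha> + of_real \<beta> * (1 - z) = 0"
    with slit_cone_lower_bound[OF d(2) assms(2,3)] have "(\<alpha> + \<beta>) * d \<le> 0" by simp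
    with mult_pos_pos[OF assms(4) d(1)] show False by simp
  qed
qed

text \<open>After multiplication by \<open>cnj (1 + w)\<close> the products \<open>w cnj w\<close>
  and \<open>(1 - z) cnj (1 - z)\<close> are nonnegative reals, and every other term is a
  nonnegative multiple of 1 or of \<open>1 - z\<close>. Hence the cone is invariant under a step of
  the continued fraction.\<close>

lemma slit_cone_step:
  assumes z: "z \<in> slit_plane" and w: "w \<in> slit_cone z"
  shows "1 + w \<noteq> 0" "1 - z + w \<noteq> 0" "(1 - z + w) / (1 + w) \<in> slit_cone z"
proof -
  obtain \<alpha> \<beta> where ab: "\<alpha> \<ge> 0" "\<beta> \<ge> 0" "w = of_real \<alpha> + of_real \<beta> * (1 - z)"
    using w unfolding slit_cone_def by blast
  have "of_real (1 + \<alpha>) + of_real \<beta> * (1 - z) \<noteq> 0"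
    using slit_cone_nz[OF z, of "1 + \<alpha>" \<beta>] ab by simp
  then show nz: "1 + w \<noteq> 0" by (simp add: ab add.assoc)
  have "of_real \<alpha> + of_real (1 + \<beta>) * (1 - z) \<noteq> 0"
    using slit_cone_nz[OF z, of \<alpha> "1 + \<beta>"] ab by simp
  then show "1 - z + w \<noteq> 0" by (simp add: ab algebra_simps)
  define N where "N = (norm (1 + w))\<^sup>2"
  have N: "N > 0" using nz by (simp add: N_def)
  define p q where "p = \<alpha> + \<beta> * (norm (1 - z))\<^sup>2 + (norm w)\<^sup>2" and "q = 1 + \<alpha> + \<beta>"
  have "(1 - z + w) * cnj (1 + w) = of_real p + of_real q * (1 - z)"
  proof -
    have "(1 - z) * cnj (1 - z) = of_real ((norm (1 - z))\<^sup>2)" "w * cnj w = of_real ((norm w)\<^sup>2)"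
      by (simp_all add: complex_norm_square del: complex_cnj_diff of_real_power)
    moreover have "(1 - z + w) * cnj (1 + w) =
       (1 - z) + (1 - z) * of_real \<alpha> + of_real \<beta> * ((1 - z) * cnj (1 - z)) + w + w * cnj w"
      by (simp add: ab(3) algebra_simps)
    ultimately show ?thesis unfolding p_def q_def by (simp add: ab(3) algebra_simps)
  qed
  moreover have "(1 - z + w) / (1 + w) = (1 - z + w) * cnj (1 + w) / ((1 + w) * cnj (1 + w))"
    using nz by (simp del: complex_cnj_add)
  moreover have "(1 + w) * cnj (1 + w) = of_real N"
    unfolding N_def complex_norm_square ..
  ultimately have "(1 - z + w) / (1 + w) = (of_real p + of_real q * (1 - z)) / of_real N"
    by (simp only:)
  also have "\<dots> = of_real (p / N) + of_real (q / N) * (1 - z)"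
    by (simp add: add_divide_distrib)
  also have "\<dots> \<in> slit_cone z"
    using N ab by (intro slit_coneI divide_nonneg_pos) (auto simp: p_def q_def)
  finally show "(1 - z + w) / (1 + w) \<in> slit_cone z" .
qed

lemma slit_cone_scale: "w \<in> slit_cone z \<Longrightarrow> k \<ge> 0 \<Longrightarrow> of_real k * w \<in> slit_cone z"
proof -
  assume "w \<in> slit_cone z" "k \<ge> 0"
  then obtain \<alpha> \<beta> where ab: "\<alpha> \<ge> 0" "\<beta> \<ge> 0" "w = of_real \<alpha> + of_real \<beta> * (1 - z)"
    unfolding slit_cone_def by blast
  have "of_real k * w = of_real (k * \<alpha>) + of_real (k * \<beta>) * (1 - z)"
    by (simp add: ab algebra_simps)
  then show ?thesis using slit_coneI[of "k * \<alpha>" "k * \<beta>" z] ab \<open>k \<ge> 0\<close> by simp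
qed

lemma one_in_slit_cone: "1 \<in> slit_cone z"
  using slit_coneI[of 1 0 z] by simp

text \<open>\<open>Re (m / r)\<close> has the sign of \<open>Re (m cnj r)\<close>, which is a
  nonnegative combination of the two quantities assumed positive.\<close>

lemma slit_cone_Re_pos:
  assumes "r \<in> slit_cone z" "r \<noteq> 0" "Re m > 0" "Re (m * cnj (1 - z)) > 0"
  shows "Re (1 / r * m) > 0"
proof -
  obtain \<alpha> \<beta> where ab: "\<alpha> \<ge> 0" "\<beta> \<ge> 0" "r = of_real \<alpha> + of_real \<beta> * (1 - z)"
    using assms(1) unfolding slit_cone_def by blast
  have "m * cnj r = of_real \<alpha> * m + of_real \<beta> * (m * cnj (1 - z))" by (simp add: ab algebra_simps)
  then have eq: "Re (m * cnj r) = \<alpha> * Re m + \<beta> * Re (m * cnj (1 - z))"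
    by (simp only: plus_complex.simps times_complex.simps Re_complex_of_real Im_complex_of_real)
  have "\<alpha> > 0 \<or> \<beta> > 0" using ab assms(2) by (cases "\<alpha> = 0"; cases "\<beta> = 0") auto
  then have "Re (m * cnj r) > 0" unfolding eq using ab assms(3,4)
    by (auto intro: add_pos_nonneg add_nonneg_pos)
  moreover have "1 / r * m = m * cnj r / of_real ((norm r)\<^sup>2)"
    unfolding complex_norm_square using assms(2) by simp
  ultimately show ?thesis using assms(2) by (simp only: Re_divide_of_real) simp
qed

text \<open>The recursion is \<open>r(A,B,C) = (1 - z + k r(B,A+1,C+1)) / (1 + k r(B,A+1,C+1))\<close>, satisfied by
  \<open>r(A,B,C) = F(A,B;C) / F(A+1,B;C)\<close> with \<open>k = (C - B) / B\<close>.\<close>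

fun gauss_cf :: "nat \<Rightarrow> real \<Rightarrow> real \<Rightarrow> real \<Rightarrow> complex \<Rightarrow> complex" where
  "gauss_cf 0 A B C z = 1"
| "gauss_cf (Suc n) A B C z =
     (1 - z + of_real ((C - B) / B) * gauss_cf n B (A + 1) (C + 1) z) /
     (1 + of_real ((C - B) / B) * gauss_cf n B (A + 1) (C + 1) z)"

text \<open>The parameter range is stable under
  \<open>(A, B, C) \<mapsto> (B, A + 1, C + 1)\<close>; the bound \<open>-1 < A\<close> is there
  because \<open>A + 1\<close> takes the place of \<open>B\<close>.\<close>

lemma gauss_cf_in_cone:
  assumes "z \<in> slit_plane" "0 < B" "B < C" "-1 < A" "A < C"
  shows "gauss_cf n A B C z \<in> slit_cone z"
  using assms(2-)
proof (induction n arbitrary: A B C)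
  case (Suc n)
  have "gauss_cf n B (A + 1) (C + 1) z \<in> slit_cone z" by (rule Suc.IH) (use Suc.prems in auto)
  then have "of_real ((C - B) / B) * gauss_cf n B (A + 1) (C + 1) z \<in> slit_cone z"
    by (rule slit_cone_scale) (use Suc.prems in auto)
  from slit_cone_step(3)[OF assms(1) this] show ?case by simp
qed (simp add: one_in_slit_cone)

lemma gauss_cf_holomorphic:
  assumes "0 < B" "B < C" "-1 < A" "A < C"
  shows "gauss_cf n A B C holomorphic_on slit_plane"
  using assms
proof (induction n arbitrary: A B C)
  case (Suc n)
  have "gauss_cf n B (A + 1) (C + 1) holomorphic_on slit_plane" by (rule Suc.IH) (use Suc.prems in auto)
  moreover have "1 + of_real ((C - B) / B) * gauss_cf n B (A + 1) (C + 1) z \<noteq> 0" if z: "z \<in> slit_plane" for z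
    by (intro slit_cone_step(1)[OF z] slit_cone_scale gauss_cf_in_cone z) (use Suc.prems in auto)
  ultimately show ?case
    by (subst gauss_cf.simps(2)[abs_def]) (intro holomorphic_intros; blast)
next
  case 0
  have "gauss_cf 0 A B C = (\<lambda>_. 1)" by (rule ext) simp
  then show ?case by simp
qed

section \<open>Convergence of the continued fraction to a quotient of two series\<close>

definition hyp_ratio_fps :: "real \<Rightarrow> real \<Rightarrow> real \<Rightarrow> complex fps" where
  "hyp_ratio_fps A B C = hyp_fps (of_real A) (of_real B) (of_real C) * inverse (hyp_fps (of_real A + 1) (of_real B) (of_real C))"

lemma hyp_fps_0: "fps_nth (hyp_fps a b c) 0 = 1"
  by (simp add: hyp_fps_nth)

lemma of_real_pos_not_nonpos_Int: "c > 0 \<Longrightarrow> complex_of_real c \<notin> \<int>\<^sub>\<le>\<^sub>0"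
  by (auto elim!: nonpos_Ints_cases simp: complex_eq_iff)

text \<open>The quotient of the two contiguous relations. Multiplying by the nonzero series
  \<open>b V T\<close> clears both inverses, after which the relations can be substituted.\<close>

lemma hyp_ratio_fps_rec:
  assumes "0 < B" "B < C"
  defines "k \<equiv> fps_const (complex_of_real ((C - B) / B))"
  shows "hyp_ratio_fps A B C * (1 + k * hyp_ratio_fps B (A + 1) (C + 1)) =
     1 - fps_X + k * hyp_ratio_fps B (A + 1) (C + 1)"
proof -
  define a b c where "a = complex_of_real A" "b = complex_of_real B" "c = complex_of_real C"
  note abc = this
  have c: "c \<notin> \<int>\<^sub>\<le>\<^sub>0" unfolding abc using assms by (intro of_real_pos_not_nonpos_Int) simp
  have b: "b \<noteq> 0" using assms by (simp add: abc)
  define S T U V where "S = hyp_fps a b c" and "T = hyp_fps (a + 1) b c"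
    and "U = hyp_fps (a + 1) b (c + 1)" and "V = hyp_fps (a + 1) (b + 1) (c + 1)"
  have inv: "T * inverse T = 1" "V * inverse V = 1"
    by (simp_all add: T_def V_def hyp_fps_0 inverse_mult_eq_1')
  have r: "hyp_ratio_fps A B C = S * inverse T" "hyp_ratio_fps B (A + 1) (C + 1) = U * inverse V"
    unfolding hyp_ratio_fps_def S_def T_def U_def V_def abc
    by (simp_all add: hyp_fps_commute[of "of_real B"] hyp_fps_commute[of "of_real B + 1"])
  have e1: "fps_const b * V + fps_const (c - b) * U = fps_const c * T"
    unfolding V_def U_def T_def by (rule hyp_fps_contiguous1[OF c])
  have e2: "fps_const b * (1 - fps_X) * V + fps_const (c - b) * U = fps_const c * S"
    unfolding V_def U_def S_def by (rule hyp_fps_contiguous2[OF c])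
  have k: "fps_const b * k = fps_const (c - b)" using b by (simp add: k_def abc)
  have "fps_const b * V * T * (S * inverse T * (1 + k * (U * inverse V)))
      = S * (T * inverse T) * (fps_const b * V + (fps_const b * k) * U * (V * inverse V))"
    by (simp add: algebra_simps)
  also have "\<dots> = S * (fps_const c * T)" unfolding inv k e1[symmetric] by simp
  also have "\<dots> = T * (fps_const c * S)" by simp
  also have "\<dots> = T * (fps_const b * (1 - fps_X) * V + (fps_const b * k) * U * (V * inverse V))"
    unfolding inv k e2[symmetric] by simp
  also have "\<dots> = fps_const b * V * T * (1 - fps_X + k * (U * inverse V))" by (simp add: algebra_simps)
  finally have "fps_const b * V * T * (S * inverse T * (1 + k * (U * inverse V))) =
     fps_const b * V * T * (1 - fps_X + k * (U * inverse V))" .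
  moreover have "fps_nth V 0 \<noteq> 0" "fps_nth T 0 \<noteq> 0" by (simp_all add: V_def T_def hyp_fps_0)
  then have "fps_const b * V * T \<noteq> 0" using b by auto
  ultimately show ?thesis unfolding r by simp
qed

text \<open>Each step gains one order of agreement: the difference of two values of
  \<open>u \<mapsto> (1 - X + k u) / (1 + k u)\<close> carries an explicit factor \<open>X\<close>
  besides the difference of the arguments.\<close>

lemma gauss_cf_expansion:
  assumes "0 < B" "B < C" "-1 < A" "A < C"
  shows "\<exists>P. gauss_cf n A B C has_fps_expansion P \<and> fps_nth P 0 = 1 \<and> fps_X ^ Suc n dvd hyp_ratio_fps A B C - P"
  using assms
proof (induction n arbitrary: A B C)
  case 0
  have "fps_nth (hyp_ratio_fps A B C - 1) 0 = 0" by (simp add: hyp_ratio_fps_def hyp_fps_0)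
  then have "hyp_ratio_fps A B C - 1 = fps_X * fps_shift 1 (hyp_ratio_fps A B C - 1)"
    by (intro fps_ext) (auto simp: fps_X_mult_nth)
  then have "fps_X dvd hyp_ratio_fps A B C - 1" by (rule dvdI)
  moreover have "gauss_cf 0 A B C = (\<lambda>_. 1)" by (rule ext) simp
  ultimately show ?case by (intro exI[of _ 1]) auto
next
  case (Suc n)
  obtain P where P: "gauss_cf n B (A + 1) (C + 1) has_fps_expansion P" "fps_nth P 0 = 1"
     "fps_X ^ Suc n dvd hyp_ratio_fps B (A + 1) (C + 1) - P"
    using Suc.IH[of "A + 1" "C + 1" B] Suc.prems by auto
  define K where "K = (C - B) / B"
  have K: "K > 0" using Suc.prems by (simp add: K_def)
  define k where "k = fps_const (complex_of_real K)"
  define R R' where "R = hyp_ratio_fps A B C" and "R' = hyp_ratio_fps B (A + 1) (C + 1)"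
  define Q where "Q = (1 - fps_X + k * P) / (1 + k * P)"
  have K1: "1 + complex_of_real K \<noteq> 0" using K by (simp add: complex_eq_iff)
  have d0: "fps_nth (1 + k * P) 0 \<noteq> 0" using P(2) K1 by (simp add: k_def)
  have exp: "gauss_cf (Suc n) A B C has_fps_expansion Q"
    unfolding gauss_cf.simps(2)[abs_def] Q_def K_def[symmetric] k_def
    by (intro fps_expansion_intros P) (use d0 in \<open>simp add: k_def\<close>)
  have Q: "Q * (1 + k * P) = 1 - fps_X + k * P"
    unfolding Q_def using d0 by (simp add: fps_divide_unit mult.assoc inverse_mult_eq_1)
  have R: "R * (1 + k * R') = 1 - fps_X + k * R'"
    unfolding R_def R'_def k_def K_def using Suc.prems by (intro hyp_ratio_fps_rec) auto
  have R'0: "fps_nth R' 0 = 1" by (simp add: R'_def hyp_ratio_fps_def hyp_fps_0)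
  have "(R - Q) * ((1 + k * R') * (1 + k * P)) = R * (1 + k * R') * (1 + k * P) - Q * (1 + k * P) * (1 + k * R')"
    by (simp add: algebra_simps)
  also have "\<dots> = fps_X * (k * (R' - P))" unfolding Q R by (simp add: algebra_simps)
  finally have eq: "(R - Q) * ((1 + k * R') * (1 + k * P)) = fps_X * (k * (R' - P))" .
  have u: "fps_nth ((1 + k * R') * (1 + k * P)) 0 \<noteq> 0" using P(2) R'0 K1 by (simp add: k_def)
  define D where "D = (1 + k * R') * (1 + k * P)"
  have "R - Q = (R - Q) * (D * inverse D)" using inverse_mult_eq_1'[OF u] by (simp add: D_def)
  then have "R - Q = fps_X * (k * (R' - P)) * inverse D"
    unfolding mult.assoc[symmetric] D_def by (simp only: eq[unfolded mult.assoc[symmetric]])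
  moreover have "fps_X * fps_X ^ Suc n dvd fps_X * (k * (R' - P)) * inverse D"
    using P(3) unfolding R'_def by (intro dvd_mult2 mult_dvd_mono dvd_refl dvd_mult)
  ultimately have "fps_X ^ Suc (Suc n) dvd R - Q" by simp
  moreover have "fps_nth Q 0 = 1"
  proof -
    have "fps_nth (Q * (1 + k * P)) 0 = fps_nth (1 - fps_X + k * P) 0" unfolding Q ..
    then show ?thesis using K1 P(2) by (simp add: k_def)
  qed
  ultimately show ?case using exp unfolding R_def by blast
qed


text \<open>The convergents and their reciprocals are locally bounded because the denominators lie
  in the cone with total weight at least 1. Montel gives a limit \<open>g\<close>, agreement of
  coefficients identifies it, and the bound on reciprocals excludes zeros.\<close>

lemma gauss_ratio:
  assumes ABC: "0 < B" "B < C" "-1 < A" "A < C"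
  obtains g where "g holomorphic_on slit_plane" "g has_fps_expansion inverse (hyp_ratio_fps A B C)"
    "\<And>z m. z \<in> slit_plane \<Longrightarrow> Re m > 0 \<Longrightarrow> Re (m * cnj (1 - z)) > 0 \<Longrightarrow> Re (g z * m) > 0"
proof -
  \<comment> \<open>With index \<open>Suc n\<close> at least one step is unfolded, so
    \<open>p n z\<close> always has the form \<open>(1 + \<omega>) / (1 - z + \<omega>)\<close> with
    \<open>\<omega>\<close> in the cone.\<close>
  define p where "p n z = 1 / gauss_cf (Suc n) A B C z" for n z
  define K where "K = (C - B) / B"
  have K: "K > 0" using ABC by (simp add: K_def)
  define \<omega> where "\<omega> n z = of_real K * gauss_cf n B (A + 1) (C + 1) z" for n z
  have \<omega>: "\<omega> n z \<in> slit_cone z" if "z \<in> slit_plane" for n z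
    unfolding \<omega>_def using ABC K that by (intro slit_cone_scale gauss_cf_in_cone) auto
  have cf: "gauss_cf (Suc n) A B C z = (1 - z + \<omega> n z) / (1 + \<omega> n z)" for n z
    by (simp add: \<omega>_def K_def)
  have cf_nz: "gauss_cf (Suc n) A B C z \<noteq> 0" if "z \<in> slit_plane" for n z
    unfolding cf using slit_cone_step(1,2)[OF that \<omega>[OF that]] by simp
  have p_hol: "p n holomorphic_on slit_plane" for n
    unfolding p_def[abs_def] using cf_nz ABC by (intro holomorphic_intros gauss_cf_holomorphic) auto
  have p_bounds: "\<exists>M. M > 0 \<and> (\<forall>n. \<forall>z\<in>S. norm (p n z) \<le> M \<and> norm (1 / p n z) \<le> M)"
    if S: "compact S" "S \<subseteq> slit_plane" for S
  proof -
    obtain d where d: "d > 0" "\<And>t z. t \<in> {0..1} \<Longrightarrow> z \<in> S \<Longrightarrow> d \<le> norm (1 - of_real t * z)"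
      using slit_dist_pos[OF S] by blast
    obtain Z where Z: "\<And>z. z \<in> S \<Longrightarrow> norm z \<le> Z" using compact_imp_bounded[OF S(1)] bounded_iff by metis
    have "norm (p n z) \<le> 1 + \<bar>Z\<bar> / d \<and> norm (1 / p n z) \<le> 1 + \<bar>Z\<bar> / d" if z: "z \<in> S" for n z
    proof -
      have zs: "z \<in> slit_plane" using z S by blast
      obtain \<alpha> \<beta> where ab: "\<alpha> \<ge> 0" "\<beta> \<ge> 0" "\<omega> n z = of_real \<alpha> + of_real \<beta> * (1 - z)"
        using \<omega>[OF zs, of n] unfolding slit_cone_def by blast
      have "(\<alpha> + (1 + \<beta>)) * d \<le> norm (of_real \<alpha> + of_real (1 + \<beta>) * (1 - z))"
        by (rule slit_cone_lower_bound) (use d(2) z ab in auto)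
      moreover have "of_real \<alpha> + of_real (1 + \<beta>) * (1 - z) = 1 - z + \<omega> n z"
        by (simp add: ab(3) algebra_simps)
      moreover have "1 * d \<le> (\<alpha> + (1 + \<beta>)) * d" using ab d(1) by (intro mult_right_mono) auto
      ultimately have low: "d \<le> norm (1 - z + \<omega> n z)" by simp
      have nz: "1 + \<omega> n z \<noteq> 0" "1 - z + \<omega> n z \<noteq> 0" using slit_cone_step(1,2)[OF zs \<omega>[OF zs]] by auto
      have e1: "(\<alpha> + 1 + \<beta>) * d \<le> norm (of_real (\<alpha> + 1) + of_real \<beta> * (1 - z))"
        by (rule slit_cone_lower_bound) (use d(2) z ab in auto)
      have e2: "of_real (\<alpha> + 1) + of_real \<beta> * (1 - z) = 1 + \<omega> n z"
        by (simp add: ab(3) algebra_simps)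
      have "1 * d \<le> (\<alpha> + 1 + \<beta>) * d" using ab d(1) by (intro mult_right_mono) auto
      then have low': "d \<le> norm (1 + \<omega> n z)" using e1 unfolding e2 by linarith
      have bd: "norm (1 + z / x) \<le> 1 + \<bar>Z\<bar> / d" "norm (1 - z / x) \<le> 1 + \<bar>Z\<bar> / d" if "d \<le> norm x" for x
      proof -
        have "norm z / norm x \<le> \<bar>Z\<bar> / d"
          using Z[OF z] that d(1) by (intro frac_le) auto
        then show "norm (1 + z / x) \<le> 1 + \<bar>Z\<bar> / d" "norm (1 - z / x) \<le> 1 + \<bar>Z\<bar> / d"
          using norm_triangle_ineq[of 1 "z / x"] norm_triangle_ineq4[of 1 "z / x"] by (simp_all add: norm_divide)
      qed
      have "p n z = 1 + z / (1 - z + \<omega> n z)" "1 / p n z = 1 - z / (1 + \<omega> n z)"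
        unfolding p_def cf using nz by (simp_all add: field_simps)
      then show ?thesis using bd[OF low] bd[OF low'] by simp
    qed
    moreover have "1 + \<bar>Z\<bar> / d > 0" using d(1) by (intro add_pos_nonneg) auto
    ultimately show ?thesis by (intro exI[of _ "1 + \<bar>Z\<bar> / d"]) auto
  qed
  have p_bound: "\<exists>M. \<forall>h\<in>range p. \<forall>z\<in>S. norm (h z) \<le> M" if S: "compact S" "S \<subseteq> slit_plane" for S
    using p_bounds[OF S] by auto
  obtain g \<rho> where g: "g holomorphic_on slit_plane" "strict_mono (\<rho> :: nat \<Rightarrow> nat)"
    "\<And>z. z \<in> slit_plane \<Longrightarrow> (\<lambda>n. p (\<rho> n) z) \<longlonglongrightarrow> g z"
    "\<And>S. compact S \<Longrightarrow> S \<subseteq> slit_plane \<Longrightarrow> uniform_limit S (p \<circ> \<rho>) g sequentially"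
    by (rule Montel[OF open_slit_plane, of "range p" p]) (use p_hol p_bound in auto)
  obtain R0 where R0: "R0 = inverse (hyp_ratio_fps A B C)" by blast
  have ratio0: "fps_nth (hyp_ratio_fps A B C) 0 = 1" by (simp add: hyp_ratio_fps_def hyp_fps_0)
  have g_exp: "g has_fps_expansion R0"
  proof -
    have an: "g analytic_on {0}" using g(1) open_slit_plane
      by (simp add: analytic_on_open[symmetric] analytic_on_subset[of g slit_plane])
    \<comment> \<open>Only a subsequence converges, but each Taylor coefficient of the convergents
      is eventually that of \<open>R0\<close>, which determines the limit.\<close>
    have "fps_expansion g 0 = R0"
    proof (rule fps_ext)
      fix m
      have "(\<lambda>n. (deriv ^^ m) ((p \<circ> \<rho>) n) 0) \<longlonglongrightarrow> (deriv ^^ m) g 0"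
      proof (rule higher_deriv_complex_uniform_limit[where A = "ball 0 (1/2)"])
        have "cball 0 (1/2) \<subseteq> slit_plane" using ball_subset_slit_plane by force
        then show "uniform_limit (ball 0 (1/2)) (p \<circ> \<rho>) g sequentially"
          by (intro uniform_limit_on_subset[OF g(4)[of "cball 0 (1/2)"]]) auto
        have "ball (0::complex) (1/2) \<subseteq> slit_plane" using ball_subset_slit_plane by force
        then show "\<forall>\<^sub>F n in sequentially. (p \<circ> \<rho>) n holomorphic_on ball 0 (1/2)"
          by (auto intro!: always_eventually holomorphic_on_subset[OF p_hol])
      qed auto
      moreover have "(deriv ^^ m) ((p \<circ> \<rho>) n) 0 = fps_nth R0 m * fact m" if "n \<ge> m" for n
      proof -
        have "\<rho> n \<ge> m" using that seq_suble[OF g(2), of n] by simp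
        obtain P where P: "gauss_cf (Suc (\<rho> n)) A B C has_fps_expansion P" "fps_nth P 0 = 1"
          "fps_X ^ Suc (Suc (\<rho> n)) dvd hyp_ratio_fps A B C - P"
          using gauss_cf_expansion[OF ABC] by blast
        have "p (\<rho> n) has_fps_expansion 1 / P"
          unfolding p_def[abs_def] by (intro fps_expansion_intros P) (use P in simp)
        then have "fps_nth (1 / P) m = (deriv ^^ m) (p (\<rho> n)) 0 / fact m" by (rule fps_nth_fps_expansion)
        moreover have iP: "1 / P = inverse P" using P(2) by (simp add: fps_divide_unit)
        moreover have "fps_nth (inverse P) m = fps_nth R0 m"
        proof -
          obtain Q where Q: "hyp_ratio_fps A B C - P = fps_X ^ Suc (Suc (\<rho> n)) * Q" using P(3) by (elim dvdE)
          have i1: "P * inverse P = 1" using P(2) by (simp add: inverse_mult_eq_1')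
          have i2: "hyp_ratio_fps A B C * R0 = 1" unfolding R0 using ratio0 by (simp add: inverse_mult_eq_1')
          have "inverse P - R0 = (hyp_ratio_fps A B C - P) * (inverse P * R0)"
          proof -
            have "(hyp_ratio_fps A B C - P) * (inverse P * R0) =
               (hyp_ratio_fps A B C * R0) * inverse P - (P * inverse P) * R0" by (simp add: algebra_simps)
            then show ?thesis unfolding i1 i2 by simp
          qed
          also have "\<dots> = fps_X ^ Suc (Suc (\<rho> n)) * (Q * (inverse P * R0))" unfolding Q by (simp add: mult.assoc)
          finally have "fps_nth (inverse P - R0) m = fps_nth (fps_X ^ Suc (Suc (\<rho> n)) * (Q * (inverse P * R0))) m" by simp
          also have "\<dots> = 0" using \<open>\<rho> n \<ge> m\<close> by (subst fps_X_power_mult_nth) simp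
          finally show ?thesis by simp
        qed
        ultimately show ?thesis by simp
      qed
      then have "\<forall>\<^sub>F n in sequentially. (deriv ^^ m) ((p \<circ> \<rho>) n) 0 = fps_nth R0 m * fact m"
        by (rule eventually_sequentiallyI)
      ultimately have "(\<lambda>n. fps_nth R0 m * fact m) \<longlonglongrightarrow> (deriv ^^ m) g 0"
        by (rule Lim_transform_eventually)
      then have "(deriv ^^ m) g 0 = fps_nth R0 m * fact m" by (rule LIMSEQ_unique[OF _ tendsto_const])
      then show "fps_nth (fps_expansion g 0) m = fps_nth R0 m" by (simp add: fps_expansion_def)
    qed
    moreover have "g has_fps_expansion fps_expansion g 0" using an by (rule analytic_at_imp_has_fps_expansion_0)
    ultimately show ?thesis by simp
  qed
  show thesis
  proof (rule that[OF g(1) g_exp[unfolded R0]])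
    fix z m assume z: "z \<in> slit_plane" and m: "Re m > 0" "Re (m * cnj (1 - z)) > 0"
    have nonneg: "Re (g z * m') \<ge> 0" if m': "Re m' > 0" "Re (m' * cnj (1 - z)) > 0" for m'
    proof (rule tendsto_lowerbound)
      show "(\<lambda>n. Re (p (\<rho> n) z * m')) \<longlonglongrightarrow> Re (g z * m')" by (intro tendsto_intros g(3) z)
      have "Re (p n z * m') > 0" for n
        unfolding p_def by (intro slit_cone_Re_pos[OF _ cf_nz[OF z] m'] gauss_cf_in_cone z ABC)
      then show "\<forall>\<^sub>F n in sequentially. 0 \<le> Re (p (\<rho> n) z * m')" by (simp add: less_imp_le)
    qed simp
    \<comment> \<open>A lower bound on the convergents passes to the limit, so \<open>g z\<close> is
      nonzero; strict positivity depends on it.\<close>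
    obtain M where M: "M > 0" "\<And>n. norm (1 / p n z) \<le> M" using p_bounds[of "{z}"] z by auto
    have "1 / M \<le> norm (g z)"
    proof (rule tendsto_lowerbound)
      show "(\<lambda>n. norm (p (\<rho> n) z)) \<longlonglongrightarrow> norm (g z)" by (intro tendsto_intros g(3) z)
      have "1 / M \<le> norm (p n z)" for n
      proof -
        have "p n z \<noteq> 0" using cf_nz[OF z] by (simp add: p_def)
        then show ?thesis using M(1) M(2)[of n] by (simp add: norm_divide field_simps)
      qed
      then show "\<forall>\<^sub>F n in sequentially. 1 / M \<le> norm (p (\<rho> n) z)" by simp
    qed simp
    then have gz: "norm (g z) > 0" using M(1) divide_pos_pos[OF zero_less_one M(1)] by linarith
    have "open {m. Re m > 0 \<and> Re (m * cnj (1 - z)) > 0}"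
      by (intro open_Collect_conj open_Collect_less continuous_intros)
    then obtain e where e: "e > 0" "ball m e \<subseteq> {m. Re m > 0 \<and> Re (m * cnj (1 - z)) > 0}"
      using m openE[of _ m] by blast
    define \<eta> where "\<eta> = e / (2 * norm (g z))"
    have \<eta>: "\<eta> > 0" using e(1) gz by (simp add: \<eta>_def)
    \<comment> \<open>The admissible \<open>m\<close> form an open set. Moving \<open>m\<close>
      along \<open>- cnj (g z)\<close> lowers the real part by \<open>\<eta> |g z|^2\<close>, so the
      weak inequality at \<open>m'\<close> is strict at \<open>m\<close>.\<close>
    define m' where "m' = m - of_real \<eta> * cnj (g z)"
    have "dist m m' = \<eta> * norm (g z)" using \<eta> by (simp add: m'_def dist_norm norm_mult)
    then have "m' \<in> ball m e" using e(1) gz by (simp add: \<eta>_def)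
    then have "Re (g z * m') \<ge> 0" using e(2) by (intro nonneg) blast+
    moreover have "g z * m' = g z * m - of_real \<eta> * (g z * cnj (g z))" by (simp add: m'_def algebra_simps)
    then have "g z * m' = g z * m - of_real (\<eta> * (norm (g z))\<^sup>2)"
      unfolding of_real_mult complex_norm_square .
    then have "Re (g z * m') = Re (g z * m) - \<eta> * (norm (g z))\<^sup>2" by simp
    moreover have "\<eta> * (norm (g z))\<^sup>2 > 0" using \<eta> gz by simp
    ultimately show "Re (g z * m) > 0" by linarith
  qed
qed

section \<open>Sufficiency: hypergeometric functions and powers\<close>

lemma hyp2F1_universally_starlike:
  fixes a b c :: real
  assumes "0 < a" "a \<le> 1" "0 < b" "b < c" "a < c"
  shows "universally_starlike (\<lambda>z. z * hyp2F1 (of_real a) (of_real b) (of_real c) z)"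
proof -
  define F where "F = hyp2F1 (of_real a) (of_real b) (of_real c)"
  define S T where "S = hyp_fps (of_real a) (of_real b) (of_real c)" and "T = hyp_fps (of_real a + 1) (of_real b) (of_real c)"
  have c: "complex_of_real c \<notin> \<int>\<^sub>\<le>\<^sub>0" using assms by (intro of_real_pos_not_nonpos_Int) simp
  have F: "F holomorphic_on slit_plane" "F has_fps_expansion S"
    unfolding F_def S_def using hyp2F1_props[OF c] by auto
  have "fps_nth S 0 = F 0" using fps_nth_fps_expansion[OF F(2), of 0] by simp
  then have F0: "F 0 = 1" by (simp add: S_def hyp_fps_0)
  obtain g where g: "g holomorphic_on slit_plane" "g has_fps_expansion inverse (hyp_ratio_fps a b c)"
    "\<And>z m. z \<in> slit_plane \<Longrightarrow> Re m > 0 \<Longrightarrow> Re (m * cnj (1 - z)) > 0 \<Longrightarrow> Re (g z * m) > 0"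
    by (rule gauss_ratio[of b c a]) (use assms in auto)
  \<comment> \<open>\<open>g\<close> was obtained as a limit and not by dividing by
    \<open>F\<close>, so this equation is available before zeros of \<open>F\<close> are
    excluded.\<close>
  have eqF: "z * deriv F z = of_real a * (g z - 1) * F z" if "z \<in> slit_plane" for z
  proof (rule slit_plane_eqI[OF _ _ _ _ that])
    show "(\<lambda>z. z * deriv F z) holomorphic_on slit_plane" "(\<lambda>z. of_real a * (g z - 1) * F z) holomorphic_on slit_plane"
      by (intro holomorphic_intros F g open_slit_plane)+
    show "(\<lambda>z. z * deriv F z) has_fps_expansion fps_X * fps_deriv S"
      by (intro fps_expansion_intros F)
    have ex: "(\<lambda>z. of_real a * (g z - 1) * F z) has_fps_expansion fps_const (of_real a) * (inverse (hyp_ratio_fps a b c) - 1) * S"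
      by (intro fps_expansion_intros F g)
    have "inverse (hyp_ratio_fps a b c) * S = T"
    proof -
      have i: "S * inverse S = 1" "T * inverse T = 1" by (simp_all add: S_def T_def hyp_fps_0 inverse_mult_eq_1')
      have "inverse (inverse T) = T" by (rule fps_inverse_idempotent) (simp add: T_def hyp_fps_0)
      then have "inverse (hyp_ratio_fps a b c) = inverse S * T"
        unfolding hyp_ratio_fps_def S_def[symmetric] T_def[symmetric] by (simp add: fps_inverse_mult)
      then show ?thesis using i by (simp add: mult_ac)
    qed
    then have "fps_const (of_real a) * (inverse (hyp_ratio_fps a b c) - 1) * S = fps_const (of_real a) * T - fps_const (of_real a) * S"
      by (simp add: algebra_simps)
    moreover have "fps_const (of_real a) * T = fps_const (of_real a) * S + fps_X * fps_deriv S"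
      unfolding S_def T_def by (rule hyp_fps_shift_a)
    ultimately have "fps_const (of_real a) * (inverse (hyp_ratio_fps a b c) - 1) * S = fps_X * fps_deriv S"
      by (simp only: add_diff_cancel_left')
    with ex show "(\<lambda>z. of_real a * (g z - 1) * F z) has_fps_expansion fps_X * fps_deriv S" by (simp only:)
  qed
  \<comment> \<open>Away from 0 the function solves \<open>F' = (a (g - 1) / z) F\<close>, so a zero
    would make \<open>F\<close> vanish on a disk and then on the whole slit plane, against
    \<open>F 0 = 1\<close>.\<close>
  have Fnz: "F z0 \<noteq> 0" if z0: "z0 \<in> slit_plane" for z0
  proof
    assume Fz0: "F z0 = 0"
    then have "z0 \<noteq> 0" using F0 by auto
    then have "z0 \<in> slit_plane - {0}" "open (slit_plane - {0})" using z0 open_slit_plane by (auto intro: open_delete)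
    then obtain e where e: "e > 0" "ball z0 e \<subseteq> slit_plane - {0}" using openE by blast
    have "(\<lambda>z. of_real a * (g z - 1) / z) holomorphic_on ball z0 e"
      using e(2) by (intro holomorphic_intros holomorphic_on_subset[OF g(1)]) blast+
    then obtain \<kappa> where \<kappa>0: "\<And>z. z \<in> ball z0 e \<Longrightarrow> (\<kappa> has_field_derivative of_real a * (g z - 1) / z) (at z within ball z0 e)"
      by (rule holomorphic_convex_primitive'[OF convex_ball open_ball]) blast
    have \<kappa>: "(\<kappa> has_field_derivative of_real a * (g z - 1) / z) (at z)" if "z \<in> ball z0 e" for z
      using \<kappa>0[OF that] unfolding at_within_open[OF that open_ball] .
    have "((\<lambda>z. F z * exp (- \<kappa> z)) has_field_derivative 0) (at z)" if z: "z \<in> ball z0 e" for z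
    proof -
      have "z \<in> slit_plane - {0}" using z e(2) by blast
      then have zs: "z \<in> slit_plane" "z \<noteq> 0" by auto
      have d: "deriv F z = of_real a * (g z - 1) / z * F z" using eqF[OF zs(1)] zs(2) by (simp add: field_simps)
      have "((\<lambda>z. F z * exp (- \<kappa> z)) has_field_derivative
         deriv F z * exp (- \<kappa> z) + exp (- \<kappa> z) * - (of_real a * (g z - 1) / z) * F z) (at z)"
        using holomorphic_derivI[OF F(1) open_slit_plane zs(1)] \<kappa>[OF z]
        by (auto intro!: derivative_eq_intros)
      then show ?thesis unfolding d by (simp add: algebra_simps)
    qed
    then have "((\<lambda>z. F z * exp (- \<kappa> z)) has_field_derivative 0) (at z within ball z0 e)" if "z \<in> ball z0 e" for z
      using that has_field_derivative_at_within by blast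
    then have "\<exists>k. \<forall>z\<in>ball z0 e. F z * exp (- \<kappa> z) = k"
      by (rule has_field_derivative_zero_constant[OF convex_ball])
    then obtain k where k: "\<And>z. z \<in> ball z0 e \<Longrightarrow> F z * exp (- \<kappa> z) = k" by blast
    have "k = 0" using k[of z0] Fz0 e(1) by simp
    then have zero: "F z = 0" if "z \<in> ball z0 e" for z using k[OF that] by simp
    have "F 0 = 0"
    proof (rule analytic_continuation_open[where f = F and g = "\<lambda>_. 0" and s = "ball z0 e" and s' = slit_plane])
      show "ball z0 e \<noteq> {}" using e(1) by simp
      show "ball z0 e \<subseteq> slit_plane" using e(2) by blast
    qed (use zero in \<open>simp_all add: connected_slit_plane open_slit_plane F\<close>)
    with F0 show False by simp
  qed
  show ?thesis
  proof (rule universally_starlikeI[OF F(1) Fnz F0])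
    fix z m assume z: "z \<in> slit_plane" and m: "Re m > 0" "Re (m * cnj (1 - z)) > 0"
    have eq: "z * deriv F z / F z = of_real a * (g z - 1)" unfolding eqF[OF z] using Fnz[OF z] by simp
    have "(1 + z * deriv F z / F z) * m = of_real (1 - a) * m + of_real a * (g z * m)"
      unfolding eq by (simp add: algebra_simps)
    then have "Re ((1 + z * deriv F z / F z) * m) = (1 - a) * Re m + a * Re (g z * m)"
      by (simp only: plus_complex.simps times_complex.simps(1)[of "of_real _"] Re_complex_of_real Im_complex_of_real)
    also have "\<dots> > 0" using assms m g(3)[OF z m] by (intro add_nonneg_pos mult_nonneg_nonneg mult_pos_pos) auto
    finally show "Re ((1 + z * deriv F z / F z) * m) > 0" .
  next
    show "z * hyp2F1 (of_real a) (of_real b) (of_real c) z = z * F z" for z unfolding F_def ..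
  qed
qed

lemma power_universally_starlike:
  assumes k: "0 \<le> k" "k \<le> 1" and f: "\<And>z. z \<in> slit_plane \<Longrightarrow> f z = z * (1 - z) powr (- complex_of_real k)"
  shows "universally_starlike f"
proof (rule universally_starlikeI[OF _ _ _ _ f])
  show "(\<lambda>z. (1 - z) powr (- complex_of_real k)) holomorphic_on slit_plane"
    using one_minus_slit_plane by (intro holomorphic_intros) auto
  fix z assume z: "z \<in> slit_plane"
  then have nz: "1 - z \<noteq> 0" using one_minus_slit_plane[OF z] by auto
  then show "(1 - z) powr (- complex_of_real k) \<noteq> 0" by simp
  fix m assume m: "Re m > 0" "Re (m * cnj (1 - z)) > 0"
  let ?p = "1 + z * deriv (\<lambda>z. (1 - z) powr (- complex_of_real k)) z / (1 - z) powr (- complex_of_real k)"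
  define P where "P = (1 - z) powr (- complex_of_real k)"
  have "((\<lambda>w. w powr (- complex_of_real k)) has_field_derivative (- of_real k * (1 - z) powr (- of_real k - 1))) (at (1 - z))"
    by (rule has_field_derivative_powr[OF one_minus_slit_plane[OF z]])
  then have "((\<lambda>z. (1 - z) powr (- complex_of_real k)) has_field_derivative (- of_real k * (1 - z) powr (- of_real k - 1)) * (- 1)) (at z)"
    by (rule DERIV_chain2) (auto intro!: derivative_eq_intros)
  then have "deriv (\<lambda>z. (1 - z) powr (- complex_of_real k)) z = of_real k * (P / (1 - z))"
    using nz by (simp add: DERIV_imp_deriv P_def powr_diff)
  moreover have "P \<noteq> 0" using nz by (simp add: P_def)
  ultimately have "?p
      = 1 + z * (of_real k / (1 - z))"
    unfolding P_def[symmetric] by simp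
  also have "\<dots> = of_real (1 - k) + of_real k * (1 / (1 - z))" using nz by (simp add: field_simps)
  finally have X: "?p
      = of_real (1 - k) + of_real k * (1 / (1 - z))" .
  have "?p * m
      = of_real (1 - k) * m + of_real k * (1 / (1 - z) * m)" unfolding X by (simp add: algebra_simps)
  then have "Re (?p * m)
      = (1 - k) * Re m + k * Re (1 / (1 - z) * m)"
    by (simp only: plus_complex.simps times_complex.simps(1)[of "of_real _"] Re_complex_of_real Im_complex_of_real)
  moreover have "1 - z \<in> slit_cone z" using slit_coneI[of 0 1 z] by simp
  then have "Re (1 / (1 - z) * m) > 0" by (rule slit_cone_Re_pos[OF _ nz m])
  then have "(1 - k) * Re m + k * Re (1 / (1 - z) * m) > 0" using k m
    by (cases "k = 0") (auto intro: add_nonneg_pos)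
  ultimately show "Re (?p * m) > 0"
    by simp
qed simp

section \<open>Constraints on the parameters\<close>

lemma hyp2F1_ode:
  fixes a b c z :: complex
  assumes "c \<notin> \<int>\<^sub>\<le>\<^sub>0" "z \<in> slit_plane"
  defines "F \<equiv> hyp2F1 a b c"
  shows "z * (1 - z) * deriv (deriv F) z + (c - (a + b + 1) * z) * deriv F z = a * b * F z"
proof -
  have F: "F holomorphic_on slit_plane" "F has_fps_expansion hyp_fps a b c"
    unfolding F_def using hyp2F1_props[OF assms(1)] by auto
  let ?S = "hyp_fps a b c"
  have "(\<lambda>z. z * (1 - z) * deriv (deriv F) z + (c - (a + b + 1) * z) * deriv F z) has_fps_expansion
     fps_X * (1 - fps_X) * fps_deriv (fps_deriv ?S) + (fps_const c - fps_const (a + b + 1) * fps_X) * fps_deriv ?S"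
    by (intro fps_expansion_intros F)
  moreover have "(\<lambda>z. a * b * F z) has_fps_expansion fps_const (a * b) * ?S"
    by (intro fps_expansion_intros F)
  ultimately show ?thesis
    unfolding hyp_fps_ode[OF assms(1)]
    by (rule slit_plane_eqI[OF _ _ _ _ assms(2), rotated 2]) (intro holomorphic_intros F open_slit_plane)+
qed

lemma hyp2F1_0:
  assumes "c \<notin> \<int>\<^sub>\<le>\<^sub>0"
  shows "hyp2F1 a b c 0 = 1" "c * deriv (hyp2F1 a b c) 0 = a * b"
    "c * (c + 1) * deriv (deriv (hyp2F1 a b c)) 0 = a * (a + 1) * b * (b + 1)"
proof -
  note F = hyp2F1_expansion[OF assms, of a b]
  have nz: "c \<noteq> 0" "c + 1 \<noteq> 0" using assms not_nonpos_Int_plus_nat[OF assms, of 1] by auto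
  show "hyp2F1 a b c 0 = 1" using fps_nth_fps_expansion[OF F, of 0] by (simp add: hyp_fps_nth)
  show "c * deriv (hyp2F1 a b c) 0 = a * b"
    using fps_nth_fps_expansion[OF F, of 1] nz by (simp add: hyp_fps_nth field_simps)
  show "c * (c + 1) * deriv (deriv (hyp2F1 a b c)) 0 = a * (a + 1) * b * (b + 1)"
  proof -
    define D where "D = deriv (deriv (hyp2F1 a b c)) 0"
    have p2: "pochhammer x 2 = x * (x + 1)" for x :: complex by (simp add: pochhammer_Suc numeral_2_eq_2)
    have "(deriv ^^ 2) (hyp2F1 a b c) 0 = D" by (simp add: D_def numeral_2_eq_2)
    then have "(a * (a + 1)) * (b * (b + 1)) / ((c * (c + 1)) * 2) = D / 2"
      using fps_nth_fps_expansion[OF F, of 2] unfolding hyp_fps_nth p2 by simp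
    then have "(a * (a + 1)) * (b * (b + 1)) / (c * (c + 1)) = D"
      unfolding divide_divide_eq_left[symmetric] by simp
    then show ?thesis unfolding D_def[symmetric] using nz by auto
  qed
qed

lemma log_deriv_riccati:
  assumes F: "F holomorphic_on slit_plane" "\<And>z. z \<in> slit_plane \<Longrightarrow> F z \<noteq> 0" and z: "z \<in> slit_plane"
  shows "deriv (log_deriv F) z + (log_deriv F z)\<^sup>2 = deriv (deriv F) z / F z"
proof -
  have "(log_deriv F has_field_derivative (deriv (deriv F) z * F z - deriv F z * deriv F z) / (F z * F z)) (at z)"
    unfolding log_deriv_def[abs_def]
    by (rule DERIV_divide) (use holomorphic_derivI[OF F(1) open_slit_plane z] F(2)[OF z]
        holomorphic_derivI[OF holomorphic_deriv[OF F(1) open_slit_plane] open_slit_plane z] in auto)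
  from DERIV_imp_deriv[OF this] show ?thesis
    using F(2)[OF z] by (simp add: log_deriv_def field_simps power2_eq_square)
qed

text \<open>If \<open>c\<close> equals \<open>a\<close> or \<open>b\<close>, the factor
  \<open>c + n\<close> cancels from the coefficient recursion and a binomial series remains; if
  \<open>a b = 0\<close>, the series is constant and \<open>k = 0\<close>.\<close>

lemma hyp2F1_degenerate:
  assumes "c \<notin> \<int>\<^sub>\<le>\<^sub>0" "a * b = 0 \<or> c = a \<or> c = b"
  obtains k where "\<And>z. z \<in> slit_plane \<Longrightarrow> (1 - z) * deriv (hyp2F1 a b c) z = k * hyp2F1 a b c z"
proof -
  let ?S = "hyp_fps a b c"
  have "\<exists>k. (1 - fps_X) * fps_deriv ?S = fps_const k * ?S"
  proof -
    have "\<exists>k. \<forall>n. of_nat (Suc n) * fps_nth ?S (Suc n) = (k + of_nat n) * fps_nth ?S n"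
    proof -
      have nz: "c + of_nat n \<noteq> 0" for n using not_nonpos_Int_plus_nat[OF assms(1), of n] by auto
      have rec: "(c + of_nat n) * (of_nat (Suc n) * fps_nth ?S (Suc n)) = (a + of_nat n) * (b + of_nat n) * fps_nth ?S n" for n
        using hyp_fps_Suc[OF assms(1), of a b n] by (simp add: mult_ac)
      consider "c = b" | "c = a" | "a * b = 0" using assms(2) by blast
      then show ?thesis
      proof cases
        case 1
        have "of_nat (Suc n) * fps_nth ?S (Suc n) = (a + of_nat n) * fps_nth ?S n" for n
          using rec[of n] nz[of n] unfolding 1 by (simp del: of_nat_Suc add: mult.assoc mult.left_commute[of "a + _"])
        then show ?thesis by blast
      next
        case 2
        have "of_nat (Suc n) * fps_nth ?S (Suc n) = (b + of_nat n) * fps_nth ?S n" for n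
          using rec[of n] nz[of n] unfolding 2 by (simp del: of_nat_Suc add: mult.assoc)
        then show ?thesis by blast
      next
        case 3
        have z: "fps_nth ?S (Suc n) = 0" for n using 3 by (auto simp: hyp_fps_nth pochhammer_rec)
        have "of_nat (Suc n) * fps_nth ?S (Suc n) = (0 + of_nat n) * fps_nth ?S n" for n
          using z by (cases n) auto
        then show ?thesis by blast
      qed
    qed
    then obtain k where k: "\<And>n. of_nat (Suc n) * fps_nth ?S (Suc n) = (k + of_nat n) * fps_nth ?S n" by blast
    have "(1 - fps_X) * fps_deriv ?S = fps_const k * ?S"
    proof (rule fps_ext)
      fix n
      have "(1 - fps_X) * fps_deriv ?S = fps_deriv ?S - fps_X * fps_deriv ?S" by (simp add: algebra_simps)
      then have "fps_nth ((1 - fps_X) * fps_deriv ?S) n = of_nat (Suc n) * fps_nth ?S (Suc n) - of_nat n * fps_nth ?S n"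
        by (simp only: fps_sub_nth fps_X_mult_deriv_nth) simp
      then show "fps_nth ((1 - fps_X) * fps_deriv ?S) n = fps_nth (fps_const k * ?S) n"
        unfolding k by (simp add: algebra_simps)
    qed
    then show ?thesis by blast
  qed
  then obtain k where k: "(1 - fps_X) * fps_deriv ?S = fps_const k * ?S" by blast
  note F = hyp2F1_props[OF assms(1), of a b]
  have "(\<lambda>z. (1 - z) * deriv (hyp2F1 a b c) z) has_fps_expansion (1 - fps_X) * fps_deriv ?S"
    "(\<lambda>z. k * hyp2F1 a b c z) has_fps_expansion fps_const k * ?S"
    by (intro fps_expansion_intros F)+
  then show thesis
    unfolding k by (intro that[of k] slit_plane_eqI) (auto intro!: holomorphic_intros F open_slit_plane)
qed

lemma constant_log_deriv_imp_power:
  assumes F: "F holomorphic_on slit_plane" "F 0 = 1" and us: "universally_starlike (\<lambda>z. z * F z)"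
    and k: "\<And>z. z \<in> slit_plane \<Longrightarrow> (1 - z) * log_deriv F z = k"
  shows "\<exists>k::real. 0 \<le> k \<and> k \<le> 1 \<and> (\<forall>z\<in>slit_plane. F z = (1 - z) powr (- of_real k))"
proof -
  define r where "r = Re k"
  have k0: "log_deriv F 0 = k" using k[of 0] by simp
  then have kr: "k = of_real r" using log_deriv_real[OF F us, of 0] by (simp add: r_def complex_eq_iff)
  have r0: "r \<ge> 0" using log_deriv_0_nonneg[OF F us] k0 by (simp add: r_def)
  have E: "log_deriv F z = of_real r / (1 - z)" if "z \<in> slit_plane" for z
  proof -
    have "1 - z \<noteq> 0" using one_minus_slit_plane[OF that] by auto
    then show ?thesis using k[OF that] kr by (simp add: nonzero_eq_divide_eq mult.commute)
  qed
  have "r \<le> 1"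
  proof (rule ccontr)
    assume "\<not> r \<le> 1"
    then have r: "r > 1" by simp
    \<comment> \<open>\<open>1 + x E x \<ge> 0\<close> amounts to
      \<open>1 + x (r - 1) \<ge> 0\<close>; at this point the left side is -1.\<close>
    define x where "x = - 2 / (r - 1)"
    have x: "x < 0" using r by (simp add: x_def)
    have "log_deriv F (of_real x) = of_real (r / (1 - x))"
      using E[of "of_real x"] x by (simp add: slit_plane_iff)
    then have "1 + x * (r / (1 - x)) \<ge> 0" using mult_log_deriv_ge[OF F us, of x] x by simp
    then have "1 + x * (r - 1) \<ge> 0" using x by (simp add: field_simps)
    then show False using r by (simp add: x_def)
  qed
  moreover have "F z = (1 - z) powr (- of_real r)" if z: "z \<in> slit_plane" for z
  proof -
    define H where "H z = F z * (1 - z) powr (of_real r)" for z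
    have D: "(H has_field_derivative 0) (at z)" if z: "z \<in> slit_plane" for z
    proof -
      have nz: "1 - z \<noteq> 0" "F z \<noteq> 0" using one_minus_slit_plane[OF z] universally_starlike_factor_nonzero[OF F us z] by auto
      have "((\<lambda>w. w powr of_real r) has_field_derivative (of_real r * (1 - z) powr (of_real r - 1))) (at (1 - z))"
        by (rule has_field_derivative_powr[OF one_minus_slit_plane[OF z]])
      then have "((\<lambda>z. (1 - z) powr of_real r) has_field_derivative (of_real r * (1 - z) powr (of_real r - 1)) * (- 1)) (at z)"
        by (rule DERIV_chain2) (auto intro!: derivative_eq_intros)
      from DERIV_mult[OF holomorphic_derivI[OF F(1) open_slit_plane z] this]
      have "(H has_field_derivative deriv F z * (1 - z) powr of_real r +
         (of_real r * (1 - z) powr (of_real r - 1)) * (- 1) * F z) (at z)" by (simp add: H_def[abs_def])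
      moreover have "deriv F z = of_real r / (1 - z) * F z" using E[OF z] nz by (simp add: log_deriv_def field_simps)
      moreover have "(1 - z) powr (of_real r - 1) = (1 - z) powr of_real r / (1 - z)" using nz by (simp add: powr_diff)
      ultimately show ?thesis by simp
    qed
    then have "continuous_on slit_plane H"
      by (intro continuous_at_imp_continuous_on ballI DERIV_isCont) auto
    then obtain C where "\<And>z. z \<in> slit_plane \<Longrightarrow> H z = C"
      using DERIV_zero_connected_constant[OF connected_slit_plane open_slit_plane finite.emptyI] D by blast
    then have "H z = H 0" using z by simp
    then have "F z * (1 - z) powr of_real r = 1" using F(2) by (simp add: H_def)
    moreover have "(1 - z) powr of_real r \<noteq> 0" using one_minus_slit_plane[OF z] by auto
    ultimately have "F z = 1 / (1 - z) powr of_real r" by (simp add: nonzero_eq_divide_eq)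
    then show ?thesis by (simp add: powr_minus divide_inverse)
  qed
  ultimately show ?thesis using r0 by blast
qed

text \<open>Here \<open>m1\<close> and \<open>m2\<close> are \<open>E 0\<close> and
  \<open>E' 0\<close>, \<open>l\<close> is the parameter found at minus infinity and
  \<open>e\<close> the other one. With \<open>g = m1 / l = e / c\<close> and
  \<open>t = m2 / m1\<close> the inequalities read \<open>g \<le> t \<le> 1\<close>, and the
  equations become \<open>(c + 1) (t - g) = (1 + l) (1 - g)\<close> and
  \<open>(c + 1) (1 - t) = (c - l) (1 - g)\<close>. The first gives \<open>c + 1 > 0\<close>, the
  second \<open>c \<ge> l\<close>.\<close>

lemma parameter_inequalities:
  fixes l e c m1 m2 :: real
  assumes "c * m1 = l * e" "(c + 1) * m2 = m1 * (1 + l + e - m1)"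
    and "m1 \<ge> 0" "m2 \<le> m1" "m1\<^sup>2 \<le> l * m2" "0 \<le> l"
    and "c \<noteq> 0" "l * e \<noteq> 0" "c \<noteq> l" "c \<noteq> e"
  shows "0 < l \<and> l < c \<and> 0 < e \<and> e < c"
proof -
  have l: "l > 0" using assms by auto
  have m1: "m1 > 0" using assms by (cases "m1 = 0") auto
  define g t where "g = m1 / l" and "t = m2 / m1"
  have g0: "g > 0" using l m1 by (simp add: g_def)
  have e: "e = g * c" using assms(1) l by (simp add: g_def field_simps)
  have m1g: "m1 = g * l" using l by (simp add: g_def)
  have m2t: "m2 = t * m1" using m1 by (simp add: t_def)
  have t1: "t \<le> 1" using assms(4) m1 by (simp add: t_def)
  have "m1 * (g * l) \<le> m1 * (l * t)" using assms(5) unfolding m2t by (simp add: m1g[symmetric] power2_eq_square mult_ac)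
  then have gt: "g \<le> t" using m1 l by (simp add: mult.commute)
  have "g \<noteq> 1" using assms(10) e by auto
  then have g1: "g < 1" using gt t1 by simp
  have "m1 * ((c + 1) * t) = m1 * (1 + l + e - m1)" using assms(2) by (simp add: m2t mult_ac)
  then have "(c + 1) * t = 1 + l + e - m1" using m1 by simp
  then have ct: "(c + 1) * t = 1 + l + g * c - g * l" unfolding e m1g .
  have "(c + 1) * (t - g) = (1 + l) * (1 - g)" using ct by (simp add: algebra_simps)
  moreover have "(1 + l) * (1 - g) > 0" using l g1 by simp
  ultimately have "(c + 1) * (t - g) > 0" by simp
  then have c1: "c + 1 > 0" using gt by (simp add: zero_less_mult_iff)
  have "(c + 1) * (1 - t) = (c - l) * (1 - g)" using ct by (simp add: algebra_simps)
  moreover have "(c + 1) * (1 - t) \<ge> 0" using c1 t1 by simp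
  ultimately have "c - l \<ge> 0" using g1 by (simp add: zero_le_mult_iff)
  then have "l < c" using assms(9) by simp
  moreover have "0 < e" "e < c" using g0 g1 l \<open>l < c\<close> by (auto simp: e)
  ultimately show ?thesis using l by simp
qed

section \<open>Behaviour at minus infinity\<close>

lemma mono_bounded_tendsto_at_bot:
  fixes q :: "real \<Rightarrow> real"
  assumes mono: "\<And>x y. x \<le> y \<Longrightarrow> y \<le> 0 \<Longrightarrow> q x \<le> q y" and ge: "\<And>x. x \<le> 0 \<Longrightarrow> b \<le> q x"
  obtains L where "(q \<longlongrightarrow> L) at_bot" "b \<le> L" "L \<le> q 0"
proof -
  define L where "L = Inf (q ` {..0})"
  have bdd: "bdd_below (q ` {..0})" using ge by (intro bdd_belowI[of _ b]) auto
  have L: "L \<le> q x" if "x \<le> 0" for x unfolding L_def using that by (intro cInf_lower bdd) auto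
  have "(q \<longlongrightarrow> L) at_bot"
  proof (rule tendstoI)
    fix eps :: real assume "eps > 0"
    then have "Inf (q ` {..0}) < L + eps" by (simp add: L_def)
    then obtain x0 where x0: "x0 \<le> 0" "q x0 < L + eps" using cInf_lessD[of "q ` {..0}" "L + eps"] by auto
    have "dist (q x) L < eps" if "x \<le> x0" for x
      using L[of x] mono[OF that x0(1)] x0 that by (simp add: dist_real_def)
    then show "\<forall>\<^sub>F x in at_bot. dist (q x) L < eps" unfolding eventually_at_bot_linorder by blast
  qed
  moreover have "b \<le> L" unfolding L_def using ge by (intro cInf_greatest) auto
  ultimately show ?thesis using that L[of 0] by auto
qed

text \<open>Otherwise \<open>q\<close> would grow logarithmically.\<close>

lemma log_scale_derivative_limit_zero:
  fixes q :: "real \<Rightarrow> real"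
  assumes q: "(q \<longlongrightarrow> L) at_bot" and der: "\<And>x. x < 0 \<Longrightarrow> (q has_real_derivative q' x) (at x)"
    and lim: "((\<lambda>x. x * q' x) \<longlongrightarrow> \<Lambda>) at_bot"
  shows "\<Lambda> = 0"
proof (rule ccontr)
  assume "\<Lambda> \<noteq> 0"
  then have pos: "\<bar>\<Lambda>\<bar> / 2 > 0" "\<bar>\<Lambda>\<bar> / 8 > 0" by auto
  have "\<forall>\<^sub>F x in at_bot. dist (x * q' x) \<Lambda> < \<bar>\<Lambda>\<bar> / 2 \<and> dist (q x) L < \<bar>\<Lambda>\<bar> / 8"
    using tendstoD[OF lim pos(1)] tendstoD[OF q pos(2)] by (rule eventually_conj)
  then obtain x0 where x0: "\<And>x. x \<le> x0 \<Longrightarrow> \<bar>x * q' x - \<Lambda>\<bar> < \<bar>\<Lambda>\<bar> / 2 \<and> \<bar>q x - L\<bar> < \<bar>\<Lambda>\<bar> / 8"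
    unfolding eventually_at_bot_linorder dist_real_def by blast
  define x where "x = min x0 (-1)"
  have x: "x < 0" "x \<le> x0" by (auto simp: x_def)
  \<comment> \<open>The mean value theorem on \<open>[2 x, x]\<close> bounds
    \<open>|\<xi> q' \<xi>|\<close> by twice an increment of \<open>q\<close>. That is less than
    \<open>|\<Lambda>| / 2\<close> once \<open>q\<close> is within \<open>|\<Lambda>| / 8\<close> of
    its limit, while convergence to \<open>\<Lambda>\<close> keeps it above
    \<open>|\<Lambda>| / 2\<close>.\<close>
  have "2 * x < x" using x by simp
  have "\<exists>\<xi>. \<xi> > 2 * x \<and> \<xi> < x \<and> q x - q (2 * x) = (x - 2 * x) * q' \<xi>"
    by (rule MVT2[OF \<open>2 * x < x\<close>]) (use der x in auto)
  then obtain \<xi> where \<xi>: "2 * x < \<xi>" "\<xi> < x" "q x - q (2 * x) = - x * q' \<xi>" by auto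
  have "\<bar>\<xi> * q' \<xi> - \<Lambda>\<bar> < \<bar>\<Lambda>\<bar> / 2" using x0[of \<xi>] \<xi> x by simp
  then have big: "\<bar>\<xi> * q' \<xi>\<bar> > \<bar>\<Lambda>\<bar> / 2" by linarith
  have "\<bar>\<xi> * q' \<xi>\<bar> \<le> \<bar>2 * x\<bar> * \<bar>q' \<xi>\<bar>" unfolding abs_mult[of \<xi>] using \<xi> x by (intro mult_right_mono) auto
  also have "\<dots> = 2 * \<bar>q x - q (2 * x)\<bar>" unfolding \<xi>(3) by (simp add: abs_mult)
  finally have up: "\<bar>\<xi> * q' \<xi>\<bar> \<le> 2 * \<bar>q x - q (2 * x)\<bar>" .
  have "\<bar>q x - L\<bar> < \<bar>\<Lambda>\<bar> / 8" "\<bar>q (2 * x) - L\<bar> < \<bar>\<Lambda>\<bar> / 8" using x0[of x] x0[of "2 * x"] x by auto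
  moreover have "\<bar>q x - q (2 * x)\<bar> \<le> \<bar>q x - L\<bar> + \<bar>q (2 * x) - L\<bar>"
    using abs_triangle_ineq4[of "q x - L" "q (2 * x) - L"] by simp
  ultimately have "2 * \<bar>q x - q (2 * x)\<bar> < \<bar>\<Lambda>\<bar> / 2" by (simp add: field_simps)
  then show False using big up by linarith
qed


lemma slit_plane_real_eqI:
  assumes "f holomorphic_on slit_plane" "g holomorphic_on slit_plane" "\<And>x::real. x < 1 \<Longrightarrow> f (of_real x) = g (of_real x)"
    and z: "z \<in> slit_plane"
  shows "f z = g z"
proof -
  have "f z - g z = 0"
  proof (rule analytic_continuation[where f = "\<lambda>z. f z - g z" and S = slit_plane and U = "of_real ` {..<1}" and \<xi> = 0])
    show "(\<lambda>z. f z - g z) holomorphic_on slit_plane" by (intro holomorphic_intros assms)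
    show "of_real ` {..<1} \<subseteq> slit_plane" by (auto simp: slit_plane_iff)
    show "0 islimpt complex_of_real ` {..<1}"
    proof (rule islimptI)
      fix T :: "complex set" assume "0 \<in> T" "open T"
      then obtain e where e: "e > 0" "ball 0 e \<subseteq> T" using openE by blast
      have "of_real (- e / 2) \<in> T" using e by (intro subsetD[OF e(2)]) auto
      moreover have "of_real (- e / 2) \<in> complex_of_real ` {..<1}" using e(1) by (intro imageI) simp
      moreover have "complex_of_real (- e / 2) \<noteq> 0" using e(1) by simp
      ultimately show "\<exists>y\<in>of_real ` {..<1}. y \<in> T \<and> y \<noteq> 0" by blast
    qed
  qed (use assms in \<open>auto simp: open_slit_plane connected_slit_plane\<close>)
  then show ?thesis by simp
qed

section \<open>The nondegenerate cases: nonreal and real parameters\<close>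

lemma hyp2F1_riccati:
  fixes a b c z :: complex
  assumes "c \<notin> \<int>\<^sub>\<le>\<^sub>0" "\<And>z. z \<in> slit_plane \<Longrightarrow> hyp2F1 a b c z \<noteq> 0" and z: "z \<in> slit_plane"
  defines "E \<equiv> log_deriv (hyp2F1 a b c)"
  shows "z * (1 - z) * (deriv E z + (E z)\<^sup>2) + (c - (a + b + 1) * z) * E z = a * b"
proof -
  define F where "F = hyp2F1 a b c"
  have nz: "F z \<noteq> 0" using assms(2)[OF z] by (simp add: F_def)
  have 1: "deriv E z + (E z)\<^sup>2 = deriv (deriv F) z / F z"
    unfolding E_def F_def by (rule log_deriv_riccati[OF hyp2F1_holomorphic[OF assms(1)] assms(2) z])
  have 2: "E z = deriv F z / F z" by (simp add: E_def F_def log_deriv_def)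
  have "(z * (1 - z) * deriv (deriv F) z + (c - (a + b + 1) * z) * deriv F z) / F z = a * b"
    unfolding F_def hyp2F1_ode[OF assms(1) z] using nz by (simp add: F_def)
  then show ?thesis unfolding 1 unfolding 2 by (simp add: add_divide_distrib)
qed

text \<open>\<open>E\<close> and \<open>E'\<close> are real on the real axis, so the imaginary part
  of the Riccati equation contains neither \<open>E'\<close> nor \<open>E^2\<close> and determines
  \<open>E\<close> as \<open>m / (1 - \<beta> z)\<close>. The full equation then forces
  \<open>\<beta> = 1\<close>.\<close>

lemma nonreal_parameters_imp_power:
  fixes a b c :: complex
  assumes c: "c \<notin> \<int>\<^sub>\<le>\<^sub>0" and us: "universally_starlike (\<lambda>z. z * hyp2F1 a b c z)"
    and ab: "a * b \<noteq> 0" and nonreal: "\<not> (Im c = 0 \<and> Im (a + b) = 0 \<and> Im (a * b) = 0)"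
    and z: "z \<in> slit_plane"
  shows "(1 - z) * log_deriv (hyp2F1 a b c) z = log_deriv (hyp2F1 a b c) 0"
proof -
  define F where "F = hyp2F1 a b c"
  define E where "E = log_deriv F"
  have F: "F holomorphic_on slit_plane" "F 0 = 1" unfolding F_def using hyp2F1_holomorphic[OF c] hyp2F1_0[OF c] by auto
  note us' = us[folded F_def]
  note nz = universally_starlike_factor_nonzero[OF F us']
  have ric: "z * (1 - z) * (deriv E z + (E z)\<^sup>2) + (c - (a + b + 1) * z) * E z = a * b" if "z \<in> slit_plane" for z
    unfolding E_def F_def by (rule hyp2F1_riccati[OF c _ that]) (use nz in \<open>simp add: F_def\<close>)
  have sl: "of_real x \<in> slit_plane" if "x < 1" for x using that by (simp add: slit_plane_iff)
  define m where "m = Re (E 0)"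
  have E0: "E 0 = of_real m" using log_deriv_real[OF F us', of 0] by (simp add: m_def E_def complex_eq_iff)
  have cm: "c * of_real m = a * b" using ric[of 0] E0 by simp
  have "m \<noteq> 0" using cm ab by auto
  then have m: "m > 0" using log_deriv_0_nonneg[OF F us'] by (simp add: m_def E_def)
  define e e' where "e x = Re (E (of_real x))" and "e' x = Re (deriv E (of_real x))" for x
  have Ereal: "E (of_real x) = of_real (e x)" if "x < 1" for x
    using log_deriv_real[OF F us' that] by (simp add: E_def e_def complex_eq_iff)
  have E'real: "deriv E (of_real x) = of_real (e' x)" if "x < 1" for x
    using deriv_log_deriv_real[OF F us' that] by (simp add: E_def e'_def complex_eq_iff)
  have lin: "(Im c - Im (a + b) * x) * e x = Im c * m" if x: "x < 1" for x
  proof -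
    have "of_real (x * (1 - x) * (e' x + (e x)\<^sup>2)) + (c - (a + b + 1) * of_real x) * of_real (e x) = c * of_real m"
      using ric[OF sl[OF x]] unfolding Ereal[OF x] E'real[OF x] cm by simp
    from arg_cong[where f = Im, OF this] have "Im ((c - (a + b + 1) * of_real x) * of_real (e x)) = Im (c * of_real m)"
      by (simp only: plus_complex.simps Im_complex_of_real add_0_left)
    then show ?thesis by (simp add: algebra_simps)
  qed
  \<comment> \<open>Otherwise \<open>lin\<close> makes \<open>E\<close> vanish on the real axis off
    0, which contradicts \<open>E 0 = m > 0\<close> by continuity.\<close>
  have C: "Im c \<noteq> 0"
  proof
    assume C0: "Im c = 0"
    then have "Im (a * b) = 0" unfolding cm[symmetric] by simp
    then have B: "Im (a + b) \<noteq> 0" using nonreal C0 by blast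
    have "e x = 0" if "x < 1" "x \<noteq> 0" for x using lin[OF that(1)] C0 B that(2) by simp
    moreover have "((\<lambda>x. e x) \<longlongrightarrow> Re (E 0)) (at_left (0::real))"
      unfolding e_def E_def by (intro tendsto_Re isCont_tendsto_compose[OF isCont_log_deriv[OF F us' zero_in_slit_plane]])
        (auto intro!: tendsto_eq_intros)
    moreover have "\<forall>\<^sub>F x in at_left (0::real). e x = 0"
      unfolding eventually_at_left_field using calculation(1) by (intro exI[of _ "-1"]) auto
    ultimately have "((\<lambda>x. 0) \<longlongrightarrow> Re (E 0)) (at_left (0::real))" using Lim_transform_eventually by fast
    then have "Re (E 0) = 0" using tendsto_unique[OF trivial_limit_at_left_real _ tendsto_const] by force
    then show False using m by (simp add: m_def)
  qed
  define \<beta> where "\<beta> = Im (a + b) / Im c"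
  have lin': "(1 - \<beta> * x) * e x = m" if "x < 1" for x
  proof -
    have "Im c * ((1 - \<beta> * x) * e x) = (Im c - (Im c * \<beta>) * x) * e x"
      by (simp add: algebra_simps)
    also have "Im c * \<beta> = Im (a + b)" using C by (simp add: \<beta>_def)
    finally have "Im c * ((1 - \<beta> * x) * e x) = Im c * m" unfolding lin[OF that] .
    then show ?thesis using C by simp
  qed
  \<comment> \<open>For \<open>\<beta> = 0\<close> the function \<open>E\<close> would be a positive
    constant on the real axis, against \<open>1 + x E x \<ge> 0\<close>; for
    \<open>\<beta> < 0\<close> it would have a pole on the negative axis.\<close>
  have \<beta>pos: "\<beta> > 0"
  proof (rule ccontr)
    assume "\<not> \<beta> > 0"
    then consider "\<beta> = 0" | "\<beta> < 0" by linarith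
    then show False
    proof cases
      case 1
      define x where "x = - 2 / m"
      have x: "x < 0" "x * m = - 2" using m by (auto simp: x_def divide_neg_pos)
      have "e x = m" using lin'[of x] 1 x(1) by simp
      moreover have "1 + x * e x \<ge> 0" using mult_log_deriv_ge[OF F us', of x] x(1) by (simp add: e_def E_def)
      ultimately show False using x(2) by simp
    next
      case 2
      define x where "x = 1 / \<beta>"
      have x: "x < 1" "\<beta> * x = 1" using 2 by (auto simp: x_def intro: less_trans[OF divide_pos_neg[of 1 \<beta>]])
      show False using lin'[OF x(1)] x(2) m by simp
    qed
  qed
  have hol: "(\<lambda>z. (1 - of_real \<beta> * z) * E z) holomorphic_on slit_plane"
    unfolding E_def by (intro holomorphic_intros log_deriv_holomorphic[OF F us'])
  have eq: "(1 - of_real \<beta> * z) * E z = of_real m" if z: "z \<in> slit_plane" for z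
  proof (rule slit_plane_real_eqI[OF hol _ _ z])
    show "(1 - of_real \<beta> * of_real x) * E (of_real x) = of_real m" if "x < 1" for x
      unfolding Ereal[OF that] using arg_cong[where f = complex_of_real, OF lin'[OF that]] by simp
  qed simp
  have eq': "(1 - of_real \<beta> * z) * deriv E z = of_real \<beta> * E z" if z: "z \<in> slit_plane" for z
  proof -
    have "((\<lambda>z. (1 - of_real \<beta> * z) * E z) has_field_derivative (1 - of_real \<beta> * z) * deriv E z - of_real \<beta> * E z) (at z)"
      unfolding E_def using log_deriv_has_derivative[OF F us' z] by (auto intro!: derivative_eq_intros)
    moreover have "((\<lambda>z. (1 - of_real \<beta> * z) * E z) has_field_derivative 0) (at z)"
      by (rule has_field_derivative_transform_within_open[OF DERIV_const open_slit_plane z]) (use eq in simp)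
    ultimately show ?thesis using DERIV_unique by fastforce
  qed
  define \<kappa> where "\<kappa> = complex_of_real (m * (\<beta> + m))"
  have quad: "z * (1 - z) * \<kappa> + (c - (a + b + 1) * z) * of_real m * (1 - of_real \<beta> * z) = a * b * (1 - of_real \<beta> * z)\<^sup>2"
    if z: "z \<in> slit_plane" for z
  proof -
    define u where "u = 1 - of_real \<beta> * z"
    have 1: "u * (u * deriv E z) = of_real \<beta> * of_real m"
      using eq'[OF z] eq[OF z] unfolding u_def by (metis mult.left_commute)
    have 2: "(u * E z)\<^sup>2 = (of_real m)\<^sup>2" using eq[OF z] unfolding u_def by simp
    have "u\<^sup>2 * (z * (1 - z) * (deriv E z + (E z)\<^sup>2) + (c - (a + b + 1) * z) * E z) =
      z * (1 - z) * (u * (u * deriv E z) + (u * E z)\<^sup>2) + (c - (a + b + 1) * z) * (u * E z) * u"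
      by (simp add: power2_eq_square algebra_simps)
    also have "u * E z = of_real m" using eq[OF z] by (simp add: u_def)
    finally show ?thesis unfolding ric[OF z] 1 u_def[symmetric] by (simp add: \<kappa>_def power2_eq_square algebra_simps)
  qed
  \<comment> \<open>In essence \<open>quad\<close> at \<open>1 / \<beta>\<close>, but that point may
    lie on the cut. So the coefficients are first shown to vanish, using the points 0, -1 and -2,
    and the reversed polynomial is then evaluated at \<open>\<beta>\<close>.\<close>
  have "\<kappa> * (of_real \<beta> - 1) = 0"
  proof -
    define B M s t where "B = complex_of_real \<beta>" and "M = complex_of_real m" and "s = a + b + 1" and "t = a * b"
    define p0 p1 p2 where "p0 = c * M - t" and "p1 = \<kappa> - c * M * B - s * M + 2 * t * B" and "p2 = - \<kappa> + s * M * B - t * B\<^sup>2"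
    have P: "p0 + p1 * z + p2 * z\<^sup>2 = 0" if "z \<in> slit_plane" for z
      using quad[OF that] unfolding p0_def p1_def p2_def B_def[symmetric] M_def[symmetric] s_def[symmetric] t_def[symmetric]
      by (simp add: power2_eq_square algebra_simps)
    have "p0 = 0" using P[of 0] by simp
    moreover have "p1 * (- 1) + p2 = 0" using P[of "-1"] \<open>p0 = 0\<close> by (simp add: slit_plane_iff)
    moreover have "p1 * (- 2) + p2 * 4 = 0" using P[of "-2"] \<open>p0 = 0\<close> by (simp add: slit_plane_iff)
    ultimately have "p0 = 0" "p1 = 0" "p2 = 0" by (auto simp: algebra_simps)
    moreover have "\<kappa> * (B - 1) = B\<^sup>2 * p0 + B * p1 + p2"
      unfolding p0_def p1_def p2_def by (simp add: power2_eq_square algebra_simps)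
    ultimately show ?thesis by (simp add: B_def)
  qed
  moreover have "\<kappa> \<noteq> 0" using m \<beta>pos by (simp add: \<kappa>_def add_pos_pos less_imp_neq[symmetric] flip: of_real_add)
  ultimately have "complex_of_real \<beta> = 1" by simp
  then show ?thesis using eq[OF z] E0 unfolding E_def F_def by simp
qed

text \<open>On the negative axis \<open>q x = x E x\<close> increases and stays above -1, so it has
  a limit \<open>- l\<close> with \<open>0 \<le> l \<le> 1\<close>. The Riccati equation makes
  \<open>x q'\<close> converge too, necessarily to 0, and the limit equation identifies
  \<open>l\<close> with \<open>a\<close> or \<open>b\<close>. The bound \<open>l \<le> 1\<close> is
  the last disjunction of the conclusion.\<close>

lemma real_parameters_bounds:
  fixes a b c :: complex
  assumes c: "c \<notin> \<int>\<^sub>\<le>\<^sub>0" and us: "universally_starlike (\<lambda>z. z * hyp2F1 a b c z)"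
    and ab: "a * b \<noteq> 0" and ca: "c \<noteq> a" and cb: "c \<noteq> b"
    and real: "Im c = 0" "Im (a + b) = 0" "Im (a * b) = 0"
  shows "Im a = 0 \<and> Im b = 0 \<and> 0 < Re a \<and> Re a < Re c \<and> 0 < Re b \<and> Re b < Re c \<and> (Re a \<le> 1 \<or> Re b \<le> 1)"
proof -
  define F where "F = hyp2F1 a b c"
  define E where "E = log_deriv F"
  have F: "F holomorphic_on slit_plane" "F 0 = 1" unfolding F_def using hyp2F1_holomorphic[OF c] hyp2F1_0[OF c] by auto
  note us' = us[folded F_def]
  note nz = universally_starlike_factor_nonzero[OF F us']
  have ric: "z * (1 - z) * (deriv E z + (E z)\<^sup>2) + (c - (a + b + 1) * z) * E z = a * b" if "z \<in> slit_plane" for z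
    unfolding E_def F_def by (rule hyp2F1_riccati[OF c _ that]) (use nz in \<open>simp add: F_def\<close>)
  have sl: "of_real x \<in> slit_plane" if "x < 1" for x using that by (simp add: slit_plane_iff)
  define e e' where "e x = Re (E (of_real x))" and "e' x = Re (deriv E (of_real x))" for x
  have Ereal: "E (of_real x) = of_real (e x)" if "x < 1" for x
    using log_deriv_real[OF F us' that] by (simp add: E_def e_def complex_eq_iff)
  have E'real: "deriv E (of_real x) = of_real (e' x)" if "x < 1" for x
    using deriv_log_deriv_real[OF F us' that] by (simp add: E_def e'_def complex_eq_iff)
  define C s t where "C = Re c" and "s = Re (a + b)" and "t = Re (a * b)"
  have cC: "c = of_real C" and ss: "a + b = of_real s" and tt: "a * b = of_real t"
    using real by (auto simp: C_def s_def t_def complex_eq_iff)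
  have ricr: "x * (1 - x) * (e' x + (e x)\<^sup>2) + (C - (s + 1) * x) * e x = t" if x: "x < 1" for x
  proof -
    have "complex_of_real (x * (1 - x) * (e' x + (e x)\<^sup>2) + (C - (s + 1) * x) * e x) = of_real t"
      using ric[OF sl[OF x]] unfolding Ereal[OF x] E'real[OF x] cC ss tt by simp
    then show ?thesis by (simp only: of_real_eq_iff)
  qed
  define q where "q x = x * e x" for x
  have qge: "q x \<ge> -1" if "x \<le> 0" for x
    using mult_log_deriv_ge[OF F us', of x] that by (simp add: q_def e_def E_def)
  have qmono: "q x \<le> q y" if "x \<le> y" "y \<le> 0" for x y
    using mult_log_deriv_mono[OF F us', of x y] that by (simp add: q_def e_def E_def)
  obtain L where L: "(q \<longlongrightarrow> L) at_bot" "-1 \<le> L" "L \<le> q 0"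
    using mono_bounded_tendsto_at_bot[of q "-1"] qmono qge by blast
  define l where "l = - L"
  have l: "0 \<le> l" "l \<le> 1" using L by (auto simp: l_def q_def)
  define q' where "q' x = e x + x * e' x" for x
  have der: "(q has_real_derivative q' x) (at x)" if x: "x < 0" for x
  proof -
    have "((\<lambda>z. 1 + z * E z) has_field_derivative E (of_real x) + of_real x * deriv E (of_real x)) (at (of_real x))"
      unfolding E_def by (rule mult_log_deriv_has_derivative[OF F us']) (use x in \<open>simp add: slit_plane_iff\<close>)
    from has_field_derivative_Re[OF has_vector_derivative_real_field[OF this]]
    have "((\<lambda>x. 1 + q x) has_real_derivative q' x) (at x)"
      by (simp add: q_def[abs_def] q'_def e_def e'_def)
    from DERIV_diff[OF this DERIV_const[of 1]] show ?thesis by simp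
  qed
  have inv: "((\<lambda>x. 1 / (1 - x)) \<longlongrightarrow> 0) (at_bot :: real filter)"
    using tendsto_divide_0[OF tendsto_const filterlim_at_top_imp_at_infinity[OF
      filterlim_tendsto_add_at_top[OF tendsto_const filterlim_uminus_at_top_at_bot]], of 1 1] by simp
  \<comment> \<open>The Riccati equation solved for \<open>x q'\<close>, arranged so that on the
    right \<open>x\<close> occurs outside \<open>q\<close> only through \<open>1 / (1 - x)\<close>,
    which tends to 0.\<close>
  have theta: "x * q' x = (1 / (1 - x) - 1) * (t + s * q x + (q x)\<^sup>2) - q x * (q x + C - 1) * (1 / (1 - x))" if x: "x < 0" for x
  proof -
    have "(1 - x) * (x * q' x) = x * (t + s * q x + (q x)\<^sup>2) - q x * (q x + C - 1)"
    proof -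
      have "x * (1 - x) * e' x = t - x * (1 - x) * (e x)\<^sup>2 - (C - (s + 1) * x) * e x"
        using ricr[of x] x by (simp add: algebra_simps)
      then have "x * (x * (1 - x) * e' x) = x * (t - x * (1 - x) * (e x)\<^sup>2 - (C - (s + 1) * x) * e x)"
        by (simp only:)
      then show ?thesis unfolding q'_def q_def by (simp add: power2_eq_square algebra_simps)
    qed
    then have "x * q' x = (x * (t + s * q x + (q x)\<^sup>2) - q x * (q x + C - 1)) / (1 - x)"
      using x by (simp only: nonzero_eq_divide_eq mult.commute[of "1 - x"])
    moreover have "1 / (1 - x) - 1 = x / (1 - x)" using x by (simp add: field_simps)
    moreover have "(x * T - Y) / (1 - x) = x / (1 - x) * T - Y * (1 / (1 - x))" for T Y
      by (simp add: diff_divide_distrib)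
    ultimately show ?thesis by (simp only:)
  qed
  have "((\<lambda>x. (1 / (1 - x) - 1) * (t + s * q x + (q x)\<^sup>2) - q x * (q x + C - 1) * (1 / (1 - x))) \<longlongrightarrow>
     (0 - 1) * (t + s * L + L\<^sup>2) - L * (L + C - 1) * 0) at_bot"
    by (intro tendsto_intros inv L(1))
  then have lim: "((\<lambda>x. x * q' x) \<longlongrightarrow> (0 - 1) * (t + s * L + L\<^sup>2) - L * (L + C - 1) * 0) at_bot"
    by (rule Lim_transform_eventually)
       (use theta in \<open>auto intro!: eventually_mono[OF eventually_le_at_bot[of "-1"]]\<close>)
  have root: "(0 - 1) * (t + s * L + L\<^sup>2) - L * (L + C - 1) * 0 = 0"
    by (rule log_scale_derivative_limit_zero[where q = q and q' = q', OF L(1) _ lim]) (rule der)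
  then have "l\<^sup>2 - s * l + t = 0" by (simp add: l_def algebra_simps)
  then have "complex_of_real (l\<^sup>2 - s * l + t) = 0" by simp
  then have "(of_real l - a) * (of_real l - b) = 0"
    by (simp add: ss[symmetric] tt[symmetric] power2_eq_square algebra_simps)
  \<comment> \<open>One parameter is the real number \<open>l\<close>; as \<open>a + b\<close> is
    real, so is the other. This excludes a conjugate pair.\<close>
  then have lab: "a = of_real l \<or> b = of_real l" by auto
  have ima: "Im a = 0" "Im b = 0" using lab real(2) by auto
  define m1 m2 where "m1 = e 0" and "m2 = e' 0"
  have m1: "m1 \<ge> 0" using log_deriv_0_nonneg[OF F us'] by (simp add: m1_def e_def E_def)
  have m21: "m2 \<le> m1" using deriv_log_deriv_le[OF F us'] by (simp add: m1_def m2_def e_def e'_def E_def)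
  have m12: "m1\<^sup>2 \<le> l * m2"
  proof -
    have "(Re (log_deriv F 0))\<^sup>2 \<le> l * Re (deriv (log_deriv F) 0)"
    proof (rule log_deriv_sq_le[OF F us'])
      show "((\<lambda>x. x * Re (log_deriv F (of_real x))) \<longlongrightarrow> - l) at_bot"
        using L(1) by (simp add: q_def[abs_def] e_def E_def l_def)
      show "((\<lambda>x. x * (Re (log_deriv F (of_real x)) + x * Re (deriv (log_deriv F) (of_real x)))) \<longlongrightarrow> 0) at_bot"
        using lim unfolding root by (simp add: q'_def e_def e'_def E_def)
    qed (rule l)
    then show ?thesis by (simp add: m1_def m2_def e_def e'_def E_def)
  qed
  have cm1: "C * m1 = t" using ricr[of 0] by (simp add: m1_def)
  have C0: "C \<noteq> 0" "C + 1 \<noteq> 0"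
  proof -
    show "C \<noteq> 0" using c cC by auto
    show "C + 1 \<noteq> 0"
    proof
      assume "C + 1 = 0"
      then have "complex_of_real (C + 1) = 0" by simp
      then have "c + 1 = 0" by (simp add: cC)
      then show False using not_nonpos_Int_plus_nat[OF c, of 1] by simp
    qed
  qed
  \<comment> \<open>At 0 the Riccati equation yields only \<open>cm1\<close>, since
    \<open>E'\<close> is multiplied by \<open>z\<close> there; the second relation is read off from
    the second Taylor coefficient of \<open>F\<close>.\<close>
  have cm2: "(C + 1) * m2 = m1 * (1 + s - m1)"
  proof -
    define D1 D2 where "D1 = deriv F 0" and "D2 = deriv (deriv F) 0"
    have D1: "D1 = of_real m1" using Ereal[of 0] F(2) by (simp add: E_def log_deriv_def D1_def m1_def)
    have "deriv E 0 + (E 0)\<^sup>2 = D2 / F 0"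
      unfolding E_def D2_def by (rule log_deriv_riccati[OF F(1) nz]) auto
    then have D2: "D2 = of_real (m2 + m1\<^sup>2)" using Ereal[of 0] E'real[of 0] F(2) by (simp add: m1_def m2_def)
    have "c * (c + 1) * D2 = a * (a + 1) * b * (b + 1)"
      unfolding D2_def F_def by (rule hyp2F1_0[OF c])
    also have "\<dots> = (a * b) * (a * b + (a + b) + 1)" by (simp add: algebra_simps)
    finally have "complex_of_real (C * (C + 1) * (m2 + m1\<^sup>2)) = of_real (t * (t + s + 1))"
      unfolding D2 cC ss tt by simp
    then have "C * (C + 1) * (m2 + m1\<^sup>2) = t * (t + s + 1)" by (simp only: of_real_eq_iff)
    then have "C * ((C + 1) * (m2 + m1\<^sup>2)) = C * (m1 * (C * m1 + s + 1))" unfolding cm1[symmetric] by (simp add: mult_ac)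
    then have "(C + 1) * (m2 + m1\<^sup>2) = m1 * (C * m1 + s + 1)" using C0 by simp
    then show ?thesis by (simp add: power2_eq_square algebra_simps)
  qed
  define A B where "A = Re a" and "B = Re b"
  have aA: "a = of_real A" and bB: "b = of_real B" using ima by (auto simp: A_def B_def complex_eq_iff)
  have sAB: "s = A + B" and tAB: "t = A * B" using ima by (simp_all add: s_def t_def A_def B_def)
  have neq: "C \<noteq> A" "C \<noteq> B" "A * B \<noteq> 0" using ca cb ab unfolding aA bB cC by auto
  have "A = l \<or> B = l" using lab unfolding aA bB by simp
  then show ?thesis
  proof
    assume "A = l"
    then have "0 < A \<and> A < C \<and> 0 < B \<and> B < C"
      using cm1 cm2 m1 m21 m12 l C0 neq sAB tAB by (intro parameter_inequalities[of C m1 A B m2]) (auto simp: add.assoc)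
    then show ?thesis using ima l \<open>A = l\<close> by (simp add: A_def B_def C_def)
  next
    assume "B = l"
    then have "0 < B \<and> B < C \<and> 0 < A \<and> A < C"
      using cm1 cm2 m1 m21 m12 l C0 neq sAB tAB by (intro parameter_inequalities[of C m1 B A m2]) (auto simp: add_ac mult.commute)
    then show ?thesis using ima l \<open>B = l\<close> by (simp add: A_def B_def C_def)
  qed
qed

theorem theorem5p2:
  fixes a b c :: complex and f :: "complex \<Rightarrow> complex"
  assumes "Re a \<le> Re b"
    and "c \<notin> \<int>\<^sub>\<le>\<^sub>0"
    and "f = (\<lambda>z. z * hyp2F1 a b c z)"
  shows "universally_starlike f \<longleftrightarrow>
    (a \<in> \<real> \<and> b \<in> \<real> \<and> c \<in> \<real> \<and> 0 < Re a \<and> Re a \<le> 1 \<and> 0 < Re b \<and> Re b < Re c) \<or>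
    (\<exists>k::real. 0 \<le> k \<and> k \<le> 1 \<and>
       (\<forall>z\<in>slit_plane. f z = z * (1 - z) powr (- complex_of_real k)))"
    (is "?us \<longleftrightarrow> ?real \<or> ?power")
proof
  assume "?real \<or> ?power"
  then show ?us
  proof
    assume r: ?real
    then have "a = of_real (Re a)" "b = of_real (Re b)" "c = of_real (Re c)" by auto
    \<comment> \<open>The condition that the first parameter is below the third follows from
      \<open>Re a \<le> Re b < Re c\<close>.\<close>
    moreover have "universally_starlike (\<lambda>z. z * hyp2F1 (of_real (Re a)) (of_real (Re b)) (of_real (Re c)) z)"
      using r assms(1) by (intro hyp2F1_universally_starlike) auto
    ultimately show ?us unfolding assms(3) by simp
  next
    assume ?power
    then show ?us using power_universally_starlike by blast
  qed
next
  assume ?us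
  note us = this[unfolded assms(3)]
  define F where "F = hyp2F1 a b c"
  have F: "F holomorphic_on slit_plane" "F 0 = 1"
    unfolding F_def using hyp2F1_holomorphic[OF assms(2)] hyp2F1_0[OF assms(2)] by auto
  note us' = us[folded F_def]
  have power: ?power if "\<And>z. z \<in> slit_plane \<Longrightarrow> (1 - z) * log_deriv F z = k" for k
    using constant_log_deriv_imp_power[OF F us' that] unfolding assms(3) F_def[symmetric] by auto
  \<comment> \<open>The first case collects the parameters for which the series reduces to a power,
    real or not; removing it supplies the strictness conditions of the third.\<close>
  consider "a * b = 0 \<or> c = a \<or> c = b"
    | "a * b \<noteq> 0" "\<not> (Im c = 0 \<and> Im (a + b) = 0 \<and> Im (a * b) = 0)"
    | "a * b \<noteq> 0" "c \<noteq> a" "c \<noteq> b" "Im c = 0" "Im (a + b) = 0" "Im (a * b) = 0" by blast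
  then show "?real \<or> ?power"
  proof cases
    case 1
    then obtain k where "\<And>z. z \<in> slit_plane \<Longrightarrow> (1 - z) * deriv F z = k * F z"
      using hyp2F1_degenerate[OF assms(2) 1] unfolding F_def by blast
    then have "(1 - z) * log_deriv F z = k" if "z \<in> slit_plane" for z
      using universally_starlike_factor_nonzero[OF F us' that] that by (simp add: log_deriv_def)
    then show ?thesis using power by blast
  next
    case 2
    then show ?thesis
      using power nonreal_parameters_imp_power[OF assms(2) us 2] unfolding F_def[symmetric] by blast
  next
    case 3
    \<comment> \<open>One of the two upper parameters is at most 1, and \<open>Re a\<close> is the
      smaller one.\<close>
    from real_parameters_bounds[OF assms(2) us 3] 3(4) assms(1)
    have ?real by (auto simp: complex_is_Real_iff)
    then show ?thesis by blast
  qed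
qed

end
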